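(* Let $\boldsymbol{k}$ be a field of characteristic zero. Let $Z$ be a finite set of $m$ points of $\check{\mathbb P}^2$ (the dual of $\mathbb P^2=\mathbb P^2_{\boldsymbol{k}}$) and let $y\in\check{\mathbb P}^2\setminus Z$. If $y$ lies on no trisecant line to $Z$, then $a_y=d_{Z,y}$, where $a_y\le b_y$ are the integers with $(\mathcal T_Z)_{|H_y}\simeq\mathcal O_{H_y}(-a_y)\oplus\mathcal O_{H_y}(-b_y)$.
   Context: Each point $y\in\check{\mathbb P}^2$ corresponds to a line $H_y\subset\mathbb P^2$. For $Z=\{z_1,\dots,z_m\}\subset\check{\mathbb P}^2$, let $f_i$ be a linear form defining $H_{z_i}$, $f=\prod_i f_i$, $D_Z=\bigcup_i H_{z_i}$, and $$\mathcal T_Z=\mathcal T_{\mathbb P^2}(-\log D_Z)=\ker\Bigl((\partial_0 f,\partial_1 f,\partial_2 f):\mathcal O_{\mathbb P^2}^{3}\to\mathcal O_{\mathbb P^2}(m-1)\Bigr),$$ where $\partial_i=\partial/\partial x_i$; it is a rank-2 vector bundle, so its restriction to the line $H_y$ splits as $\mathcal O_{H_y}(-a_y)\oplus\mathcal O_{H_y}(-b_y)$ with $a_y\le b_y$, $a_y+b_y=m-1$. A line $L\subset\check{\mathbb P}^2$ is trisecant to $Z$ if $|L\cap Z|\ge 3$. The number $d_{Z,y}$ is the smallest non-negative integer $d$ such that there is a curve in $\check{\mathbb P}^2$ of degree $d+1$ passing through $Z$ and having multiplicity (at least) $d$ at $y$; equivalently, the smallest $d$ with $\mathrm H^0(\check{\mathbb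 P}^2,\mathcal I_y^d\otimes\mathcal I_Z(d+1))\neq 0$, where $\mathcal I_y,\mathcal I_Z$ are the ideal sheaves of $y$ and $Z$ in $\check{\mathbb P}^2$. *)

theory Defs
  imports
    "HOL-Analysis.Analysis"
    "HOL-Library.Poly_Mapping"
    "HOL-Library.Set_Algebras"
    "HOL-Computational_Algebra.Fraction_Field"
begin

section \<open>Polynomials in three variables\<close>

type_synonym 'k poly3 = "(3 \<Rightarrow>\<^sub>0 nat) \<Rightarrow>\<^sub>0 'k"

definition mdeg :: "(3 \<Rightarrow>\<^sub>0 nat) \<Rightarrow> nat" where
  "mdeg m = (\<Sum>i\<in>UNIV. Poly_Mapping.lookup m i)"

definition homogeneous :: "nat \<Rightarrow> 'k::field poly3 \<Rightarrow> bool" where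
  "homogeneous n p \<longleftrightarrow> (\<forall>m\<in>Poly_Mapping.keys p. mdeg m = n)"

definition hom_component :: "nat \<Rightarrow> 'k::field poly3 \<Rightarrow> 'k poly3" where
  "hom_component n p =
     (\<Sum>m | m \<in> Poly_Mapping.keys p \<and> mdeg m = n. Poly_Mapping.single m (Poly_Mapping.lookup p m))"

definition evalp :: "'k::field poly3 \<Rightarrow> 'k^3 \<Rightarrow> 'k" where
  "evalp p v =
     (\<Sum>m\<in>Poly_Mapping.keys p. Poly_Mapping.lookup p m * (\<Prod>i\<in>UNIV. (v $ i) ^ Poly_Mapping.lookup m i))"

text \<open>The truncated subtraction on exponents is harmless: where it truncates, the coefficient is 0.\<close>

definition partial_deriv :: "3 \<Rightarrow> 'k::field poly3 \<Rightarrow> 'k poly3" where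
  "partial_deriv i p =
     (\<Sum>m\<in>Poly_Mapping.keys p. Poly_Mapping.single (m - Poly_Mapping.single i 1)
        (of_nat (Poly_Mapping.lookup m i) * Poly_Mapping.lookup p m))"

definition linear_form :: "'k::field^3 \<Rightarrow> 'k poly3" where
  "linear_form v = (\<Sum>i\<in>UNIV. Poly_Mapping.single (Poly_Mapping.single i 1) (v $ i))"


section \<open>The dual projective plane\<close>

text \<open>
  A rational point of the dual plane is a line through the origin in the space of linear forms;
  a linear form is given by its coefficient vector in \<open>'k^3\<close>.  Lines of the dual plane are the
  two-dimensional subspaces, and incidence is inclusion.
\<close>

definition dual_points :: "('k::field^3) set set" where
  "dual_points = {U. vec.subspace U \<and> vec.dim U = 1}"

definition dual_lines :: "('k::field^3) set set" where
  "dual_lines = {U. vec.subspace U \<and> vec.dim U = 2}"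

definition trisecant :: "('k::field^3) set set \<Rightarrow> ('k^3) set \<Rightarrow> bool" where
  "trisecant Z L \<longleftrightarrow> L \<in> dual_lines \<and> card {z \<in> Z. z \<subseteq> L} \<ge> 3"

text \<open>
  The homogeneous ideal of a point: the field being infinite, vanishing on the whole line \<open>y\<close>
  through the origin forces every homogeneous component to vanish at the point.
\<close>

definition point_ideal :: "('k::field^3) set \<Rightarrow> 'k poly3 set" where
  "point_ideal y = {g. \<forall>v\<in>y. evalp g v = 0}"

text \<open>
  The curve \<open>g = 0\<close> has multiplicity at least \<open>d\<close> at \<open>y\<close> iff its local equation lies in the \<open>d\<close>-th
  power of the maximal ideal of the local ring at \<open>y\<close>, that is, iff \<open>g\<close> lies in the \<open>d\<close>-th power of
  the ideal of \<open>y\<close> after multiplication by some \<open>h\<close> not vanishing at \<open>y\<close>.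
  The power \<open>point_ideal y ^ d\<close> is the elementwise one, the set of all \<open>d\<close>-fold products.
\<close>

definition multiplicity_at_least :: "'k::field poly3 \<Rightarrow> ('k^3) set \<Rightarrow> nat \<Rightarrow> bool" where
  "multiplicity_at_least g y d \<longleftrightarrow>
     (\<exists>h. h \<notin> point_ideal y \<and> h * g \<in> module.span (*) (point_ideal y ^ d))"

definition d_number :: "('k::field^3) set set \<Rightarrow> ('k^3) set \<Rightarrow> nat" where
  "d_number Z y =
     (LEAST d. \<exists>g. g \<noteq> 0 \<and> homogeneous (d + 1) g \<and> (\<forall>z\<in>Z. g \<in> point_ideal z) \<and>
        multiplicity_at_least g y d)"


section \<open>The projective plane as a scheme\<close>

definition Proj :: "'k::field poly3 set set" where
  "Proj = {P. module.subspace (*) P \<and> (\<forall>p\<in>P. \<forall>n. hom_component n p \<in> P) \<and>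
     1 \<notin> P \<and> (\<forall>a b. a * b \<in> P \<longrightarrow> a \<in> P \<or> b \<in> P) \<and>
     \<not> range linear_form \<subseteq> P}"

definition zariski :: "'k::field poly3 set topology" where
  "zariski = topology (\<lambda>U. \<exists>A. U = {P \<in> Proj. \<not> A \<subseteq> P})"

lemma openin_zariski:
  fixes U :: "'k::field poly3 set set"
  shows "openin zariski U \<longleftrightarrow> (\<exists>A. U = {P \<in> Proj. \<not> A \<subseteq> P})"
proof -
  have "istopology (\<lambda>U :: 'k poly3 set set. \<exists>A. U = {P \<in> Proj. \<not> A \<subseteq> P})"
    unfolding istopology_def
  proof (intro conjI allI impI)
    fix S T :: "'k poly3 set set"
    assume "\<exists>A. S = {P \<in> Proj. \<not> A \<subseteq> P}" "\<exists>A. T = {P \<in> Proj. \<not> A \<subseteq> P}"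
    then obtain A B where AB: "S = {P \<in> Proj. \<not> A \<subseteq> P}" "T = {P \<in> Proj. \<not> B \<subseteq> P}"
      by blast
    have "A * B \<subseteq> P \<longleftrightarrow> A \<subseteq> P \<or> B \<subseteq> P" if "P \<in> Proj" for P
    proof -
      have m: "Modules.module ((*) :: 'k poly3 \<Rightarrow> _)"
        by unfold_locales (simp_all add: algebra_simps)
      have P: "module.subspace (*) P" "\<And>a b. a * b \<in> P \<Longrightarrow> a \<in> P \<or> b \<in> P"
        using that by (auto simp: Proj_def)
      have "a * b \<in> P" if "a \<in> P \<or> b \<in> P" for a b
        using that module.subspace_scale[OF m P(1)] by (metis mult.commute)
      then show ?thesis
        using P(2) by (auto simp: set_times_def) blast
    qed
    then have "S \<inter> T = {P \<in> Proj. \<not> A * B \<subseteq> P}"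
      unfolding AB by auto
    then show "\<exists>A. S \<inter> T = {P \<in> Proj. \<not> A \<subseteq> P}" by blast
  next
    fix \<K> :: "'k poly3 set set set"
    assume "\<forall>K\<in>\<K>. \<exists>A. K = {P \<in> Proj. \<not> A \<subseteq> P}"
    then obtain A where A: "\<And>K. K \<in> \<K> \<Longrightarrow> K = {P \<in> Proj. \<not> A K \<subseteq> P}"
      by metis
    have "\<Union>\<K> = {P \<in> Proj. \<not> (\<Union>K\<in>\<K>. A K) \<subseteq> P}"
    proof (intro set_eqI iffI)
      fix P assume "P \<in> \<Union>\<K>"
      then obtain K where "K \<in> \<K>" "P \<in> K" by blast
      then show "P \<in> {P \<in> Proj. \<not> (\<Union>K\<in>\<K>. A K) \<subseteq> P}" using A[of K] by auto
    next
      fix P assume "P \<in> {P \<in> Proj. \<not> (\<Union>K\<in>\<K>. A K) \<subseteq> P}"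
      then obtain K where "P \<in> Proj" "K \<in> \<K>" "\<not> A K \<subseteq> P" by blast
      then show "P \<in> \<Union>\<K>" using A[of K] by auto
    qed
    then show "\<exists>A. \<Union>\<K> = {P \<in> Proj. \<not> A \<subseteq> P}" by blast
  qed
  then show ?thesis
    unfolding zariski_def by (simp only: topology_inverse')
qed


section \<open>Sheaves of modules on the plane\<close>

text \<open>
  All sheaves on the plane considered here are subsheaves of a constant sheaf \<open>K^r\<close>, where \<open>K\<close> is the
  fraction field of the polynomial ring: the plane is integral, so the sections of
  \<open>O(n)\<close> over a nonempty open set are the elements of \<open>K\<close> which at each of its points are a
  quotient of homogeneous polynomials of degree difference \<open>n\<close>, with denominator not vanishing at
  the point.
\<close>

type_synonym 'k ratf3 = "'k poly3 fract"

type_synonym ('k, 'r) sheaf3 = "'k poly3 set set \<Rightarrow> ('k ratf3 ^ 'r) set"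

definition twist :: "int \<Rightarrow> 'k::field poly3 set set \<Rightarrow> 'k ratf3 set" where
  "twist n U =
     (if U = {} then {0}
      else {g. \<forall>P\<in>U. \<exists>a b i j. homogeneous i a \<and> homogeneous j b \<and> int i - int j = n \<and>
                  b \<notin> P \<and> g = Fract a b})"

text \<open>The direct sum of the line bundles \<open>O(n $ i)\<close>.\<close>

definition twist_sum :: "int ^ 'r \<Rightarrow> ('k::field, 'r::finite) sheaf3" where
  "twist_sum n U = {v. \<forall>i. v $ i \<in> twist (n $ i) U}"

definition log_tangent :: "'k::field poly3 \<Rightarrow> ('k, 3) sheaf3" where
  "log_tangent f U =
     {v \<in> twist_sum 0 U. (\<Sum>i\<in>UNIV. v $ i * Fract (partial_deriv i f) 1) = 0}"

text \<open>Inside a constant sheaf the direct limit defining a stalk is a union.\<close>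

definition stalk :: "('k::field, 'r::finite) sheaf3 \<Rightarrow> 'k poly3 set \<Rightarrow> ('k ratf3 ^ 'r) set" where
  "stalk F P = (\<Union>U\<in>{U. openin zariski U \<and> P \<in> U}. F U)"


section \<open>Restriction to a line\<close>

definition line_of :: "('k::field^3) set \<Rightarrow> 'k poly3 set set" where
  "line_of y = {P \<in> Proj. linear_form ` y \<subseteq> P}"

text \<open>
  The ideal sheaf of \<open>line_of y\<close> with its reduced structure is the image of multiplication
  \<open>O(-1) \<rightarrow> O\<close> by a linear form representing \<open>y\<close>.
\<close>

definition line_ideal :: "('k::field^3) set \<Rightarrow> ('k, 1) sheaf3" where
  "line_ideal y U = {v. \<exists>w\<in>y. \<exists>g\<in>twist (-1) U. v $ 1 = Fract (linear_form w) 1 * g}"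

text \<open>\<open>ideal_stalk F y P\<close> is the submodule \<open>I\<^sub>P F\<^sub>P\<close> of the stalk \<open>F\<^sub>P\<close>, where \<open>I\<close> is the ideal sheaf of the line.\<close>

definition ideal_stalk ::
    "('k::field, 'r::finite) sheaf3 \<Rightarrow> ('k^3) set \<Rightarrow> 'k poly3 set \<Rightarrow> ('k ratf3 ^ 'r) set" where
  "ideal_stalk F y P =
     {\<Sum>j<n. (c j $ 1) *s t j | (n::nat) c t.
        \<forall>j<n. c j \<in> stalk (line_ideal y) P \<and> t j \<in> stalk F P}"

text \<open>
  The pullback \<open>F|\<^sub>H\<close> to \<open>H = line_of y\<close> as a sheaf of \<open>O\<^sub>H\<close>-modules.  Its stalk at \<open>P\<close> is
  \<open>F\<^sub>P \<otimes> O\<^sub>H\<^sub>,\<^sub>P = F\<^sub>P / I\<^sub>P F\<^sub>P\<close>, and its sections over an open subset \<open>W\<close> of \<open>H\<close> are the families of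
  elements of these stalks (cosets) locally induced by sections of \<open>F\<close>.
  In particular \<open>restr (twist_sum (0::int^1)) y\<close> is the structure sheaf \<open>O\<^sub>H\<close>.
\<close>

type_synonym ('k, 'r) section3 = "'k poly3 set \<Rightarrow> ('k ratf3 ^ 'r) set"

definition restr ::
    "('k::field, 'r::finite) sheaf3 \<Rightarrow> ('k^3) set \<Rightarrow> 'k poly3 set set \<Rightarrow> ('k, 'r) section3 set" where
  "restr F y W =
     {s \<in> extensional W. \<forall>P\<in>W. \<exists>V t. openin zariski V \<and> P \<in> V \<and> t \<in> F V \<and>
        (\<forall>Q\<in>V \<inter> W. s Q = (+) t ` ideal_stalk F y Q)}"

definition sec_add ::
    "'k::field poly3 set set \<Rightarrow> ('k, 'r::finite) section3 \<Rightarrow> ('k, 'r) section3 \<Rightarrow> ('k, 'r) section3" where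
  "sec_add W s t = restrict (\<lambda>P. {u + v | u v. u \<in> s P \<and> v \<in> t P}) W"

definition sec_scale ::
    "('k::field, 'r::finite) sheaf3 \<Rightarrow> ('k^3) set \<Rightarrow> 'k poly3 set set \<Rightarrow>
     ('k, 1) section3 \<Rightarrow> ('k, 'r) section3 \<Rightarrow> ('k, 'r) section3" where
  "sec_scale F y W c s =
     restrict (\<lambda>P. {(g $ 1) *s v + n | g v n. g \<in> c P \<and> v \<in> s P \<and> n \<in> ideal_stalk F y P}) W"

text \<open>Isomorphism of \<open>F|\<^sub>H\<close> and \<open>G|\<^sub>H\<close> as sheaves of \<open>O\<^sub>H\<close>-modules.\<close>

definition restr_iso ::
    "('k::field, 'r::finite) sheaf3 \<Rightarrow> ('k, 's::finite) sheaf3 \<Rightarrow> ('k^3) set \<Rightarrow> bool" where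
  "restr_iso F G y \<longleftrightarrow>
     (\<exists>\<phi> :: 'k poly3 set set \<Rightarrow> ('k, 'r) section3 \<Rightarrow> ('k, 's) section3.
        \<forall>W. openin (subtopology zariski (line_of y)) W \<longrightarrow>
          bij_betw (\<phi> W) (restr F y W) (restr G y W) \<and>
          (\<forall>s\<in>restr F y W. \<forall>t\<in>restr F y W. \<phi> W (sec_add W s t) = sec_add W (\<phi> W s) (\<phi> W t)) \<and>
          (\<forall>c\<in>restr (twist_sum (0::int^1)) y W. \<forall>s\<in>restr F y W.
             \<phi> W (sec_scale F y W c s) = sec_scale G y W c (\<phi> W s)) \<and>
          (\<forall>W' \<subseteq> W. openin (subtopology zariski (line_of y)) W' \<longrightarrow>
             (\<forall>s\<in>restr F y W. \<phi> W' (restrict s W') = restrict (\<phi> W s) W')))"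

text \<open>\<open>log_tangent f\<close> restricted to the line of \<open>y\<close> is isomorphic to \<open>O(-a) \<oplus> O(-b)\<close>.\<close>

definition splits_on_line :: "'k::field poly3 \<Rightarrow> ('k^3) set \<Rightarrow> int \<Rightarrow> int \<Rightarrow> bool" where
  "splits_on_line f y a b \<longleftrightarrow>
     restr_iso (log_tangent f) (twist_sum (vector [- a, - b] :: int^2)) y"

end

theory Submission
  imports Defs "HOL-Computational_Algebra.Polynomial_Factorial"
begin

text \<open>
  Why the theorem holds.  Let \<open>w\<close> span \<open>y\<close>, let \<open>H\<close> be the line \<open>w = 0\<close> and let \<open>f\<close> be the product
  of the forms \<open>s\<close> of the arrangement.  A local section of the bundle is a vector field \<open>\<theta>\<close> with
  \<open>\<theta>(f) = 0\<close>.  If all components of \<open>\<theta>\<close> are divisible by \<open>w\<close>, the quotient again kills \<open>f\<close>, so the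
  restriction to \<open>H\<close> embeds into the trivial bundle of rank three on \<open>H\<close>
  (\<open>res_eq_0_imp_multiple\<close>).  The image is described by two conditions.  Since \<open>\<theta>(f) = 0\<close>, the form \<open>s\<close>
  divides \<open>\<theta>(s)\<close>, so on \<open>H\<close> the function \<open>\<theta>(s)\<close> vanishes at the point where \<open>H\<close> meets \<open>s = 0\<close>;
  and the sum of the quotients \<open>\<theta>(s) / s\<close> is zero.  Conversely, these conditions suffice: a point of \<open>H\<close>
  on three lines of the arrangement would give a trisecant through \<open>y\<close>, so at most two lines pass through
  each point of \<open>H\<close>, their forms are part of a basis, and the components of \<open>\<theta>\<close> in the dual basis can
  be lifted off \<open>H\<close> one by one (\<open>tangent_data_lifts\<close>).

  Hence a section of the \<open>d\<close>-th twist of the restricted bundle is a vector \<open>N\<close> of three binary forms of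
  degree \<open>d\<close> on \<open>H\<close> with these properties.  A point \<open>v\<close> of the dual plane other than \<open>y\<close> cuts \<open>H\<close> in
  one point; pairing \<open>v\<close> with the value of \<open>N\<close> there defines a form \<open>g\<close> on the dual plane.  It has degree
  \<open>d + 1\<close> and lies in the \<open>d\<close>-th power of the ideal of \<open>y\<close>, and it vanishes on \<open>Z\<close> because of the
  vanishing of \<open>N\<close> paired with \<open>s\<close>.  All curves with multiplicity \<open>d\<close> at \<open>y\<close> arise in this way, because
  such a form is linear along the lines through \<open>y\<close>.  The vectors \<open>N\<close> with \<open>g = 0\<close> are the multiples of the
  Euler field, and for nonempty \<open>Z\<close> in characteristic zero these are complementary to the vectors with vanishing sum of
  quotients.  So the \<open>d\<close>-th twist has a nonzero section iff a curve as in the definition of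
  \<open>d_number\<close> exists (\<open>twisted_imp_curve\<close>, \<open>curve_imp_twisted\<close>).  On the other hand the \<open>d\<close>-th twist of
  \<open>O(-a) \<oplus> O(-b)\<close> has a nonzero section iff \<open>a \<le> d\<close>, and \<open>a\<close> is the least such \<open>d\<close>.

  To compare the two sides, the sections of a restricted sheaf over an open subset of \<open>H\<close> are identified
  with the vectors over the function field of \<open>H\<close> that lift at every point (\<open>restr_eq\<close>).
  An isomorphism concerns the untwisted sheaves; a section of the twist is therefore encoded as a pair of
  sections over two standard affine charts whose ratio is a power of the coordinate \<open>\<tau>\<close>, a condition
  that every isomorphism of modules preserves (\<open>twisted_transfer\<close>).
\<close>

section \<open>Evaluation homomorphisms\<close>

text \<open>
  Evaluation of a polynomial at a triple in any algebra over the field.  Points of three-space, parametrised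
  lines, cones over lines, the grading and the Kronecker substitution all are special cases.
\<close>
definition eval_hom :: "('k::field \<Rightarrow> 'r::comm_ring_1) \<Rightarrow> (3 \<Rightarrow> 'r) \<Rightarrow> 'k poly3 \<Rightarrow> 'r" where
  "eval_hom \<iota> x p =
     (\<Sum>m\<in>Poly_Mapping.keys p. \<iota> (Poly_Mapping.lookup p m) * (\<Prod>i\<in>UNIV. x i ^ Poly_Mapping.lookup m i))"

locale unital_hom =
  fixes h :: "'a::comm_ring_1 \<Rightarrow> 'b::comm_ring_1"
  assumes add: "h (a + b) = h a + h b"
    and mult: "h (a * b) = h a * h b"
    and one: "h 1 = 1"
begin

lemma zero: "h 0 = 0"
  using add[of 0 0] by simp

lemma uminus: "h (- a) = - h a"
  using add[of "- a" a] zero by (simp add: add_eq_0_iff2)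

lemma sum: "h (sum f A) = (\<Sum>a\<in>A. h (f a))"
  by (induction A rule: infinite_finite_induct) (simp_all add: zero add)

lemma prod: "h (prod f A) = (\<Prod>a\<in>A. h (f a))"
  by (induction A rule: infinite_finite_induct) (simp_all add: one mult)

lemma power: "h (a ^ n) = h a ^ n"
  by (induction n) (simp_all add: one mult)

lemma of_nat: "h (of_nat n) = of_nat n"
  by (induction n) (simp_all add: zero one add)

end

lemma poly3_induct [case_names zero single add]:
  assumes "P 0" and "\<And>m c. P (Poly_Mapping.single m c)"
    and "\<And>p q. P p \<Longrightarrow> P q \<Longrightarrow> P (p + q)"
  shows "P (p :: 'k::field poly3)"
proof (induction p rule: update_induct)
  case const
  show ?case by (rule assms(1))
next
  case (update f a b)
  have "Poly_Mapping.update a b f = f + Poly_Mapping.single a b"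
    using update(1) by (intro poly_mapping_eqI)
      (auto simp: lookup_update lookup_add lookup_single when_def in_keys_iff)
  then show ?case using assms(2,3) update(3) by simp
qed

lemma prod_monom:
  "(\<Prod>i\<in>A. monom (c i) (n i)) = monom (\<Prod>i\<in>A. c i :: 'r::comm_ring_1) (\<Sum>i\<in>A. n i)"
  by (induction A rule: infinite_finite_induct) (simp_all add: mult_monom)

context
  fixes \<iota> :: "'k::field \<Rightarrow> 'r::comm_ring_1" and x :: "3 \<Rightarrow> 'r"
  assumes \<iota>: "unital_hom \<iota>"
begin

interpretation unital_hom \<iota> by (rule \<iota>)

lemma eval_hom_superset:
  assumes "finite A" and "Poly_Mapping.keys p \<subseteq> A"
  shows "eval_hom \<iota> x p =
    (\<Sum>m\<in>A. \<iota> (Poly_Mapping.lookup p m) * (\<Prod>i\<in>UNIV. x i ^ Poly_Mapping.lookup m i))"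
  unfolding eval_hom_def using assms
  by (intro sum.mono_neutral_left) (auto simp: zero in_keys_iff)

lemma eval_hom_add: "eval_hom \<iota> x (p + q) = eval_hom \<iota> x p + eval_hom \<iota> x q"
  using keys_add[of p q]
  by (simp add: eval_hom_superset[of "Poly_Mapping.keys p \<union> Poly_Mapping.keys q"]
      lookup_add add distrib_right sum.distrib)

lemma eval_hom_single:
  "eval_hom \<iota> x (Poly_Mapping.single m c) = \<iota> c * (\<Prod>i\<in>UNIV. x i ^ Poly_Mapping.lookup m i)"
  by (subst eval_hom_superset[of "{m}"]) (auto simp: in_keys_iff lookup_single when_def split: if_splits)

lemma eval_hom_mult: "eval_hom \<iota> x (p * q) = eval_hom \<iota> x p * eval_hom \<iota> x q"
proof (induction p rule: poly3_induct)
  case zero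
  show ?case by (simp add: eval_hom_def)
next
  case (add p p')
  then show ?case by (simp add: distrib_right eval_hom_add)
next
  case p: (single m c)
  show ?case
  proof (induction q rule: poly3_induct)
    case zero
    show ?case by (simp add: eval_hom_def)
  next
    case (single n d)
    show ?case
      by (simp add: mult_single eval_hom_single mult lookup_add power_add prod.distrib algebra_simps)
  next
    case (add p q)
    then show ?case by (simp add: distrib_left eval_hom_add)
  qed
qed

lemma unital_hom_eval_hom: "unital_hom (eval_hom \<iota> x)"
proof
  show "eval_hom \<iota> x 1 = 1"
    using eval_hom_single[of 0 1] by (simp add: one)
qed (simp_all add: eval_hom_add eval_hom_mult)

lemma eval_hom_comp:
  assumes "unital_hom h"
  shows "h (eval_hom \<iota> x p) = eval_hom (\<lambda>c. h (\<iota> c)) (\<lambda>i. h (x i)) p"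
proof -
  interpret h: unital_hom h by (rule assms)
  show ?thesis by (simp add: eval_hom_def h.sum h.mult h.prod h.power)
qed

text \<open>\<open>X i \<mapsto> s x\<^sub>i\<close> separates the homogeneous components by the powers of the new variable \<open>s\<close>.\<close>

lemma coeff_eval_hom_graded:
  "coeff (eval_hom (\<lambda>c. [:\<iota> c:]) (\<lambda>i. [:0, x i:]) p) n = eval_hom \<iota> x (hom_component n p)"
proof -
  let ?t = "\<lambda>m. \<iota> (Poly_Mapping.lookup p m) * (\<Prod>i\<in>UNIV. x i ^ Poly_Mapping.lookup m i)"
  have *: "[:\<iota> (Poly_Mapping.lookup p m):] * (\<Prod>i\<in>UNIV. [:0, x i:] ^ Poly_Mapping.lookup m i)
      = monom (?t m) (mdeg m)" for m
  proof -
    have "[:0, x i:] ^ k = monom (x i ^ k) k" for i k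
    proof -
      have "[:0, x i:] = monom (x i) 1" by (simp add: monom_altdef)
      then show ?thesis by (simp add: monom_power)
    qed
    then have "(\<Prod>i\<in>UNIV. [:0, x i:] ^ Poly_Mapping.lookup m i)
        = monom (\<Prod>i\<in>UNIV. x i ^ Poly_Mapping.lookup m i) (mdeg m)"
      by (simp add: mdeg_def prod_monom)
    then show ?thesis by (simp add: smult_monom)
  qed
  have "coeff (eval_hom (\<lambda>c. [:\<iota> c:]) (\<lambda>i. [:0, x i:]) p) n
      = (\<Sum>m\<in>Poly_Mapping.keys p. if mdeg m = n then ?t m else 0)"
    unfolding eval_hom_def * by (simp add: coeff_sum)
  also have "\<dots> = (\<Sum>m | m \<in> Poly_Mapping.keys p \<and> mdeg m = n. ?t m)"
    by (simp add: sum.inter_filter)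
  also have "\<dots> = eval_hom \<iota> x (hom_component n p)"
    unfolding hom_component_def
    by (simp add: unital_hom.sum[OF unital_hom_eval_hom] eval_hom_single)
  finally show ?thesis .
qed

end

abbreviation const3 :: "'k::field \<Rightarrow> 'k poly3" where
  "const3 \<equiv> Poly_Mapping.single 0"

abbreviation var3 :: "3 \<Rightarrow> 'k::field poly3" where
  "var3 i \<equiv> Poly_Mapping.single (Poly_Mapping.single i 1) 1"

lemma unital_hom_id: "unital_hom (\<lambda>c. c)"
  by unfold_locales simp_all

lemma unital_hom_const3: "unital_hom const3"
  by unfold_locales (simp_all add: single_add mult_single)

lemma unital_hom_pCons: "unital_hom \<iota> \<Longrightarrow> unital_hom (\<lambda>c. [:\<iota> c:])"
  by (auto simp: unital_hom_def)

lemma unital_hom_const_poly: "unital_hom (\<lambda>c. [:c:])"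
  by (rule unital_hom_pCons[OF unital_hom_id])

lemma unital_hom_poly: "unital_hom (\<lambda>q. poly q t)"
  by unfold_locales simp_all

lemma evalp_eq_eval_hom: "evalp p v = eval_hom (\<lambda>c. c) (($) v) p"
  by (simp add: evalp_def eval_hom_def)

lemma prod_single_exponent:
  "(\<Prod>i\<in>UNIV. x i ^ Poly_Mapping.lookup (Poly_Mapping.single j 1) i) = (x (j::3) :: 'r::comm_ring_1)"
proof -
  have "(\<Prod>i\<in>UNIV. x i ^ Poly_Mapping.lookup (Poly_Mapping.single j 1) i) = (\<Prod>i\<in>UNIV. if j = i then x i else 1)"
    by (rule prod.cong) (simp_all add: lookup_single when_def)
  then show ?thesis by simp
qed

lemma eval_hom_const: "unital_hom \<iota> \<Longrightarrow> eval_hom \<iota> x (const3 c) = \<iota> c"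
  by (simp add: eval_hom_single)

lemma eval_hom_linear_form:
  "unital_hom \<iota> \<Longrightarrow> eval_hom \<iota> x (linear_form v) = (\<Sum>i\<in>UNIV. \<iota> (v $ i) * x i)"
  unfolding linear_form_def
  by (simp add: unital_hom.sum[OF unital_hom_eval_hom] eval_hom_single prod_single_exponent[unfolded One_nat_def])

lemma eval_hom_self: "eval_hom const3 var3 p = p"
proof (induction p rule: poly3_induct)
  case zero
  show ?case by (simp add: eval_hom_def)
next
  case (add p q)
  then show ?case by (simp add: eval_hom_add unital_hom_const3)
next
  case (single m c)
  have pow: "var3 i ^ k = (Poly_Mapping.single (Poly_Mapping.single i k) 1 :: 'a poly3)" for i k
    by (induction k) (simp_all add: mult_single single_add[symmetric])
  have "(\<Prod>i\<in>A. Poly_Mapping.single (Poly_Mapping.single i (Poly_Mapping.lookup m i)) 1)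
      = (Poly_Mapping.single (\<Sum>i\<in>A. Poly_Mapping.single i (Poly_Mapping.lookup m i)) 1 :: 'a poly3)" for A
    by (induction A rule: infinite_finite_induct) (simp_all add: mult_single)
  moreover have "(\<Sum>i\<in>UNIV. Poly_Mapping.single i (Poly_Mapping.lookup m i)) = m"
    by (rule poly_mapping_eqI) (simp add: lookup_sum lookup_single when_def)
  ultimately show ?case
    by (simp add: eval_hom_single[OF unital_hom_const3] pow mult_single del: One_nat_def)
qed

section \<open>Homogeneous components\<close>

lemma lookup_hom_component:
  "Poly_Mapping.lookup (hom_component n p) m = (if mdeg m = n then Poly_Mapping.lookup p m else 0)"
proof -
  have "Poly_Mapping.lookup (hom_component n p) m =
      (\<Sum>m' | m' \<in> Poly_Mapping.keys p \<and> mdeg m' = n. if m' = m then Poly_Mapping.lookup p m' else 0)"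
    unfolding hom_component_def by (simp add: lookup_sum lookup_single when_def)
  also have "\<dots> = (if mdeg m = n then Poly_Mapping.lookup p m else 0)"
    by (simp add: in_keys_iff)
  finally show ?thesis .
qed

lemma homogeneous_iff_hom_component: "homogeneous n p \<longleftrightarrow> hom_component n p = p"
  unfolding homogeneous_def poly_mapping_eq_iff fun_eq_iff lookup_hom_component
  by (auto simp: in_keys_iff)

text \<open>
  The substitution of \<open>s X\<^sub>i\<close> for \<open>X\<^sub>i\<close> turns gradedness into an identity of polynomials in \<open>s\<close>.
\<close>
definition graded :: "'k::field poly3 \<Rightarrow> 'k poly3 poly" where
  "graded = eval_hom (\<lambda>c. [:const3 c:]) (\<lambda>i. [:0, var3 i:])"

lemma coeff_graded: "coeff (graded p) n = hom_component n p"
  unfolding graded_def coeff_eval_hom_graded[OF unital_hom_const3] by (rule eval_hom_self)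

lemma unital_hom_graded: "unital_hom graded"
  unfolding graded_def by (intro unital_hom_eval_hom unital_hom_pCons unital_hom_const3)

lemma poly_graded: "poly (graded p) 1 = p"
  unfolding graded_def
  by (subst eval_hom_comp[OF unital_hom_pCons[OF unital_hom_const3] unital_hom_poly])
    (simp add: eval_hom_self del: One_nat_def)

lemma sum_hom_component: "(\<Sum>n\<le>degree (graded p). hom_component n p) = p"
  using poly_graded[of p] by (simp add: poly_altdef coeff_graded)

lemma homogeneous_iff_graded: "homogeneous n p \<longleftrightarrow> graded p = monom p n"
proof
  assume "homogeneous n p"
  then show "graded p = monom p n"
    by (intro poly_eqI poly_mapping_eqI)
      (auto simp: coeff_graded lookup_hom_component homogeneous_def in_keys_iff)
next
  assume "graded p = monom p n"
  then show "homogeneous n p"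
    by (metis coeff_graded coeff_monom homogeneous_iff_hom_component)
qed

lemma homogeneous_zero [simp]: "homogeneous n 0"
  by (simp add: homogeneous_def)

lemma homogeneous_add: "homogeneous n p \<Longrightarrow> homogeneous n q \<Longrightarrow> homogeneous n (p + q)"
  by (simp add: homogeneous_iff_graded unital_hom.add[OF unital_hom_graded] add_monom)

lemma homogeneous_sum: "(\<And>a. a \<in> A \<Longrightarrow> homogeneous n (f a)) \<Longrightarrow> homogeneous n (sum f A)"
  by (induction A rule: infinite_finite_induct) (auto simp: homogeneous_add)

lemma homogeneous_mult: "homogeneous n p \<Longrightarrow> homogeneous m q \<Longrightarrow> homogeneous (n + m) (p * q)"
  by (simp add: homogeneous_iff_graded unital_hom.mult[OF unital_hom_graded] mult_monom)

lemma homogeneous_const: "homogeneous 0 (const3 c)"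
  by (simp add: homogeneous_def mdeg_def)

lemma homogeneous_one: "homogeneous 0 1"
  using homogeneous_const[of 1] by simp

lemma homogeneous_power: "homogeneous n p \<Longrightarrow> homogeneous (k * n) (p ^ k)"
  by (induction k) (auto simp: homogeneous_one intro!: homogeneous_mult)

lemma homogeneous_linear_form: "homogeneous 1 (linear_form v)"
  unfolding linear_form_def
  by (rule homogeneous_sum) (simp add: homogeneous_def mdeg_def lookup_single when_def)

lemma homogeneous_var: "homogeneous 1 (var3 i)"
  by (simp add: homogeneous_def mdeg_def lookup_single when_def)

lemma homogeneous_hom_component: "homogeneous n (hom_component n p)"
  by (auto simp: homogeneous_def in_keys_iff lookup_hom_component split: if_splits)

lemma hom_component_of_homogeneous:
  "homogeneous n p \<Longrightarrow> hom_component k p = (if k = n then p else 0)"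
  by (metis coeff_graded coeff_monom homogeneous_iff_graded)

lemma homogeneous_factor_linear:
  assumes "homogeneous (Suc n) (l * q)" and "homogeneous 1 l" and "l \<noteq> 0"
  shows "homogeneous n q"
proof -
  have "monom l 1 * graded q = monom (l * q) (Suc n)"
    using assms by (simp add: homogeneous_iff_graded unital_hom.mult[OF unital_hom_graded])
  also have "\<dots> = monom l 1 * monom q n"
    by (simp add: mult_monom)
  finally show ?thesis
    using assms(3) by (simp add: homogeneous_iff_graded)
qed

lemma homogeneous_factor_linear_0:
  assumes "homogeneous 0 (l * q)" and "homogeneous 1 l" and "l \<noteq> 0"
  shows "q = 0"
proof (rule ccontr)
  assume "q \<noteq> 0"
  have "monom l 1 * graded q = monom (l * q) 0"
    using assms by (simp add: homogeneous_iff_graded unital_hom.mult[OF unital_hom_graded])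
  then have "coeff (monom l 1 * graded q) 0 = l * q" by simp
  moreover have "coeff (monom l 1 * graded q) 0 = 0" by (simp add: coeff_mult)
  ultimately show False using \<open>q \<noteq> 0\<close> assms(3) by simp
qed

lemma eval_hom_scale:
  assumes "homogeneous n p"
  shows "eval_hom \<iota> (\<lambda>i. s * x i) p = s ^ n * eval_hom \<iota> x p"
  using assms
  by (auto simp: eval_hom_def homogeneous_def mdeg_def sum_distrib_left power_mult_distrib prod.distrib
      power_sum[symmetric] mult_ac intro!: sum.cong)

lemma vec_nth_lambda: "($) (\<chi> i. f i) = f"
  by (simp add: fun_eq_iff)

lemma evalp_scale: "homogeneous n p \<Longrightarrow> evalp p (s *s v) = s ^ n * evalp p v"
  using eval_hom_scale[of n p "\<lambda>c. c" s "($) v"]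
  by (simp add: evalp_eq_eval_hom vector_scalar_mult_def vec_nth_lambda)

section \<open>Polynomials as functions\<close>

lemma evalp_hom: "unital_hom (\<lambda>p. evalp p v)"
  unfolding evalp_eq_eval_hom by (rule unital_hom_eval_hom[OF unital_hom_id])

lemma base_digits:
  fixes N a b c a' b' c' :: nat
  assumes "a + N * b + N\<^sup>2 * c = a' + N * b' + N\<^sup>2 * c'"
    and "a < N" "b < N" "a' < N" "b' < N"
  shows "a = a' \<and> b = b' \<and> c = c'"
proof -
  have e: "a + N * (b + N * c) = a' + N * (b' + N * c')"
    using assms(1) by (simp add: power2_eq_square algebra_simps)
  have "a = a'"
    using arg_cong[OF e, of "\<lambda>x. x mod N"] assms by simp
  moreover have f: "b + N * c = b' + N * c'"
    using e assms(2) \<open>a = a'\<close> by simp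
  moreover have "b = b'"
    using arg_cong[OF f, of "\<lambda>x. x mod N"] assms by simp
  ultimately show ?thesis using assms by simp
qed

lemma infinite_field: "infinite (UNIV :: 'k::field_char_0 set)"
  by (rule infinite_UNIV_char_0)

lemma poly_eq_0_if_vanishing:
  fixes q :: "'k::field_char_0 poly"
  assumes "\<And>t. poly q t = 0"
  shows "q = 0"
  using assms poly_all_0_iff_0 by blast

text \<open>
  By the Kronecker substitution \<open>(t, t^N, t^(N^2))\<close>, distinct monomials with exponents below \<open>N\<close> become distinct
  powers of \<open>t\<close>, and a polynomial in one variable over an infinite field is determined by its values.
\<close>
lemma evalp_eq_0_imp_eq_0:
  fixes p :: "'k::field_char_0 poly3"
  assumes "\<And>v. evalp p v = 0"
  shows "p = 0"
proof -
  \<comment> \<open>a bound for all exponents, used as the base of a positional system\<close>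
  define N where "N = Suc (\<Sum>m\<in>Poly_Mapping.keys p. mdeg m)"
  define w :: "3 \<Rightarrow> nat" where "w i = (if i = 1 then 1 else if i = 2 then N else N\<^sup>2)" for i
  define E where "E m = (\<Sum>i\<in>UNIV. w i * Poly_Mapping.lookup m i)" for m
  have less: "Poly_Mapping.lookup m i < N" if "m \<in> Poly_Mapping.keys p" for m i
  proof -
    have "Poly_Mapping.lookup m i \<le> mdeg m"
      unfolding mdeg_def by (rule member_le_sum) auto
    also have "\<dots> \<le> (\<Sum>m\<in>Poly_Mapping.keys p. mdeg m)"
      by (rule member_le_sum) (use that in auto)
    finally show ?thesis by (simp add: N_def)
  qed
  have inj: "m = m'" if "m \<in> Poly_Mapping.keys p" "m' \<in> Poly_Mapping.keys p" "E m = E m'" for m m'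
  proof -
    have "Poly_Mapping.lookup m i = Poly_Mapping.lookup m' i" for i
      using base_digits[of "Poly_Mapping.lookup m 1" N "Poly_Mapping.lookup m 2" "Poly_Mapping.lookup m 3"
          "Poly_Mapping.lookup m' 1" "Poly_Mapping.lookup m' 2" "Poly_Mapping.lookup m' 3"]
        less[OF that(1)] less[OF that(2)] that(3) exhaust_3[of i]
      by (auto simp: E_def sum_3 w_def)
    then show ?thesis by (intro poly_mapping_eqI)
  qed
  define q where "q = eval_hom (\<lambda>c. [:c:]) (\<lambda>i. monom 1 (w i)) p"
  have q: "q = (\<Sum>m\<in>Poly_Mapping.keys p. monom (Poly_Mapping.lookup p m) (E m))"
    unfolding q_def eval_hom_def
    by (simp add: monom_power prod_monom smult_monom E_def mult.commute)
  have "poly q t = evalp p (\<chi> i. t ^ w i)" for t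
    unfolding q_def eval_hom_comp[OF unital_hom_const_poly unital_hom_poly]
    by (simp add: evalp_eq_eval_hom poly_monom vec_nth_lambda)
  then have "q = 0"
    using assms by (intro poly_eq_0_if_vanishing) simp
  have "Poly_Mapping.lookup p m = 0" if m: "m \<in> Poly_Mapping.keys p" for m
  proof -
    have "coeff q (E m) = (\<Sum>m'\<in>Poly_Mapping.keys p. if m' = m then Poly_Mapping.lookup p m' else 0)"
      unfolding q coeff_sum coeff_monom using inj m by (intro sum.cong refl) metis
    also have "\<dots> = Poly_Mapping.lookup p m" using m by simp
    finally show ?thesis using \<open>q = 0\<close> by simp
  qed
  then show ?thesis
    by (metis in_keys_iff lookup_zero poly_mapping_eqI)
qed

section \<open>Partial derivatives\<close>

lemma partial_deriv_superset:
  assumes "finite A" and "Poly_Mapping.keys p \<subseteq> A"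
  shows "partial_deriv i p = (\<Sum>m\<in>A. Poly_Mapping.single (m - Poly_Mapping.single i 1)
    (of_nat (Poly_Mapping.lookup m i) * Poly_Mapping.lookup p m))"
  unfolding partial_deriv_def using assms
  by (intro sum.mono_neutral_left) (auto simp: in_keys_iff)

lemma partial_deriv_zero [simp]: "partial_deriv i 0 = 0"
  by (simp add: partial_deriv_def)

lemma partial_deriv_add: "partial_deriv i (p + q) = partial_deriv i p + partial_deriv i q"
  using keys_add[of p q]
  by (simp add: partial_deriv_superset[of "Poly_Mapping.keys p \<union> Poly_Mapping.keys q"]
      lookup_add distrib_left sum.distrib single_add)

lemma partial_deriv_sum: "partial_deriv i (sum f A) = (\<Sum>a\<in>A. partial_deriv i (f a))"
  by (induction A rule: infinite_finite_induct) (simp_all add: partial_deriv_add)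

lemma partial_deriv_single:
  "partial_deriv i (Poly_Mapping.single m c) =
    Poly_Mapping.single (m - Poly_Mapping.single i 1) (of_nat (Poly_Mapping.lookup m i) * c)"
  by (subst partial_deriv_superset[of "{m}"]) (auto simp: in_keys_iff lookup_single when_def split: if_splits)

lemma single_minus_exponent:
  fixes m n :: "3 \<Rightarrow>\<^sub>0 nat" and c :: "'k::field"
  shows "Poly_Mapping.single (m - Poly_Mapping.single i 1) (of_nat (Poly_Mapping.lookup m i) * c) * Poly_Mapping.single n d
    = Poly_Mapping.single (m + n - Poly_Mapping.single i 1) (of_nat (Poly_Mapping.lookup m i) * (c * d))"
proof (cases "Poly_Mapping.lookup m i = 0")
  case False
  then have "m - Poly_Mapping.single i 1 + n = m + n - Poly_Mapping.single i 1"
    by (intro poly_mapping_eqI) (auto simp: lookup_add lookup_minus lookup_single when_def)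
  then show ?thesis by (simp add: mult_single mult.assoc)
qed simp

lemma partial_deriv_mult:
  "partial_deriv i (p * q) = partial_deriv i p * q + p * partial_deriv i q"
proof (induction p rule: poly3_induct)
  case (add p p')
  then show ?case by (simp add: partial_deriv_add algebra_simps)
next
  case p: (single m c)
  show ?case
  proof (induction q rule: poly3_induct)
    case (add q q')
    then show ?case by (simp add: partial_deriv_add algebra_simps)
  next
    case (single n d)
    show ?case
      using single_minus_exponent[of m i c n d] single_minus_exponent[of n i d m c]
      by (simp add: mult_single partial_deriv_single lookup_add single_add[symmetric] algebra_simps)
  qed simp
qed simp

lemma partial_deriv_one [simp]: "partial_deriv i 1 = 0"
  using partial_deriv_single[of i 0 1] by simp

lemma partial_deriv_linear_form: "partial_deriv i (linear_form v) = const3 (v $ i)"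
proof -
  have "partial_deriv i (linear_form v) = (\<Sum>j\<in>UNIV. if j = i then const3 (v $ j) else 0)"
    unfolding linear_form_def partial_deriv_sum partial_deriv_single
    by (rule sum.cong) (auto simp: lookup_single when_def)
  then show ?thesis by simp
qed

lemma partial_deriv_prod_linear_forms:
  assumes "finite S"
  shows "partial_deriv i (\<Prod>z\<in>S. linear_form (a z))
    = (\<Sum>z\<in>S. const3 (a z $ i) * (\<Prod>z'\<in>S - {z}. linear_form (a z')))"
  using assms
proof (induction S)
  case (insert s S)
  have "(\<Prod>z'\<in>insert s S - {z}. linear_form (a z')) = linear_form (a s) * (\<Prod>z'\<in>S - {z}. linear_form (a z'))"
    if "z \<in> S" for z
  proof -
    have "insert s S - {z} = insert s (S - {z})" using insert(2) that by auto
    then show ?thesis using insert(1,2) by simp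
  qed
  then show ?case
    using insert by (simp add: partial_deriv_mult partial_deriv_linear_form sum_distrib_left mult_ac)
qed simp

section \<open>Specialising fractions\<close>

text \<open>
  A ring homomorphism \<open>R\<close> extends to the fractions whose denominator can be chosen outside the kernel of \<open>R\<close>;
  on these fractions the choice made here does not depend on the representation.
\<close>
definition fract_map :: "('a::idom \<Rightarrow> 'b::idom) \<Rightarrow> 'a fract \<Rightarrow> 'b fract" where
  "fract_map R g = (SOME r. \<exists>a b. R b \<noteq> 0 \<and> g = Fract a b \<and> r = Fract (R a) (R b))"

definition regular :: "('a::idom \<Rightarrow> 'b::idom) \<Rightarrow> 'a fract set" where
  "regular R = {Fract a b | a b. R b \<noteq> 0}"

context
  fixes R :: "'a::idom \<Rightarrow> 'b::idom"
  assumes R: "unital_hom R"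
begin

interpretation unital_hom R by (rule R)

lemma fract_map_Fract:
  assumes "R b \<noteq> 0"
  shows "fract_map R (Fract a b) = Fract (R a) (R b)"
proof -
  have nz: "d \<noteq> 0" if "R d \<noteq> 0" for d
    using that zero by auto
  have "Fract (R a') (R b') = Fract (R a) (R b)"
    if "R b' \<noteq> 0" "Fract a b = Fract a' b'" for a' b'
  proof -
    have "R (a * b') = R (a' * b)"
      using that nz assms by (simp add: eq_fract)
    then show ?thesis using that assms by (simp add: eq_fract mult)
  qed
  then show ?thesis
    unfolding fract_map_def by (intro some_equality) (use assms in blast)+
qed

lemma regularE:
  assumes "g \<in> regular R"
  obtains a b where "R b \<noteq> 0" "b \<noteq> 0" "g = Fract a b" "fract_map R g = Fract (R a) (R b)"
  using assms fract_map_Fract zero unfolding regular_def by blast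

lemma regular_Fract: "R b \<noteq> 0 \<Longrightarrow> Fract a b \<in> regular R"
  by (auto simp: regular_def)

lemma fract_map_poly: "fract_map R (Fract a 1) = Fract (R a) 1"
  using fract_map_Fract[of 1 a] by (simp add: one)

lemma regular_poly: "Fract a 1 \<in> regular R"
  by (rule regular_Fract) (simp add: one)

lemma regular_add:
  assumes "g \<in> regular R" and "h \<in> regular R"
  shows "g + h \<in> regular R" and "fract_map R (g + h) = fract_map R g + fract_map R h"
proof -
  obtain a b where g: "R b \<noteq> 0" "b \<noteq> 0" "g = Fract a b" "fract_map R g = Fract (R a) (R b)"
    using assms(1) by (rule regularE)
  obtain c d where h: "R d \<noteq> 0" "d \<noteq> 0" "h = Fract c d" "fract_map R h = Fract (R c) (R d)"
    using assms(2) by (rule regularE)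
  have "g + h = Fract (a * d + c * b) (b * d)" using g h by simp
  then show "g + h \<in> regular R" "fract_map R (g + h) = fract_map R g + fract_map R h"
    using g h by (simp_all add: regular_Fract fract_map_Fract mult add)
qed

lemma regular_mult:
  assumes "g \<in> regular R" and "h \<in> regular R"
  shows "g * h \<in> regular R" and "fract_map R (g * h) = fract_map R g * fract_map R h"
proof -
  obtain a b where g: "R b \<noteq> 0" "b \<noteq> 0" "g = Fract a b" "fract_map R g = Fract (R a) (R b)"
    using assms(1) by (rule regularE)
  obtain c d where h: "R d \<noteq> 0" "d \<noteq> 0" "h = Fract c d" "fract_map R h = Fract (R c) (R d)"
    using assms(2) by (rule regularE)
  show "g * h \<in> regular R" "fract_map R (g * h) = fract_map R g * fract_map R h"
    using g h by (simp_all add: regular_Fract fract_map_Fract mult)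
qed

lemma regular_zero: "0 \<in> regular R" and fract_map_zero: "fract_map R 0 = 0"
  using regular_poly[of 0] fract_map_poly[of 0] by (simp_all add: zero Zero_fract_def)

lemma regular_uminus:
  assumes "g \<in> regular R"
  shows "- g \<in> regular R" and "fract_map R (- g) = - fract_map R g"
proof -
  obtain a b where g: "R b \<noteq> 0" "b \<noteq> 0" "g = Fract a b" "fract_map R g = Fract (R a) (R b)"
    using assms(1) by (rule regularE)
  show "- g \<in> regular R" "fract_map R (- g) = - fract_map R g"
    using g by (simp_all add: regular_Fract fract_map_Fract uminus)
qed

lemma regular_diff:
  assumes "g \<in> regular R" and "h \<in> regular R"
  shows "g - h \<in> regular R" and "fract_map R (g - h) = fract_map R g - fract_map R h"
  using regular_add[OF assms(1) regular_uminus(1)[OF assms(2)]] regular_uminus(2)[OF assms(2)]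
  by simp_all

lemma regular_sum:
  assumes "\<And>a. a \<in> A \<Longrightarrow> f a \<in> regular R"
  shows "sum f A \<in> regular R" and "fract_map R (sum f A) = (\<Sum>a\<in>A. fract_map R (f a))"
proof -
  have "sum f A \<in> regular R \<and> fract_map R (sum f A) = (\<Sum>a\<in>A. fract_map R (f a))"
    using assms
    by (induction A rule: infinite_finite_induct) (simp_all add: regular_zero fract_map_zero regular_add)
  then show "sum f A \<in> regular R" "fract_map R (sum f A) = (\<Sum>a\<in>A. fract_map R (f a))" by auto
qed

end

section \<open>Dual bases of three-space\<close>

definition dot :: "'k::comm_ring_1 ^ 3 \<Rightarrow> 'k ^ 3 \<Rightarrow> 'k" where
  "dot u v = (\<Sum>i\<in>UNIV. u $ i * v $ i)"

definition cross :: "'k::comm_ring_1 ^ 3 \<Rightarrow> 'k ^ 3 \<Rightarrow> 'k ^ 3" where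
  "cross a b = vector [a $ 2 * b $ 3 - a $ 3 * b $ 2, a $ 3 * b $ 1 - a $ 1 * b $ 3,
     a $ 1 * b $ 2 - a $ 2 * b $ 1]"
lemma dot_expand: "dot u v = u $ 1 * v $ 1 + u $ 2 * v $ 2 + u $ 3 * v $ 3"
  by (simp add: dot_def sum_3)

lemma cross_expand:
  "cross a b $ 1 = a $ 2 * b $ 3 - a $ 3 * b $ 2"
  "cross a b $ 2 = a $ 3 * b $ 1 - a $ 1 * b $ 3"
  "cross a b $ 3 = a $ 1 * b $ 2 - a $ 2 * b $ 1"
  by (simp_all add: cross_def vector_3)
text \<open>
  The last condition is the completeness relation, which expands every vector in either basis.
\<close>
definition dual_bases :: "'k::field ^ 3 \<Rightarrow> 'k ^ 3 \<Rightarrow> 'k ^ 3 \<Rightarrow> 'k ^ 3 \<Rightarrow> 'k ^ 3 \<Rightarrow> 'k ^ 3 \<Rightarrow> bool" where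
  "dual_bases a b c a' b' c' \<longleftrightarrow>
     dot a a' = 1 \<and> dot a b' = 0 \<and> dot a c' = 0 \<and>
     dot b a' = 0 \<and> dot b b' = 1 \<and> dot b c' = 0 \<and>
     dot c a' = 0 \<and> dot c b' = 0 \<and> dot c c' = 1 \<and>
     (\<forall>i j. a $ i * a' $ j + b $ i * b' $ j + c $ i * c' $ j = (if i = j then 1 else 0))"

lemma dual_bases_cross:
  assumes "dot c (cross a b) = 1"
  shows "dual_bases a b c (cross b c) (cross c a) (cross a b)"
proof -
  have "a $ i * cross b c $ j + b $ i * cross c a $ j + c $ i * cross a b $ j
      = (if i = j then dot c (cross a b) else 0)" for i j
    using exhaust_3[of i] exhaust_3[of j]
    by (elim disjE) (simp_all add: dot_expand cross_expand algebra_simps)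
  moreover have "dot a (cross b c) = dot c (cross a b)" "dot b (cross c a) = dot c (cross a b)"
    by (simp_all add: dot_expand cross_expand algebra_simps)
  moreover have "dot a (cross c a) = 0" "dot a (cross a b) = 0" "dot b (cross b c) = 0"
      "dot b (cross a b) = 0" "dot c (cross b c) = 0" "dot c (cross c a) = 0"
    by (simp_all add: dot_expand cross_expand algebra_simps)
  ultimately show ?thesis
    using assms by (simp add: dual_bases_def)
qed
lemma ex_dot_eq_1:
  assumes "(v :: 'k::field ^ 3) \<noteq> 0"
  shows "\<exists>c. dot c v = 1"
proof -
  obtain j where j: "v $ j \<noteq> 0" using assms by (auto simp: vec_eq_iff)
  have "dot (\<chi> i. if i = j then inverse (v $ j) else 0) v = (\<Sum>i\<in>UNIV. if i = j then inverse (v $ j) * v $ j else 0)"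
    unfolding dot_def by (rule sum.cong) auto
  then show ?thesis using j by auto
qed

lemma ex_dual_bases:
  assumes "cross a b \<noteq> (0 :: 'k::field ^ 3)"
  obtains c where "dual_bases a b c (cross b c) (cross c a) (cross a b)"
  using ex_dot_eq_1[OF assms] dual_bases_cross by blast

lemma dot_cross_rotate: "dot u (cross a b) = dot b (cross u a)"
  by (simp add: dot_expand cross_expand algebra_simps)

lemma dot_cross_self: "dot a (cross a b) = 0" "dot b (cross a b) = 0"
  by (simp_all add: dot_expand cross_expand algebra_simps)

lemma dot_add: "dot (a + b) c = dot a c + dot b c" "dot a (b + c) = dot a b + dot a c"
  by (simp_all add: dot_def sum.distrib algebra_simps)

lemma dot_scale: "dot (s *s a) b = s * dot a b" "dot a (s *s b) = s * dot a b"
  by (simp_all add: dot_def sum_distrib_left mult_ac)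

lemma dot_diff: "dot (a - b) c = dot a c - dot b c" "dot a (b - c) = dot a b - dot a c"
  by (simp_all add: dot_def sum_subtractf algebra_simps)

lemma dual_bases_expand:
  assumes "dual_bases a b c a' b' c'"
  shows "v = dot v a' *s a + dot v b' *s b + dot v c' *s c"
proof -
  have d: "a $ i * a' $ j + b $ i * b' $ j + c $ i * c' $ j = (if i = j then 1 else 0)" for i j
    using assms by (simp add: dual_bases_def)
  have "(dot v a' *s a + dot v b' *s b + dot v c' *s c) $ i = v $ i" for i
  proof -
    have "(dot v a' *s a + dot v b' *s b + dot v c' *s c) $ i =
        (\<Sum>j\<in>UNIV. v $ j * (a $ i * a' $ j + b $ i * b' $ j + c $ i * c' $ j))"
      by (simp add: dot_def sum_3 algebra_simps)
    also have "\<dots> = (\<Sum>j\<in>UNIV. if i = j then v $ j else 0)"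
      unfolding d by (intro sum.cong) auto
    also have "\<dots> = v $ i" by simp
    finally show ?thesis .
  qed
  then show ?thesis by (simp add: vec_eq_iff)
qed

text \<open>Only finitely many points \<open>(1, t, t\<^sup>2)\<close> of the moment curve lie on one of finitely many planes.\<close>

lemma ex_dot_nonzero:
  fixes S :: "('k::field_char_0 ^ 3) set"
  assumes "finite S" and "0 \<notin> S"
  shows "\<exists>v. \<forall>s\<in>S. dot v s \<noteq> 0"
proof -
  define q where "q s = [:s $ 1, s $ 2, s $ 3:]" for s :: "'k ^ 3"
  have "finite (\<Union>s\<in>S. {t. poly (q s) t = 0})"
  proof (intro finite_UN_I assms)
    fix s assume "s \<in> S"
    then have "s \<noteq> 0" using assms by auto
    then have "q s \<noteq> 0" by (auto simp: q_def vec_eq_iff forall_3)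
    then show "finite {t. poly (q s) t = 0}" by (rule poly_roots_finite)
  qed
  then obtain t where t: "t \<notin> (\<Union>s\<in>S. {t. poly (q s) t = 0})"
    using infinite_field ex_new_if_finite by blast
  have "dot (vector [1, t, t\<^sup>2]) s = poly (q s) t" for s
    by (simp add: dot_def sum_3 q_def power2_eq_square algebra_simps)
  with t have "\<forall>s\<in>S. dot (vector [1, t, t\<^sup>2]) s \<noteq> 0" by auto
  then show ?thesis by blast
qed

text \<open>
  The vectors \<open>cross w v\<close> fill the plane \<open>w = 0\<close>.  A form \<open>s\<close> vanishes on that whole plane only if it is
  proportional to \<open>w\<close>.
\<close>
lemma ex_cross_avoiding:
  fixes S :: "('k::field_char_0 ^ 3) set"
  assumes "finite S" and "\<And>s. s \<in> S \<Longrightarrow> cross s w \<noteq> 0"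
  shows "\<exists>v. \<forall>s\<in>S. dot s (cross w v) \<noteq> 0"
proof -
  have "\<exists>v. \<forall>s'\<in>(\<lambda>s. cross s w) ` S. dot v s' \<noteq> 0"
    by (rule ex_dot_nonzero) (use assms in force)+
  then show ?thesis by (simp add: dot_cross_rotate[of _ w])
qed

section \<open>Restriction to a parametrised line\<close>

text \<open>
  Restriction to the affine chart \<open>t \<mapsto> q0 + t q1\<close> of a line.  A form of degree \<open>n\<close> becomes a polynomial of
  degree at most \<open>n\<close>, whose coefficient at \<open>n\<close> is the value at the point \<open>q1\<close> at infinity.
\<close>
definition line_poly :: "'k::field ^ 3 \<Rightarrow> 'k ^ 3 \<Rightarrow> 'k poly3 \<Rightarrow> 'k poly" where
  "line_poly q0 q1 = eval_hom (\<lambda>c. [:c:]) (\<lambda>i. [:q0 $ i, q1 $ i:])"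

lemma unital_hom_line_poly: "unital_hom (line_poly q0 q1)"
  unfolding line_poly_def by (rule unital_hom_eval_hom[OF unital_hom_const_poly])

lemma line_poly_linear_form: "line_poly q0 q1 (linear_form v) = [:dot v q0, dot v q1:]"
  unfolding line_poly_def
  by (subst eval_hom_linear_form[OF unital_hom_const_poly]) (simp add: dot_def sum_3)

lemma line_poly_const: "line_poly q0 q1 (const3 c) = [:c:]"
  unfolding line_poly_def by (rule eval_hom_const[OF unital_hom_const_poly])

lemma poly_line_poly: "poly (line_poly q0 q1 p) t = evalp p (q0 + t *s q1)"
proof -
  have "poly (line_poly q0 q1 p) t = eval_hom (\<lambda>c. c) (\<lambda>i. q0 $ i + t * q1 $ i) p"
    unfolding line_poly_def by (subst eval_hom_comp[OF unital_hom_const_poly unital_hom_poly]) simp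
  moreover have "(\<lambda>i. q0 $ i + t * q1 $ i) = ($) (q0 + t *s q1)" by auto
  ultimately show ?thesis by (simp only: evalp_eq_eval_hom)
qed

definition top_coeff :: "nat \<Rightarrow> 'k::comm_ring_1 poly \<Rightarrow> 'k \<Rightarrow> bool" where
  "top_coeff n q c \<longleftrightarrow> degree q \<le> n \<and> coeff q n = c"

lemma top_coeff_mult:
  assumes "top_coeff n p a" and "top_coeff m q b"
  shows "top_coeff (n + m) (p * q) (a * b)"
proof -
  have "coeff (p * q) (n + m) = (\<Sum>i\<le>n + m. coeff p i * coeff q (n + m - i))"
    by (rule coeff_mult)
  also have "\<dots> = (\<Sum>i\<le>n + m. if i = n then a * b else 0)"
  proof (rule sum.cong)
    fix i assume "i \<in> {..n + m}"
    show "coeff p i * coeff q (n + m - i) = (if i = n then a * b else 0)"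
      using assms
      by (cases i n rule: linorder_cases) (auto simp: top_coeff_def coeff_eq_0)
  qed simp
  finally show ?thesis
    using assms degree_mult_le[of p q] by (auto simp: top_coeff_def)
qed

lemma top_coeff_power: "top_coeff n p a \<Longrightarrow> top_coeff (k * n) (p ^ k) (a ^ k)"
  by (induction k) (auto simp: top_coeff_mult, simp add: top_coeff_def)

lemma top_coeff_prod:
  "(\<And>i. i \<in> A \<Longrightarrow> top_coeff (n i) (p i) (a i)) \<Longrightarrow> top_coeff (sum n A) (prod p A) (prod a A)"
  by (induction A rule: infinite_finite_induct) (auto simp: top_coeff_mult, simp_all add: top_coeff_def)

lemma top_coeff_sum:
  "(\<And>i. i \<in> A \<Longrightarrow> top_coeff n (p i) (a i)) \<Longrightarrow> top_coeff n (sum p A) (sum a A)"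
  by (induction A rule: infinite_finite_induct) (auto simp: top_coeff_def degree_add_le)

lemma top_coeff_line_poly:
  assumes "homogeneous n p"
  shows "top_coeff n (line_poly q0 q1 p) (evalp p q1)"
  unfolding line_poly_def eval_hom_def evalp_def
proof (rule top_coeff_sum)
  fix m assume m: "m \<in> Poly_Mapping.keys p"
  have "top_coeff 1 [:q0 $ i, q1 $ i:] (q1 $ i)" for i by (simp add: top_coeff_def)
  then have "top_coeff (\<Sum>i\<in>UNIV. Poly_Mapping.lookup m i * 1)
      (\<Prod>i\<in>UNIV. [:q0 $ i, q1 $ i:] ^ Poly_Mapping.lookup m i) (\<Prod>i\<in>UNIV. (q1 $ i) ^ Poly_Mapping.lookup m i)"
    by (intro top_coeff_prod top_coeff_power)
  moreover have "(\<Sum>i\<in>UNIV. Poly_Mapping.lookup m i * 1) = n"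
    using assms m by (simp add: homogeneous_def mdeg_def)
  moreover have "top_coeff 0 [:Poly_Mapping.lookup p m:] (Poly_Mapping.lookup p m)"
    by (simp add: top_coeff_def)
  ultimately show "top_coeff n ([:Poly_Mapping.lookup p m:] * (\<Prod>i\<in>UNIV. [:q0 $ i, q1 $ i:] ^ Poly_Mapping.lookup m i))
      (Poly_Mapping.lookup p m * (\<Prod>i\<in>UNIV. (q1 $ i) ^ Poly_Mapping.lookup m i))"
    using top_coeff_mult by fastforce
qed

lemma degree_line_poly: "homogeneous n p \<Longrightarrow> degree (line_poly q0 q1 p) \<le> n"
  using top_coeff_line_poly[of n p q0 q1] by (simp add: top_coeff_def)

lemma coeff_line_poly: "homogeneous n p \<Longrightarrow> coeff (line_poly q0 q1 p) n = evalp p q1"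
  using top_coeff_line_poly[of n p q0 q1] by (simp add: top_coeff_def)

section \<open>Points of the line as homogeneous primes\<close>

definition cone_poly :: "'k::field ^ 3 \<Rightarrow> 'k ^ 3 \<Rightarrow> 'k poly3 \<Rightarrow> 'k poly poly" where
  "cone_poly q0 q1 = eval_hom (\<lambda>c. [:[:c:]:]) (\<lambda>i. [:0, [:q0 $ i, q1 $ i:]:])"

text \<open>
  The point of the line with equation \<open>\<pi>\<close>, as a homogeneous prime; \<open>\<pi> = 0\<close> gives the generic point.
  Using the cone over the line instead of the line makes this a preimage of a principal ideal, so that
  primality is inherited from \<open>\<pi>\<close>.
\<close>
definition line_prime :: "'k::field ^ 3 \<Rightarrow> 'k ^ 3 \<Rightarrow> 'k poly \<Rightarrow> 'k poly3 set" where
  "line_prime q0 q1 \<pi> = {p. [:\<pi>:] dvd cone_poly q0 q1 p}"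

lemma unital_hom_cone_poly: "unital_hom (cone_poly q0 q1)"
  unfolding cone_poly_def by (intro unital_hom_eval_hom unital_hom_pCons unital_hom_id)

lemma coeff_cone_poly: "coeff (cone_poly q0 q1 p) n = line_poly q0 q1 (hom_component n p)"
  unfolding cone_poly_def line_poly_def by (rule coeff_eval_hom_graded[OF unital_hom_const_poly])

lemma line_prime_iff: "p \<in> line_prime q0 q1 \<pi> \<longleftrightarrow> (\<forall>n. \<pi> dvd line_poly q0 q1 (hom_component n p))"
  by (simp add: line_prime_def const_poly_dvd_iff coeff_cone_poly)

lemma homogeneous_in_line_prime_iff:
  "homogeneous n p \<Longrightarrow> p \<in> line_prime q0 q1 \<pi> \<longleftrightarrow> \<pi> dvd line_poly q0 q1 p"
  unfolding line_prime_iff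
  by (auto simp: hom_component_of_homogeneous unital_hom.zero[OF unital_hom_line_poly] split: if_splits)

lemma module_mult: "Modules.module ((*) :: 'a::comm_ring_1 \<Rightarrow> 'a \<Rightarrow> 'a)"
  by unfold_locales (simp_all add: algebra_simps)

lemma line_prime_in_Proj:
  assumes \<pi>: "\<pi> = 0 \<or> prime_elem \<pi>" and x: "\<not> \<pi> dvd line_poly q0 q1 (linear_form x)"
  shows "line_prime q0 q1 \<pi> \<in> Proj"
proof -
  interpret unital_hom "cone_poly q0 q1" by (rule unital_hom_cone_poly)
  have prime: "[:\<pi>:] dvd a \<or> [:\<pi>:] dvd b" if "[:\<pi>:] dvd a * b" for a b
    using \<pi>
  proof
    assume "\<pi> = 0" then show ?thesis using that by simp
  next
    assume "prime_elem \<pi>"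
    then show ?thesis using that lift_prime_elem_poly prime_elem_dvd_multD by blast
  qed
  have "\<not> [:\<pi>:] dvd 1"
    using \<pi> by (auto simp: is_unit_const_poly_iff prime_elem_def)
  moreover have "linear_form x \<notin> line_prime q0 q1 \<pi>"
    using x by (simp add: homogeneous_in_line_prime_iff[OF homogeneous_linear_form])
  then have "\<not> range linear_form \<subseteq> line_prime q0 q1 \<pi>" by blast
  moreover have "hom_component n p \<in> line_prime q0 q1 \<pi>" if "p \<in> line_prime q0 q1 \<pi>" for n p
    using that
    by (simp only: homogeneous_in_line_prime_iff[OF homogeneous_hom_component]) (simp add: line_prime_iff)
  ultimately show ?thesis
    unfolding Proj_def using prime
    by (auto simp: module.subspace_def[OF module_mult] line_prime_def zero add mult one)
qed

section \<open>Graded local rings and stalks\<close>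

lemma ProjD:
  assumes "P \<in> Proj"
  shows "0 \<in> P" "1 \<notin> P" "\<And>a b. a \<in> P \<Longrightarrow> b \<in> P \<Longrightarrow> a + b \<in> P"
    "\<And>a b. b \<in> P \<Longrightarrow> a * b \<in> P" "\<And>a b. a * b \<in> P \<Longrightarrow> a \<in> P \<or> b \<in> P"
    "\<And>a n. a \<in> P \<Longrightarrow> hom_component n a \<in> P" "\<exists>x. linear_form x \<notin> P"
  using assms unfolding Proj_def module.subspace_def[OF module_mult] by blast+

lemma Proj_mult_iff: "P \<in> Proj \<Longrightarrow> a * b \<in> P \<longleftrightarrow> a \<in> P \<or> b \<in> P"
  using ProjD(4,5) by (metis mult.commute)

lemma Proj_prod_iff: "finite A \<Longrightarrow> P \<in> Proj \<Longrightarrow> prod f A \<in> P \<longleftrightarrow> (\<exists>a\<in>A. f a \<in> P)"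
  by (induction A rule: finite_induct) (auto simp: Proj_mult_iff ProjD(2))

lemma Proj_power: "P \<in> Proj \<Longrightarrow> a \<notin> P \<Longrightarrow> a ^ n \<notin> P"
  by (induction n) (auto simp: Proj_mult_iff ProjD(2))

lemma Proj_sum: "P \<in> Proj \<Longrightarrow> (\<And>a. a \<in> A \<Longrightarrow> f a \<in> P) \<Longrightarrow> sum f A \<in> P"
  by (induction A rule: infinite_finite_induct) (auto simp: ProjD)

text \<open>
  The degree \<open>n\<close> part of the homogeneous localisation at \<open>P\<close>: the stalk of \<open>O(n)\<close>.
\<close>
definition loc :: "int \<Rightarrow> 'k::field poly3 set \<Rightarrow> 'k ratf3 set" where
  "loc n P = {g. \<exists>a b i j. homogeneous i a \<and> homogeneous j b \<and> int i - int j = n \<and> b \<notin> P \<and> g = Fract a b}"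

lemma loc_Fract:
  "homogeneous i a \<Longrightarrow> homogeneous j b \<Longrightarrow> b \<notin> P \<Longrightarrow> n = int i - int j \<Longrightarrow> Fract a b \<in> loc n P"
  unfolding loc_def by blast

lemma locE:
  assumes "g \<in> loc n P"
  obtains a b i j where "homogeneous i a" "homogeneous j b" "int i - int j = n" "b \<notin> P" "g = Fract a b"
  using assms unfolding loc_def by blast

context
  fixes P :: "'k::field poly3 set"
  assumes P: "P \<in> Proj"
begin

lemma loc_zero: "0 \<in> loc n P"
proof -
  obtain x where x: "linear_form x \<notin> P" using ProjD(7)[OF P] by blast
  have "Fract 0 (linear_form x ^ nat (- n)) \<in> loc n P"
    by (rule loc_Fract[of "nat n" _ "nat (- n)"])
      (use Proj_power[OF P x] homogeneous_power[OF homogeneous_linear_form, of "nat (- n)" x] in auto)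
  moreover have "Fract 0 (linear_form x ^ nat (- n)) = 0"
    by (simp add: fract_collapse)
  ultimately show ?thesis by simp
qed

lemma loc_mult:
  assumes "g \<in> loc n P" and "h \<in> loc m P"
  shows "g * h \<in> loc (n + m) P"
proof -
  obtain a b i j where g: "homogeneous i a" "homogeneous j b" "int i - int j = n" "b \<notin> P" "g = Fract a b"
    using assms(1) by (rule locE)
  obtain a' b' i' j' where h: "homogeneous i' a'" "homogeneous j' b'" "int i' - int j' = m" "b' \<notin> P"
    "h = Fract a' b'" using assms(2) by (rule locE)
  have "Fract (a * a') (b * b') \<in> loc (n + m) P"
    by (rule loc_Fract[of "i + i'" _ "j + j'"])
      (use g h in \<open>auto simp: homogeneous_mult Proj_mult_iff[OF P]\<close>)
  then show ?thesis using g h by simp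
qed

lemma loc_add:
  assumes "g \<in> loc n P" and "h \<in> loc n P"
  shows "g + h \<in> loc n P"
proof -
  obtain a b i j where g: "homogeneous i a" "homogeneous j b" "int i - int j = n" "b \<notin> P" "g = Fract a b"
    using assms(1) by (rule locE)
  obtain a' b' i' j' where h: "homogeneous i' a'" "homogeneous j' b'" "int i' - int j' = n" "b' \<notin> P"
    "h = Fract a' b'" using assms(2) by (rule locE)
  have nz: "b \<noteq> 0" "b' \<noteq> 0" using g h ProjD(1)[OF P] by auto
  have "i' + j = i + j'" using g h by linarith
  then have "homogeneous (i + j') (a * b' + a' * b)"
    using g h by (metis homogeneous_add homogeneous_mult)
  then have "Fract (a * b' + a' * b) (b * b') \<in> loc n P"
    by (rule loc_Fract[of _ _ "j + j'"])
      (use g h in \<open>auto simp: homogeneous_mult Proj_mult_iff[OF P]\<close>)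
  then show ?thesis using g h nz by simp
qed

lemma loc_poly: "homogeneous n a \<Longrightarrow> Fract a 1 \<in> loc (int n) P"
  by (rule loc_Fract[OF _ homogeneous_one]) (auto simp: ProjD(2)[OF P])

lemma loc_uminus:
  assumes "g \<in> loc n P"
  shows "- g \<in> loc n P"
proof -
  have "Fract (const3 (- 1)) 1 = (- 1 :: 'k ratf3)"
    by (simp add: unital_hom.uminus[OF unital_hom_const3] One_fract_def)
  then show ?thesis
    using loc_mult[OF loc_poly[OF homogeneous_const[of "- 1"]] assms] by simp
qed

lemma loc_diff: "g \<in> loc n P \<Longrightarrow> h \<in> loc n P \<Longrightarrow> g - h \<in> loc n P"
  using loc_add[OF _ loc_uminus] by fastforce

lemma loc_sum: "(\<And>a. a \<in> A \<Longrightarrow> f a \<in> loc n P) \<Longrightarrow> sum f A \<in> loc n P"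
  by (induction A rule: infinite_finite_induct) (auto simp: loc_zero loc_add)

end

lemma twist_nonempty: "U \<noteq> {} \<Longrightarrow> twist n U = {g. \<forall>P\<in>U. g \<in> loc n P}"
  unfolding twist_def loc_def by auto

definition basic_open :: "'k::field poly3 \<Rightarrow> 'k poly3 set set" where
  "basic_open b = {P \<in> Proj. b \<notin> P}"

lemma openin_basic_open: "openin zariski (basic_open b)"
  unfolding openin_zariski basic_open_def by (rule exI[of _ "{b}"]) auto

text \<open>
  The kernel of one linear equation with coefficients \<open>e\<close> on a sum of line bundles.  Both sheaves of the
  theorem have this form, with \<open>e = 0\<close> for the sum of line bundles itself and \<open>e\<close> the gradient of \<open>f\<close>
  for the logarithmic bundle.
\<close>
definition ker_sheaf :: "int ^ 'r \<Rightarrow> 'k ratf3 ^ 'r \<Rightarrow> ('k::field, 'r::finite) sheaf3" where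
  "ker_sheaf n e U = {v \<in> twist_sum n U. (\<Sum>i\<in>UNIV. v $ i * e $ i) = 0}"

definition ker_stalk :: "int ^ 'r \<Rightarrow> 'k ratf3 ^ 'r \<Rightarrow> 'k::field poly3 set \<Rightarrow> ('k ratf3 ^ 'r::finite) set" where
  "ker_stalk n e P = {v. (\<forall>i. v $ i \<in> loc (n $ i) P) \<and> (\<Sum>i\<in>UNIV. v $ i * e $ i) = 0}"

lemma twist_sum_eq_ker_sheaf: "twist_sum n = ker_sheaf n 0"
  by (simp add: fun_eq_iff ker_sheaf_def)

lemma log_tangent_eq_ker_sheaf: "log_tangent f = ker_sheaf 0 (\<chi> i. Fract (partial_deriv i f) 1)"
  by (simp add: fun_eq_iff ker_sheaf_def log_tangent_def)

lemma ker_sheaf_subset_stalk: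
  assumes "P \<in> U" and "v \<in> ker_sheaf n e U"
  shows "v \<in> ker_stalk n e P"
proof -
  have "U \<noteq> {}" using assms by auto
  then show ?thesis
    using assms by (auto simp: ker_sheaf_def ker_stalk_def twist_sum_def twist_nonempty)
qed

text \<open>
  The product of the denominators is a common one, and it stays invertible on a basic open set.
\<close>
lemma ker_stalk_extends:
  assumes P: "P \<in> Proj" and v: "v \<in> ker_stalk n e P"
  shows "\<exists>U. openin zariski U \<and> P \<in> U \<and> v \<in> ker_sheaf n e U"
proof -
  have "\<forall>i. \<exists>a b j k. homogeneous j a \<and> homogeneous k b \<and> int j - int k = n $ i \<and> b \<notin> P \<and> v $ i = Fract a b"
    using v by (auto simp: ker_stalk_def loc_def)
  then obtain a b j k where ab: "\<And>i. homogeneous (j i) (a i)" "\<And>i. homogeneous (k i) (b i)"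
      "\<And>i. int (j i) - int (k i) = n $ i" "\<And>i. b i \<notin> P" "\<And>i. v $ i = Fract (a i) (b i)"
    by metis
  let ?U = "basic_open (\<Prod>i\<in>UNIV. b i)"
  have PU: "P \<in> ?U" using P ab(4) by (auto simp: basic_open_def Proj_prod_iff)
  have "v $ i \<in> loc (n $ i) Q" if "Q \<in> ?U" for Q i
    unfolding ab(5)
    by (rule loc_Fract[OF ab(1,2)]) (use that ab(3) in \<open>auto simp: basic_open_def Proj_prod_iff\<close>)
  moreover have "?U \<noteq> {}" using PU by blast
  ultimately have "v \<in> ker_sheaf n e ?U"
    using v by (auto simp: ker_sheaf_def twist_sum_def twist_nonempty ker_stalk_def)
  then show ?thesis using PU openin_basic_open by blast
qed

lemma stalk_ker_sheaf: "P \<in> Proj \<Longrightarrow> stalk (ker_sheaf n e) P = ker_stalk n e P"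
proof (intro set_eqI iffI)
  fix v assume "v \<in> stalk (ker_sheaf n e) P"
  then obtain U where "P \<in> U" "v \<in> ker_sheaf n e U" by (auto simp: stalk_def)
  then show "v \<in> ker_stalk n e P" by (rule ker_sheaf_subset_stalk)
next
  fix v assume "P \<in> Proj" and "v \<in> ker_stalk n e P"
  from ker_stalk_extends[OF this] show "v \<in> stalk (ker_sheaf n e) P" by (auto simp: stalk_def)
qed

lemma ker_stalk_add:
  assumes "P \<in> Proj" "v \<in> ker_stalk n e P" "u \<in> ker_stalk n e P"
  shows "v + u \<in> ker_stalk n e P"
  using assms by (auto simp: ker_stalk_def loc_add distrib_right sum.distrib)

lemma ker_stalk_scale:
  assumes "P \<in> Proj" "c \<in> loc 0 P" "v \<in> ker_stalk n e P"
  shows "c *s v \<in> ker_stalk n e P"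
  using assms loc_mult[OF assms(1,2)]
  by (auto simp: ker_stalk_def mult.assoc sum_distrib_left[symmetric])

lemma ker_stalk_zero: "P \<in> Proj \<Longrightarrow> 0 \<in> ker_stalk n e P"
  by (auto simp: ker_stalk_def loc_zero)

lemma ker_stalk_uminus:
  assumes "P \<in> Proj" "v \<in> ker_stalk n e P"
  shows "- v \<in> ker_stalk n e P"
  using assms by (auto simp: ker_stalk_def loc_uminus sum_negf)

lemma ker_stalk_sum:
  "P \<in> Proj \<Longrightarrow> (\<And>a. a \<in> A \<Longrightarrow> f a \<in> ker_stalk n e P) \<Longrightarrow> sum f A \<in> ker_stalk n e P"
  by (induction A rule: infinite_finite_induct) (auto simp: ker_stalk_zero ker_stalk_add)

section \<open>The stalks of the restriction to a line\<close>

lemma linear_form_nonzero: "v \<noteq> 0 \<Longrightarrow> linear_form v \<noteq> 0"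
proof
  assume "v \<noteq> 0" and "linear_form v = 0"
  then obtain c where "dot c v = 1" using ex_dot_eq_1 by blast
  then have "dot v c = 1" by (simp add: dot_def mult.commute)
  moreover have "[:dot v c, dot v 0:] = 0"
    using line_poly_linear_form[of c 0 v] \<open>linear_form v = 0\<close>
    by (simp add: unital_hom.zero[OF unital_hom_line_poly])
  ultimately show False by simp
qed

lemma linear_form_eq_sum: "linear_form v = (\<Sum>i\<in>UNIV. const3 (v $ i) * var3 i)"
  by (simp add: linear_form_def mult_single)

lemma linear_form_scale: "linear_form (c *s v) = const3 c * linear_form v"
  by (simp add: linear_form_def sum_distrib_left mult_single)

lemma linear_form_add: "linear_form (u + v) = linear_form u + linear_form v"
  by (simp add: linear_form_def sum.distrib single_add)

lemma evalp_linear_form: "evalp (linear_form v) u = dot v u"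
  by (simp add: evalp_eq_eval_hom eval_hom_linear_form[OF unital_hom_id] dot_def)

text \<open>
  A frame adapted to the line \<open>w = 0\<close>: this line is spanned by \<open>p0\<close> and \<open>p1\<close> and has homogeneous
  coordinates \<open>x0\<close> and \<open>x1\<close>.  The affine coordinate used below is \<open>x1 / x0\<close>, and \<open>p1\<close> is its point at infinity.
\<close>
locale line_frame =
  fixes w x0 x1 p0 p1 p2 :: "'k::field_char_0 ^ 3"
  assumes bases: "dual_bases x0 x1 w p0 p1 p2"
begin

abbreviation "R \<equiv> line_poly p0 p1"

lemma dots [simp]:
  "dot x0 p0 = 1" "dot x0 p1 = 0" "dot x0 p2 = 0"
  "dot x1 p0 = 0" "dot x1 p1 = 1" "dot x1 p2 = 0"
  "dot w p0 = 0" "dot w p1 = 0" "dot w p2 = 1"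
  using bases by (simp_all add: dual_bases_def)

lemma w_nonzero: "w \<noteq> 0"
  using dots(9) by (auto simp: dot_def)

lemma R_x0: "R (linear_form x0) = 1" and R_x1: "R (linear_form x1) = [:0, 1:]"
  and R_w: "R (linear_form w) = 0"
  by (simp_all add: line_poly_linear_form)

lemma evalp_zero_on_plane:
  assumes "homogeneous n p" and "R p = 0"
  shows "evalp p (s *s p0 + t *s p1) = 0"
proof (cases "s = 0")
  case True
  then show ?thesis
    using evalp_scale[OF assms(1), of t p1] coeff_line_poly[OF assms(1), of p0 p1] assms(2) by simp
next
  case False
  then have "s *s p0 + t *s p1 = s *s (p0 + (t / s) *s p1)"
    by (simp add: vec_eq_iff algebra_simps)
  moreover have "evalp p (p0 + (t / s) *s p1) = 0"
    using poly_line_poly[of p0 p1 p "t / s"] assms(2) by simp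
  ultimately show ?thesis
    by (simp only: evalp_scale[OF assms(1)] mult_zero_right)
qed

text \<open>
  Write a point as its projection to the plane \<open>w = 0\<close> plus a multiple of \<open>p2\<close>, and let this multiple be a new
  variable \<open>t\<close>.  The value at \<open>t = 0\<close> is the restriction to the plane, which vanishes, so \<open>t\<close> divides;
  setting \<open>t = w\<close> gives back the polynomial.
\<close>
lemma vanishing_on_line_dvd:
  assumes "homogeneous n p" and "R p = 0"
  shows "\<exists>q. p = linear_form w * q"
proof -
  define L where "L i = const3 (p0 $ i) * linear_form x0 + const3 (p1 $ i) * linear_form x1" for i
  \<comment> \<open>\<open>L\<close> is the projection to the plane; \<open>T\<close> is \<open>p\<close> along the lines in direction \<open>p2\<close>\<close>
  define T where "T = eval_hom (\<lambda>c. [:const3 c:]) (\<lambda>i. [:L i, const3 (p2 $ i):]) p"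
  have ev: "poly T s = eval_hom const3 (\<lambda>i. L i + s * const3 (p2 $ i)) p" for s
    unfolding T_def
    by (subst eval_hom_comp[OF unital_hom_pCons[OF unital_hom_const3] unital_hom_poly]) simp
  have "L i + linear_form w * const3 (p2 $ i) = var3 i" for i
  proof -
    have d: "x0 $ j * p0 $ i + x1 $ j * p1 $ i + w $ j * p2 $ i = (if j = i then 1 else 0)" for j
      using bases by (simp add: dual_bases_def)
    have "L i + linear_form w * const3 (p2 $ i) =
        (\<Sum>j\<in>UNIV. const3 (x0 $ j * p0 $ i + x1 $ j * p1 $ i + w $ j * p2 $ i) * var3 j)"
      unfolding L_def linear_form_eq_sum
      by (simp only: sum_distrib_left sum_distrib_right sum.distrib[symmetric] single_add
          unital_hom.mult[OF unital_hom_const3]) (rule sum.cong, simp_all only: algebra_simps)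
    also have "\<dots> = (\<Sum>j\<in>UNIV. if j = i then var3 j else 0)"
      unfolding d by (rule sum.cong) auto
    finally show ?thesis by simp
  qed
  then have T1: "poly T (linear_form w) = p"
    unfolding ev by (simp only: eval_hom_self)
  have T0: "poly T 0 = 0"
  proof (rule evalp_eq_0_imp_eq_0)
    fix v
    have "evalp (poly T 0) v = eval_hom (\<lambda>c. c) (\<lambda>i. evalp (L i) v) p"
      unfolding ev
      by (subst eval_hom_comp[OF unital_hom_const3 evalp_hom])
        (simp add: evalp_eq_eval_hom eval_hom_const[OF unital_hom_id])
    also have "(\<lambda>i. evalp (L i) v) = ($) (dot x0 v *s p0 + dot x1 v *s p1)"
      by (simp add: L_def fun_eq_iff unital_hom.add[OF evalp_hom] unital_hom.mult[OF evalp_hom] evalp_linear_form)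
        (simp add: evalp_eq_eval_hom eval_hom_const[OF unital_hom_id] mult.commute)
    also have "eval_hom (\<lambda>c. c) \<dots> p = 0"
      using evalp_zero_on_plane[OF assms] by (simp only: evalp_eq_eval_hom)
    finally show "evalp (poly T 0) v = 0" .
  qed
  obtain a q where T: "T = pCons a q" by (cases T)
  have "p = linear_form w * poly q (linear_form w)"
    using T0 T1 unfolding T by simp
  then show ?thesis by blast
qed

definition on_line :: "'k poly3 set \<Rightarrow> bool" where
  "on_line P \<longleftrightarrow> P \<in> Proj \<and> linear_form w \<in> P"

lemma on_lineD: "on_line P \<Longrightarrow> P \<in> Proj" "on_line P \<Longrightarrow> linear_form w \<in> P"
  by (auto simp: on_line_def)

lemma R_nonzero:
  assumes "on_line P" and "homogeneous n b" and "b \<notin> P"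
  shows "R b \<noteq> 0"
  using vanishing_on_line_dvd[OF assms(2)] assms
  by (auto simp: on_line_def Proj_mult_iff)

lemma R_linear_form_nonzero: "on_line P \<Longrightarrow> linear_form x \<notin> P \<Longrightarrow> R (linear_form x) \<noteq> 0"
  by (rule R_nonzero[OF _ homogeneous_linear_form])

lemma loc_regular: "on_line P \<Longrightarrow> g \<in> loc n P \<Longrightarrow> g \<in> regular R"
  by (auto elim!: locE intro!: regular_Fract[OF unital_hom_line_poly] dest: R_nonzero)

definition generic_point :: "'k poly3 set" where
  "generic_point = line_prime p0 p1 0"

lemma line_prime_on_line:
  assumes "\<pi> = 0 \<or> prime_elem \<pi>"
  shows "on_line (line_prime p0 p1 \<pi>)"
proof -
  have "\<not> \<pi> dvd R (linear_form x0)" using assms by (auto simp: R_x0 prime_elem_def)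
  then have "line_prime p0 p1 \<pi> \<in> Proj" by (rule line_prime_in_Proj[OF assms])
  then show ?thesis
    by (simp add: on_line_def homogeneous_in_line_prime_iff[OF homogeneous_linear_form] R_w)
qed

lemma generic_point_on_line: "on_line generic_point"
  unfolding generic_point_def by (rule line_prime_on_line) simp

lemma generic_point_subset:
  assumes "on_line P"
  shows "generic_point \<subseteq> P"
proof
  fix p assume "p \<in> generic_point"
  then have "R (hom_component n p) = 0" for n
    by (auto simp: generic_point_def line_prime_iff)
  then have "hom_component n p \<in> P" for n
    using vanishing_on_line_dvd[OF homogeneous_hom_component, of n p] assms
    by (auto simp: on_line_def Proj_mult_iff)
  then have "(\<Sum>n\<le>degree (graded p). hom_component n p) \<in> P"
    by (intro Proj_sum[OF on_lineD(1)[OF assms]])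
  then show "p \<in> P" by (simp only: sum_hom_component)
qed

text \<open>
  Restriction of a vector of fractions to the line, as a vector over its function field.  Fractions of any
  degree are allowed; they are dehomogenised by \<open>x0 = 1\<close>.
\<close>
definition res :: "'k ratf3 ^ 'r \<Rightarrow> 'k poly fract ^ 'r" where
  "res v = (\<chi> i. fract_map R (v $ i))"

lemma res_nth: "res v $ i = fract_map R (v $ i)"
  by (simp add: res_def)

lemma stalk_regular: "on_line P \<Longrightarrow> v \<in> ker_stalk n e P \<Longrightarrow> v $ i \<in> regular R"
  by (auto simp: ker_stalk_def intro: loc_regular)

lemma res_add:
  assumes "on_line P" "v \<in> ker_stalk n e P" "u \<in> ker_stalk n e P"
  shows "res (v + u) = res v + res u"
  using assms by (simp add: vec_eq_iff res_nth regular_add(2)[OF unital_hom_line_poly] stalk_regular)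

lemma res_diff:
  assumes "on_line P" "v \<in> ker_stalk n e P" "u \<in> ker_stalk n e P"
  shows "res (v - u) = res v - res u"
  using assms by (simp add: vec_eq_iff res_nth regular_diff(2)[OF unital_hom_line_poly] stalk_regular)

lemma res_scale:
  assumes "on_line P" "c \<in> loc k P" "v \<in> ker_stalk n e P"
  shows "res (c *s v) = fract_map R c *s res v"
  using assms by (simp add: vec_eq_iff res_nth regular_mult(2)[OF unital_hom_line_poly] stalk_regular loc_regular)

text \<open>
  Numerators vanishing on the line are divisible by its equation \<open>w\<close>, and the linear equation that defines
  the sheaf survives division by \<open>w\<close>.  This is why the restricted sheaf embeds into a sum of line bundles on
  the line.
\<close>

lemma res_eq_0_imp_multiple:
  assumes P: "on_line P" and v: "v \<in> ker_stalk n e P" and 0: "res v = 0" and x: "linear_form x \<notin> P"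
  shows "\<exists>u\<in>ker_stalk n e P. v = Fract (linear_form w) (linear_form x) *s u"
proof -
  have xnz: "linear_form x \<noteq> 0" using x ProjD(1)[OF on_lineD(1)[OF P]] by auto
  have wnz: "linear_form w \<noteq> 0" by (rule linear_form_nonzero[OF w_nonzero])
  have "\<exists>g\<in>loc (n $ i) P. v $ i = Fract (linear_form w) (linear_form x) * g" for i
  proof -
    have "v $ i \<in> loc (n $ i) P" using v by (simp add: ker_stalk_def)
    then obtain a b j k where ab: "homogeneous j a" "homogeneous k b" "int j - int k = n $ i" "b \<notin> P"
      "v $ i = Fract a b" by (rule locE)
    have b: "R b \<noteq> 0" by (rule R_nonzero[OF P ab(2,4)])
    have bnz: "b \<noteq> 0" using ab(4) ProjD(1)[OF on_lineD(1)[OF P]] by auto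
    have "fract_map R (v $ i) = 0" using 0 by (simp add: vec_eq_iff res_nth)
    then have "Fract (R a) (R b) = 0"
      using b ab(5) by (simp add: fract_map_Fract[OF unital_hom_line_poly])
    then have "R a = 0" using b by (simp add: Zero_fract_def eq_fract)
    then obtain q where q: "a = linear_form w * q" using vanishing_on_line_dvd[OF ab(1)] by blast
    have "homogeneous j (linear_form x * q)"
    proof (cases j)
      case 0
      then show ?thesis
        using homogeneous_factor_linear_0[OF _ homogeneous_linear_form wnz, of q] ab(1) q by simp
    next
      case (Suc j')
      then show ?thesis
        using homogeneous_factor_linear[OF _ homogeneous_linear_form wnz, of j' q] ab(1) q
          homogeneous_mult[OF homogeneous_linear_form, of j' q x] by simp
    qed
    then have "Fract (linear_form x * q) b \<in> loc (n $ i) P"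
      by (rule loc_Fract[OF _ ab(2,4)]) (use ab(3) in simp)
    moreover have "v $ i = Fract (linear_form w) (linear_form x) * Fract (linear_form x * q) b"
      using ab(5) q xnz bnz by (simp add: eq_fract mult_ac)
    ultimately show ?thesis by blast
  qed
  then obtain g where g: "\<And>i. g i \<in> loc (n $ i) P"
    "\<And>i. v $ i = Fract (linear_form w) (linear_form x) * g i" by metis
  have "Fract (linear_form w) (linear_form x) * (\<Sum>i\<in>UNIV. g i * e $ i) = (\<Sum>i\<in>UNIV. v $ i * e $ i)"
    by (simp add: g(2) sum_distrib_left mult.assoc)
  also have "\<dots> = 0" using v by (simp add: ker_stalk_def)
  finally have "Fract (linear_form w) (linear_form x) * (\<Sum>i\<in>UNIV. g i * e $ i) = 0" .
  moreover have "Fract (linear_form w) (linear_form x) \<noteq> 0"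
    using wnz xnz by (simp add: Zero_fract_def eq_fract)
  ultimately have "(\<Sum>i\<in>UNIV. g i * e $ i) = 0" by simp
  then have "(\<chi> i. g i) \<in> ker_stalk n e P" using g(1) by (simp add: ker_stalk_def)
  moreover have "v = Fract (linear_form w) (linear_form x) *s (\<chi> i. g i)"
    by (simp add: vec_eq_iff g(2))
  ultimately show ?thesis by blast
qed

lemma res_multiple:
  assumes P: "on_line P" and u: "u \<in> ker_stalk n e P" and x: "linear_form x \<notin> P"
  shows "Fract (linear_form w) (linear_form x) *s u \<in> ker_stalk n e P"
    and "res (Fract (linear_form w) (linear_form x) *s u) = 0"
proof -
  have c: "Fract (linear_form w) (linear_form x) \<in> loc 0 P"
    by (rule loc_Fract[OF homogeneous_linear_form homogeneous_linear_form x]) simp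
  show "Fract (linear_form w) (linear_form x) *s u \<in> ker_stalk n e P"
    by (rule ker_stalk_scale[OF on_lineD(1)[OF P] c u])
  show "res (Fract (linear_form w) (linear_form x) *s u) = 0"
    unfolding res_scale[OF P c u]
    by (simp add: fract_map_Fract[OF unital_hom_line_poly R_linear_form_nonzero[OF P x]] R_w fract_collapse)
qed

text \<open>
  With a linear form \<open>x\<close> not vanishing at \<open>P\<close>, the ideal of the line is generated by the single fraction
  \<open>w / x\<close>, so sums of products collapse to one product.
\<close>
lemma ideal_stalk_eq:
  assumes P: "on_line P" and y: "y = range (\<lambda>c. c *s w)"
  shows "ideal_stalk (ker_sheaf n e) y P = {v \<in> ker_stalk n e P. res v = 0}"
proof (intro set_eqI iffI)
  note Proj = on_lineD(1)[OF P]
  obtain x where x: "linear_form x \<notin> P" using ProjD(7)[OF Proj] by blast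
  have xnz: "linear_form x \<noteq> 0" using x ProjD(1)[OF Proj] by auto
  let ?l = "Fract (linear_form w) (linear_form x)"
  {
    fix v assume "v \<in> ideal_stalk (ker_sheaf n e) y P"
    then obtain m :: nat and c t where v: "v = (\<Sum>j<m. (c j $ 1) *s t j)"
      and ct: "\<And>j. j < m \<Longrightarrow> c j \<in> stalk (line_ideal y) P" "\<And>j. j < m \<Longrightarrow> t j \<in> ker_stalk n e P"
      unfolding ideal_stalk_def stalk_ker_sheaf[OF Proj] by blast
    have "\<exists>u\<in>ker_stalk n e P. (c j $ 1) *s t j = ?l *s u" if j: "j < m" for j
    proof -
      obtain U where U: "P \<in> U" "c j \<in> line_ideal y U"
        using ct(1)[OF j] unfolding stalk_def by blast
      then obtain s g where g: "g \<in> twist (- 1) U" "c j $ 1 = Fract (linear_form (s *s w)) 1 * g"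
        unfolding line_ideal_def y by blast
      have "g \<in> loc (- 1) P" using g(1) U(1) by (subst (asm) twist_nonempty) auto
      moreover have "Fract (const3 s * linear_form x) 1 \<in> loc (int (0 + 1)) P"
        by (intro loc_poly[OF Proj] homogeneous_mult homogeneous_const homogeneous_linear_form)
      ultimately have "Fract (const3 s * linear_form x) 1 * g \<in> loc 0 P"
        using loc_mult[OF Proj, of "Fract (const3 s * linear_form x) 1" 1 g "- 1"] by simp
      then have "(Fract (const3 s * linear_form x) 1 * g) *s t j \<in> ker_stalk n e P"
        by (rule ker_stalk_scale[OF Proj _ ct(2)[OF j]])
      moreover have "c j $ 1 = ?l * (Fract (const3 s * linear_form x) 1 * g)"
        unfolding g(2) linear_form_scale mult.assoc[symmetric]
        using xnz by (simp add: eq_fract mult_ac)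
      ultimately show ?thesis
        by (intro bexI[of _ "(Fract (const3 s * linear_form x) 1 * g) *s t j"]) (simp_all add: vector_smult_assoc)
    qed
    then obtain u where u: "\<And>j. j < m \<Longrightarrow> u j \<in> ker_stalk n e P" "\<And>j. j < m \<Longrightarrow> (c j $ 1) *s t j = ?l *s u j"
      by metis
    have "v = ?l *s (\<Sum>j<m. u j)"
      unfolding v by (simp add: u(2) vec.scale_sum_right)
    moreover have "(\<Sum>j<m. u j) \<in> ker_stalk n e P" by (rule ker_stalk_sum[OF Proj]) (use u in auto)
    ultimately show "v \<in> {v \<in> ker_stalk n e P. res v = 0}"
      using res_multiple[OF P _ x, of "\<Sum>j<m. u j" n e] by simp
  next
    fix v assume "v \<in> {v \<in> ker_stalk n e P. res v = 0}"
    then obtain u where u: "u \<in> ker_stalk n e P" "v = ?l *s u"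
      using res_eq_0_imp_multiple[OF P _ _ x] by blast
    have "Fract 1 (linear_form x) \<in> twist (- 1) (basic_open (linear_form x))"
    proof -
      have "Fract 1 (linear_form x) \<in> loc (- 1) Q" if "Q \<in> basic_open (linear_form x)" for Q
        by (rule loc_Fract[OF homogeneous_one homogeneous_linear_form]) (use that in \<open>auto simp: basic_open_def\<close>)
      moreover have "basic_open (linear_form x) \<noteq> {}" using x Proj by (auto simp: basic_open_def)
      ultimately show ?thesis by (simp add: twist_nonempty)
    qed
    moreover have "w \<in> y" unfolding y by (rule range_eqI[of _ _ 1]) simp
    ultimately have "(\<chi> i. ?l) \<in> line_ideal y (basic_open (linear_form x))"
      unfolding line_ideal_def by (auto intro!: bexI[of _ w] bexI[of _ "Fract 1 (linear_form x)"])
    then have "(\<chi> i. ?l) \<in> stalk (line_ideal y) P"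
      unfolding stalk_def using openin_basic_open[of "linear_form x"] x Proj by (auto simp: basic_open_def)
    then show "v \<in> ideal_stalk (ker_sheaf n e) y P"
      unfolding ideal_stalk_def stalk_ker_sheaf[OF Proj] u(2) mem_Collect_eq
      by (intro exI[of _ 1] exI[of _ "\<lambda>_. \<chi> i. ?l"] exI[of _ "\<lambda>_. u"]) (use u(1) in simp)
  }
qed

end

context line_frame
begin

section \<open>Sections of the restricted sheaves\<close>

abbreviation dual_pt :: "('k ^ 3) set" where
  "dual_pt \<equiv> range (\<lambda>c. c *s w)"

lemma line_of_dual_pt: "line_of dual_pt = Collect on_line"
proof (intro set_eqI iffI)
  fix P assume "P \<in> line_of dual_pt"
  moreover have "w \<in> dual_pt" by (rule range_eqI[of _ _ 1]) simp
  ultimately show "P \<in> Collect on_line" by (auto simp: line_of_def on_line_def)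
next
  fix P assume "P \<in> Collect on_line"
  then show "P \<in> line_of dual_pt"
    by (auto simp: line_of_def on_line_def linear_form_scale Proj_mult_iff)
qed

text \<open>
  The vectors over the function field of the line which lift to the sheaf at every point of \<open>W\<close>; the next
  definition turns such a vector into the family of cosets of its lifts.
\<close>
definition line_sections :: "int ^ 'r \<Rightarrow> 'k ratf3 ^ 'r \<Rightarrow> 'k poly3 set set \<Rightarrow> ('k poly fract ^ 'r::finite) set" where
  "line_sections n e W = {u. \<forall>P\<in>W. \<exists>v\<in>ker_stalk n e P. res v = u}"

definition coset_section :: "int ^ 'r \<Rightarrow> 'k ratf3 ^ 'r \<Rightarrow> 'k poly3 set set \<Rightarrow> 'k poly fract ^ 'r \<Rightarrow> ('k, 'r::finite) section3" where
  "coset_section n e W u = restrict (\<lambda>P. {v \<in> ker_stalk n e P. res v = u}) W"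

lemma coset_ideal_stalk:
  assumes P: "on_line P" and t: "t \<in> ker_stalk n e P"
  shows "(+) t ` ideal_stalk (ker_sheaf n e) dual_pt P = {v \<in> ker_stalk n e P. res v = res t}"
proof (intro set_eqI iffI)
  note Proj = on_lineD(1)[OF P]
  fix v assume "v \<in> (+) t ` ideal_stalk (ker_sheaf n e) dual_pt P"
  then obtain u where "u \<in> ker_stalk n e P" "res u = 0" "v = t + u"
    by (auto simp: ideal_stalk_eq[OF P refl])
  then show "v \<in> {v \<in> ker_stalk n e P. res v = res t}"
    using res_add[OF P t] ker_stalk_add[OF Proj t] by simp
next
  note Proj = on_lineD(1)[OF P]
  fix v assume v: "v \<in> {v \<in> ker_stalk n e P. res v = res t}"
  have "v - t \<in> ker_stalk n e P"
    using ker_stalk_add[OF Proj, of v n e "- t"] ker_stalk_uminus[OF Proj t] v by simp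
  moreover have "res (v - t) = 0" using res_diff[OF P _ t] v by simp
  ultimately have "v - t \<in> ideal_stalk (ker_sheaf n e) dual_pt P" by (simp add: ideal_stalk_eq[OF P refl])
  then show "v \<in> (+) t ` ideal_stalk (ker_sheaf n e) dual_pt P" by (rule rev_image_eqI) simp
qed

lemma generic_point_in_open:
  assumes "openin zariski V" and "P \<in> V" and "on_line P"
  shows "generic_point \<in> V"
proof -
  obtain A where V: "V = {P \<in> Proj. \<not> A \<subseteq> P}" using assms(1) by (auto simp: openin_zariski)
  then show ?thesis
    using assms generic_point_subset[OF assms(3)] on_lineD(1)[OF generic_point_on_line] by blast
qed

text \<open>
  A section is a family of cosets, and each coset is determined by its restriction to the line.  These
  restrictions agree at all points, since every open neighbourhood contains the generic point.
\<close>
lemma restr_eq: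
  assumes W: "W \<subseteq> Collect on_line" and \<eta>: "generic_point \<in> W"
  shows "restr (ker_sheaf n e) dual_pt W = coset_section n e W ` line_sections n e W"
proof (intro set_eqI iffI)
  fix s assume s: "s \<in> restr (ker_sheaf n e) dual_pt W"
  have local: "\<forall>P\<in>W. \<exists>V t. openin zariski V \<and> P \<in> V \<and> t \<in> ker_sheaf n e V \<and>
      (\<forall>Q\<in>V \<inter> W. s Q = (+) t ` ideal_stalk (ker_sheaf n e) dual_pt Q)"
    using s by (simp add: restr_def)
  have loc: "\<exists>u. (\<exists>v\<in>ker_stalk n e P. res v = u) \<and> s P = {v \<in> ker_stalk n e P. res v = u} \<and>
      s generic_point = {v \<in> ker_stalk n e generic_point. res v = u} \<and>
      (\<exists>v\<in>ker_stalk n e generic_point. res v = u)" if P: "P \<in> W" for P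
  proof -
    obtain V t where V: "openin zariski V" "P \<in> V" "t \<in> ker_sheaf n e V"
      "\<forall>Q\<in>V \<inter> W. s Q = (+) t ` ideal_stalk (ker_sheaf n e) dual_pt Q"
      using bspec[OF local P] by blast
    have on: "on_line P" using W P by blast
    have \<eta>V: "generic_point \<in> V" by (rule generic_point_in_open[OF V(1,2) on])
    have t: "t \<in> ker_stalk n e P" "t \<in> ker_stalk n e generic_point"
      by (rule ker_sheaf_subset_stalk[OF _ V(3)], fact)+
    have "s P = {v \<in> ker_stalk n e P. res v = res t}"
      using V(2,4) P coset_ideal_stalk[OF on t(1)] by simp
    moreover have "s generic_point = {v \<in> ker_stalk n e generic_point. res v = res t}"
      using V(4) \<eta>V \<eta> coset_ideal_stalk[OF generic_point_on_line t(2)] by simp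
    ultimately show ?thesis using t by (intro exI[of _ "res t"]) auto
  qed
  obtain u where u: "s generic_point = {v \<in> ker_stalk n e generic_point. res v = u}"
    "\<exists>v\<in>ker_stalk n e generic_point. res v = u"
    using loc[OF \<eta>] by blast
  have P: "(\<exists>v\<in>ker_stalk n e P. res v = u) \<and> s P = {v \<in> ker_stalk n e P. res v = u}" if PW: "P \<in> W" for P
  proof -
    obtain u' where u': "\<exists>v\<in>ker_stalk n e P. res v = u'" "s P = {v \<in> ker_stalk n e P. res v = u'}"
      "s generic_point = {v \<in> ker_stalk n e generic_point. res v = u'}"
      using loc[OF PW] by blast
    have "u' = u" using u u'(3) by auto
    then show ?thesis using u' by blast
  qed
  then have "u \<in> line_sections n e W" by (simp add: line_sections_def)
  moreover have "s = coset_section n e W u"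
  proof
    fix P
    show "s P = coset_section n e W u P"
      using P[of P] s by (auto simp: coset_section_def restr_def extensional_def)
  qed
  ultimately show "s \<in> coset_section n e W ` line_sections n e W" by blast
next
  fix s assume "s \<in> coset_section n e W ` line_sections n e W"
  then obtain u where u: "u \<in> line_sections n e W" "s = coset_section n e W u" by blast
  have "\<exists>V t. openin zariski V \<and> P \<in> V \<and> t \<in> ker_sheaf n e V \<and>
      (\<forall>Q\<in>V \<inter> W. s Q = (+) t ` ideal_stalk (ker_sheaf n e) dual_pt Q)" if P: "P \<in> W" for P
  proof -
    obtain t where t: "t \<in> ker_stalk n e P" "res t = u" using u(1) P by (auto simp: line_sections_def)
    have "P \<in> Proj" using W P on_lineD by blast
    then obtain V where V: "openin zariski V" "P \<in> V" "t \<in> ker_sheaf n e V"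
      using ker_stalk_extends[OF _ t(1)] by blast
    have "s Q = (+) t ` ideal_stalk (ker_sheaf n e) dual_pt Q" if Q: "Q \<in> V \<inter> W" for Q
    proof -
      have "on_line Q" using W Q by blast
      moreover have "t \<in> ker_stalk n e Q" by (rule ker_sheaf_subset_stalk[OF _ V(3)]) (use Q in blast)
      ultimately show ?thesis
        using coset_ideal_stalk[of Q t n e] Q t(2) by (simp add: u(2) coset_section_def)
    qed
    with V show ?thesis by blast
  qed
  then show "s \<in> restr (ker_sheaf n e) dual_pt W"
    by (simp add: restr_def u(2)) (simp add: coset_section_def)
qed

lemma coset_section_inj:
  assumes "P \<in> W" and "u \<in> line_sections n e W" and "coset_section n e W u = coset_section n e W u'"
  shows "u = u'"
proof -
  have "coset_section n e W u P = coset_section n e W u' P" by (simp only: assms(3))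
  then have eq: "{v \<in> ker_stalk n e P. res v = u} = {v \<in> ker_stalk n e P. res v = u'}"
    using assms(1) by (simp add: coset_section_def)
  obtain v where "v \<in> ker_stalk n e P" "res v = u" using assms(1,2) by (auto simp: line_sections_def)
  then have "v \<in> {v \<in> ker_stalk n e P. res v = u'}" using eq by blast
  then show ?thesis using \<open>res v = u\<close> by simp
qed

lemma restrict_coset_section: "W' \<subseteq> W \<Longrightarrow> restrict (coset_section n e W u) W' = coset_section n e W' u"
  by (auto simp: coset_section_def restrict_def fun_eq_iff)

lemma line_sections_mono: "W' \<subseteq> W \<Longrightarrow> u \<in> line_sections n e W \<Longrightarrow> u \<in> line_sections n e W'"
  by (auto simp: line_sections_def)

lemma line_sections_zero: "W \<subseteq> Collect on_line \<Longrightarrow> 0 \<in> line_sections n e W"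
proof -
  assume "W \<subseteq> Collect on_line"
  then have "\<forall>P\<in>W. 0 \<in> ker_stalk n e P" using ker_stalk_zero on_lineD(1) by blast
  moreover have "res 0 = 0"
    by (simp add: vec_eq_iff res_nth fract_map_zero[OF unital_hom_line_poly])
  ultimately show ?thesis unfolding line_sections_def by blast
qed

lemma structure_stalk:
  "g \<in> ker_stalk (0 :: int ^ 1) 0 P \<longleftrightarrow> g $ 1 \<in> loc 0 P"
  by (simp add: ker_stalk_def forall_1)

lemma line_sections_scale:
  assumes W: "W \<subseteq> Collect on_line" and c: "c \<in> line_sections (0 :: int ^ 1) 0 W" and u: "u \<in> line_sections n e W"
  shows "(c $ 1) *s u \<in> line_sections n e W"
  unfolding line_sections_def mem_Collect_eq
proof
  fix P assume P: "P \<in> W"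
  have on: "on_line P" using W P by blast
  obtain g where g: "g $ 1 \<in> loc 0 P" "res g = c" using c P by (auto simp: line_sections_def structure_stalk)
  obtain v where v: "v \<in> ker_stalk n e P" "res v = u" using u P by (auto simp: line_sections_def)
  have "res ((g $ 1) *s v) = (c $ 1) *s u"
    using res_scale[OF on g(1) v(1)] g(2) v(2) by (auto simp: res_nth)
  then show "\<exists>v\<in>ker_stalk n e P. res v = (c $ 1) *s u"
    using ker_stalk_scale[OF on_lineD(1)[OF on] g(1) v(1)] by blast
qed

text \<open>
  The sum over all products of representatives is again a full coset, because it absorbs the kernel of \<open>res\<close>.
\<close>
lemma sec_scale_coset_section:
  assumes W: "W \<subseteq> Collect on_line" and c: "c \<in> line_sections (0 :: int ^ 1) 0 W" and u: "u \<in> line_sections n e W"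
  shows "sec_scale (ker_sheaf n e) dual_pt W (coset_section 0 0 W c) (coset_section n e W u) = coset_section n e W ((c $ 1) *s u)"
proof
  fix P
  show "sec_scale (ker_sheaf n e) dual_pt W (coset_section 0 0 W c) (coset_section n e W u) P = coset_section n e W ((c $ 1) *s u) P"
  proof (cases "P \<in> W")
    case False
    then show ?thesis by (simp add: sec_scale_def coset_section_def)
  next
    case P: True
    have on: "on_line P" using W P by blast
    note Proj = on_lineD(1)[OF on]
    have mult: "(g $ 1) *s v \<in> ker_stalk n e P \<and> res ((g $ 1) *s v) = (c $ 1) *s u"
      if "g $ 1 \<in> loc 0 P" "res g = c" "v \<in> ker_stalk n e P" "res v = u" for g v
      using res_scale[OF on that(1,3)] ker_stalk_scale[OF Proj that(1,3)] that by (auto simp: res_nth)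
    have lhs: "sec_scale (ker_sheaf n e) dual_pt W (coset_section 0 0 W c) (coset_section n e W u) P =
        {(g $ 1) *s v + m | g v m. (g $ 1 \<in> loc 0 P \<and> res g = c) \<and> (v \<in> ker_stalk n e P \<and> res v = u) \<and>
            m \<in> ker_stalk n e P \<and> res m = 0}"
      using P by (simp add: sec_scale_def coset_section_def ideal_stalk_eq[OF on refl] structure_stalk)
    have rhs: "coset_section n e W ((c $ 1) *s u) P = {v \<in> ker_stalk n e P. res v = (c $ 1) *s u}"
      using P by (simp add: coset_section_def)
    show ?thesis unfolding lhs rhs
    proof (intro set_eqI iffI)
      fix t assume "t \<in> {(g $ 1) *s v + m | g v m. (g $ 1 \<in> loc 0 P \<and> res g = c) \<and>
          (v \<in> ker_stalk n e P \<and> res v = u) \<and> m \<in> ker_stalk n e P \<and> res m = 0}"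
      then obtain g v m where t: "t = (g $ 1) *s v + m" and gv: "g $ 1 \<in> loc 0 P" "res g = c"
        "v \<in> ker_stalk n e P" "res v = u" and m: "m \<in> ker_stalk n e P" "res m = 0" by blast
      show "t \<in> {v \<in> ker_stalk n e P. res v = (c $ 1) *s u}"
        using mult[OF gv] m ker_stalk_add[OF Proj _ m(1)] res_add[OF on _ m(1)] by (simp add: t)
    next
      fix t assume t: "t \<in> {v \<in> ker_stalk n e P. res v = (c $ 1) *s u}"
      obtain g where g: "g $ 1 \<in> loc 0 P" "res g = c" using c P by (auto simp: line_sections_def structure_stalk)
      obtain v where v: "v \<in> ker_stalk n e P" "res v = u" using u P by (auto simp: line_sections_def)
      let ?m = "t - (g $ 1) *s v"
      have "?m \<in> ker_stalk n e P"
        using ker_stalk_add[OF Proj, of t n e "- ((g $ 1) *s v)"] ker_stalk_uminus[OF Proj, of "(g $ 1) *s v" n e]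
          mult[OF g v] t by simp
      moreover have "res ?m = 0" using res_diff[OF on, of t n e "(g $ 1) *s v"] mult[OF g v] t by simp
      moreover have "t = (g $ 1) *s v + ?m" by simp
      ultimately show "t \<in> {(g $ 1) *s v + m | g v m. (g $ 1 \<in> loc 0 P \<and> res g = c) \<and>
          (v \<in> ker_stalk n e P \<and> res v = u) \<and> m \<in> ker_stalk n e P \<and> res m = 0}"
        using g v by blast
    qed
  qed
qed

section \<open>Transport of twisted sections\<close>

definition open_part :: "'k poly3 set set \<Rightarrow> bool" where
  "open_part W \<longleftrightarrow> openin (subtopology zariski (line_of dual_pt)) W \<and> generic_point \<in> W"

lemma open_partD:
  assumes "open_part W"
  shows "openin (subtopology zariski (line_of dual_pt)) W" "generic_point \<in> W" "W \<subseteq> Collect on_line"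
  using assms openin_subset[of "subtopology zariski (line_of dual_pt)" W]
  by (auto simp: open_part_def line_of_dual_pt)

text \<open>
  An isomorphism of restricted sheaves, expressed on vectors over the function field.  Compatibility with
  scalars determines the image of zero and governs the gluing of twisted sections.
\<close>
lemma restr_iso_line_sections:
  fixes n :: "int ^ 'r::finite" and n' :: "int ^ 's::finite"
  assumes "restr_iso (ker_sheaf n e) (ker_sheaf n' e') dual_pt"
  obtains \<psi> where
    "\<And>W. open_part W \<Longrightarrow> bij_betw (\<psi> W) (line_sections n e W) (line_sections n' e' W)"
    "\<And>W c u. open_part W \<Longrightarrow> c \<in> line_sections (0 :: int ^ 1) 0 W \<Longrightarrow> u \<in> line_sections n e W \<Longrightarrow>
      \<psi> W ((c $ 1) *s u) = (c $ 1) *s \<psi> W u"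
    "\<And>W W' u. open_part W \<Longrightarrow> W' \<subseteq> W \<Longrightarrow> open_part W' \<Longrightarrow> u \<in> line_sections n e W \<Longrightarrow> \<psi> W' u = \<psi> W u"
proof -
  let ?F = "ker_sheaf n e" and ?G = "ker_sheaf n' e'"
  obtain \<phi> where iso: "\<forall>W. openin (subtopology zariski (line_of dual_pt)) W \<longrightarrow>
      bij_betw (\<phi> W) (restr ?F dual_pt W) (restr ?G dual_pt W) \<and>
      (\<forall>s\<in>restr ?F dual_pt W. \<forall>t\<in>restr ?F dual_pt W. \<phi> W (sec_add W s t) = sec_add W (\<phi> W s) (\<phi> W t)) \<and>
      (\<forall>c\<in>restr (twist_sum (0::int^1)) dual_pt W. \<forall>s\<in>restr ?F dual_pt W.
         \<phi> W (sec_scale ?F dual_pt W c s) = sec_scale ?G dual_pt W c (\<phi> W s)) \<and>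
      (\<forall>W' \<subseteq> W. openin (subtopology zariski (line_of dual_pt)) W' \<longrightarrow>
         (\<forall>s\<in>restr ?F dual_pt W. \<phi> W' (restrict s W') = restrict (\<phi> W s) W'))"
    using assms unfolding restr_iso_def by (rule exE)
  note isoW = iso[THEN spec, THEN mp]
  have \<phi>:
    "bij_betw (\<phi> W) (restr ?F dual_pt W) (restr ?G dual_pt W)"
    "c \<in> restr (twist_sum (0::int^1)) dual_pt W \<Longrightarrow> s \<in> restr ?F dual_pt W \<Longrightarrow>
      \<phi> W (sec_scale ?F dual_pt W c s) = sec_scale ?G dual_pt W c (\<phi> W s)"
    "W' \<subseteq> W \<Longrightarrow> openin (subtopology zariski (line_of dual_pt)) W' \<Longrightarrow> s \<in> restr ?F dual_pt W \<Longrightarrow>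
      \<phi> W' (restrict s W') = restrict (\<phi> W s) W'"
    if "openin (subtopology zariski (line_of dual_pt)) W" for W W' c s
    using isoW[OF that, THEN conjunct1] isoW[OF that, THEN conjunct2, THEN conjunct2, THEN conjunct1]
      isoW[OF that, THEN conjunct2, THEN conjunct2, THEN conjunct2]
    by simp_all
  define \<psi> where "\<psi> W u = inv_into (line_sections n' e' W) (coset_section n' e' W) (\<phi> W (coset_section n e W u))" for W u
  have bij: "bij_betw (coset_section n e W) (line_sections n e W) (restr (ker_sheaf n e) dual_pt W)"
    "bij_betw (coset_section n' e' W) (line_sections n' e' W) (restr (ker_sheaf n' e') dual_pt W)" if "open_part W" for W
    using restr_eq[OF open_partD(3,2)[OF that]] coset_section_inj[OF open_partD(2)[OF that]]
    by (auto simp: bij_betw_def inj_on_def)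
  have \<psi>bij: "bij_betw (\<psi> W) (line_sections n e W) (line_sections n' e' W)" if W: "open_part W" for W
  proof -
    have "bij_betw (inv_into (line_sections n' e' W) (coset_section n' e' W) \<circ> (\<phi> W \<circ> coset_section n e W)) (line_sections n e W) (line_sections n' e' W)"
      by (rule bij_betw_trans[OF bij_betw_trans[OF bij(1)[OF W] \<phi>(1)[OF open_partD(1)[OF W]]]
            bij_betw_inv_into[OF bij(2)[OF W]]])
    then show ?thesis by (simp add: \<psi>_def comp_def cong: bij_betw_cong)
  qed
  have sec_\<psi>: "coset_section n' e' W (\<psi> W u) = \<phi> W (coset_section n e W u)" if "open_part W" "u \<in> line_sections n e W" for W u
  proof -
    have "coset_section n e W u \<in> restr (ker_sheaf n e) dual_pt W" using bij(1)[OF that(1)] that(2) by (auto simp: bij_betw_def)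
    then have "\<phi> W (coset_section n e W u) \<in> restr (ker_sheaf n' e') dual_pt W"
      using \<phi>(1)[OF open_partD(1)[OF that(1)]] by (auto simp: bij_betw_def)
    then have "\<phi> W (coset_section n e W u) \<in> coset_section n' e' W ` line_sections n' e' W"
      using bij(2)[OF that(1)] by (auto simp: bij_betw_def)
    then show ?thesis unfolding \<psi>_def by (rule f_inv_into_f)
  qed
  have \<psi>in: "\<psi> W u \<in> line_sections n' e' W" if "open_part W" "u \<in> line_sections n e W" for W u
    using \<psi>bij[OF that(1)] that(2) by (auto simp: bij_betw_def)
  have scale: "\<psi> W ((c $ 1) *s u) = (c $ 1) *s \<psi> W u"
    if W: "open_part W" and c: "c \<in> line_sections (0 :: int ^ 1) 0 W" and u: "u \<in> line_sections n e W" for W c u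
  proof -
    note sub = open_partD(3)[OF W]
    have "coset_section 0 0 W c \<in> restr (twist_sum (0::int^1)) dual_pt W"
      using restr_eq[OF open_partD(3,2)[OF W], of "0 :: int ^ 1" 0] c by (simp add: twist_sum_eq_ker_sheaf)
    moreover have "coset_section n e W u \<in> restr (ker_sheaf n e) dual_pt W"
      using restr_eq[OF open_partD(3,2)[OF W]] u by blast
    ultimately have "\<phi> W (coset_section n e W ((c $ 1) *s u)) = sec_scale (ker_sheaf n' e') dual_pt W (coset_section 0 0 W c) (\<phi> W (coset_section n e W u))"
      using \<phi>(2)[OF open_partD(1)[OF W]] by (simp only: sec_scale_coset_section[OF sub c u, symmetric])
    then have "coset_section n' e' W (\<psi> W ((c $ 1) *s u)) = coset_section n' e' W ((c $ 1) *s \<psi> W u)"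
      by (simp only: sec_\<psi>[OF W u, symmetric] sec_\<psi>[OF W line_sections_scale[OF sub c u], symmetric]
          sec_scale_coset_section[OF sub c \<psi>in[OF W u]])
    then show ?thesis
      by (rule coset_section_inj[OF open_partD(2)[OF W] \<psi>in[OF W line_sections_scale[OF sub c u]]])
  qed
  have restr: "\<psi> W' u = \<psi> W u"
    if W: "open_part W" and W': "W' \<subseteq> W" "open_part W'" and u: "u \<in> line_sections n e W" for W W' u
  proof -
    have "coset_section n e W u \<in> restr (ker_sheaf n e) dual_pt W"
      using restr_eq[OF open_partD(3,2)[OF W]] u by blast
    then have "\<phi> W' (coset_section n e W' u) = restrict (coset_section n' e' W (\<psi> W u)) W'"
      using \<phi>(3)[OF open_partD(1)[OF W] W'(1) open_partD(1)[OF W'(2)]]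
      by (simp only: restrict_coset_section[OF W'(1), symmetric] sec_\<psi>[OF W u])
    then have "coset_section n' e' W' (\<psi> W' u) = coset_section n' e' W' (\<psi> W u)"
      by (simp only: sec_\<psi>[OF W'(2) line_sections_mono[OF W'(1) u]] restrict_coset_section[OF W'(1)])
    then show ?thesis
      by (rule coset_section_inj[OF open_partD(2)[OF W'(2)] \<psi>in[OF W'(2) line_sections_mono[OF W'(1) u]]])
  qed
  show thesis
    by (rule that[OF \<psi>bij scale restr])
qed

definition chart :: "'k ^ 3 \<Rightarrow> 'k poly3 set set" where
  "chart x = {P. on_line P \<and> linear_form x \<notin> P}"

lemma open_part_chart:
  assumes "R (linear_form x) \<noteq> 0"
  shows "open_part (chart x)"
proof -
  have "chart x = basic_open (linear_form x) \<inter> line_of dual_pt"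
    unfolding line_of_dual_pt by (auto simp: chart_def basic_open_def on_line_def)
  then have "openin (subtopology zariski (line_of dual_pt)) (chart x)"
    unfolding openin_subtopology using openin_basic_open by blast
  moreover have "generic_point \<in> chart x"
    using assms generic_point_on_line
    by (simp add: chart_def generic_point_def homogeneous_in_line_prime_iff[OF homogeneous_linear_form])
  ultimately show ?thesis by (simp add: open_part_def)
qed

lemma open_part_x0: "open_part (chart x0)" and open_part_x1: "open_part (chart x1)"
  by (rule open_part_chart; simp add: R_x0 R_x1)+

lemma open_part_x01: "open_part (chart x0 \<inter> chart x1)"
  using open_part_x0 open_part_x1 by (auto simp: open_part_def)

definition \<tau> :: "'k poly fract" where
  "\<tau> = Fract [:0, 1:] 1"

lemma Fract_power: "Fract a b ^ k = Fract (a ^ k) (b ^ k)"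
  by (induction k) (simp_all add: One_fract_def)

lemma ex_loc_power:
  assumes on: "on_line P" and x: "linear_form x \<notin> P"
  shows "\<exists>g\<in>loc m P. fract_map R g = Fract (R (linear_form x)) 1 powi m"
proof -
  have xk: "linear_form x ^ k \<notin> P" for k using x Proj_power[OF on_lineD(1)[OF on]] by auto
  have hom: "homogeneous k (linear_form x ^ k)" for k
    using homogeneous_power[OF homogeneous_linear_form, of k x] by simp
  have Rk: "R (linear_form x ^ k) = R (linear_form x) ^ k" for k
    by (simp add: unital_hom.power[OF unital_hom_line_poly])
  show ?thesis
  proof (cases m)
    case (nonneg k)
    have "Fract (linear_form x ^ k) 1 \<in> loc m P"
      using loc_poly[OF on_lineD(1)[OF on] hom] nonneg by simp
    moreover have "fract_map R (Fract (linear_form x ^ k) 1) = Fract (R (linear_form x)) 1 powi m"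
      by (simp add: fract_map_poly[OF unital_hom_line_poly] Rk nonneg Fract_power)
    ultimately show ?thesis by blast
  next
    case (neg k)
    have "Fract 1 (linear_form x ^ Suc k) \<in> loc m P"
      by (rule loc_Fract[OF homogeneous_one hom xk]) (simp add: neg)
    moreover have "fract_map R (Fract 1 (linear_form x ^ Suc k)) = Fract (R (linear_form x)) 1 powi m"
      unfolding neg power_int_minus power_int_of_nat
      by (simp add: fract_map_Fract[OF unital_hom_line_poly] R_linear_form_nonzero[OF on x]
          unital_hom.one[OF unital_hom_line_poly] Rk Fract_power del: power_Suc)
    ultimately show ?thesis by blast
  qed
qed

lemma \<tau>_power_section: "(\<chi> i. \<tau> powi d) \<in> line_sections (0 :: int ^ 1) 0 (chart x0 \<inter> chart x1)"
proof -
  have "\<exists>v\<in>ker_stalk (0 :: int ^ 1) 0 P. res v = (\<chi> i. \<tau> powi d)" if "P \<in> chart x0 \<inter> chart x1" for P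
  proof -
    have on: "on_line P" and x: "linear_form x0 \<notin> P" "linear_form x1 \<notin> P" using that by (auto simp: chart_def)
    obtain g where g: "g \<in> loc (- d) P" "fract_map R g = 1"
      using ex_loc_power[OF on x(1), of "- d"] by (auto simp: R_x0 simp flip: One_fract_def)
    obtain h where h: "h \<in> loc d P" "fract_map R h = \<tau> powi d"
      using ex_loc_power[OF on x(2), of d] by (auto simp: R_x1 \<tau>_def)
    have "g * h \<in> loc 0 P" using loc_mult[OF on_lineD(1)[OF on] g(1) h(1)] by simp
    moreover have "fract_map R (g * h) = \<tau> powi d"
      using regular_mult(2)[OF unital_hom_line_poly loc_regular[OF on g(1)] loc_regular[OF on h(1)]] g h by simp
    ultimately show ?thesis
      by (intro bexI[of _ "\<chi> i. g * h"]) (simp_all add: structure_stalk res_def)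
  qed
  then show ?thesis by (simp add: line_sections_def)
qed

text \<open>
  Sections of the \<open>d\<close>-th twist, trivialised by \<open>x0\<^sup>d\<close> and \<open>x1\<^sup>d\<close> on the two standard charts of the line;
  \<open>\<tau>\<close> is the restriction of \<open>x1 / x0\<close>.
\<close>

definition twisted :: "int \<Rightarrow> int ^ 'r \<Rightarrow> 'k ratf3 ^ 'r \<Rightarrow> ('k poly fract ^ 'r::finite) set" where
  "twisted d n e = {u \<in> line_sections n e (chart x0). (\<tau> powi (- d)) *s u \<in> line_sections n e (chart x1)}"

text \<open>
  The two halves of a twisted section are mapped separately.  On the intersection of the charts they differ
  by the scalar \<open>\<tau>\<^bsup>-d\<^esup>\<close>, which is a section of the structure sheaf there, so the images differ by it too.
\<close>
lemma twisted_transfer: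
  fixes n :: "int ^ 'r::finite" and n' :: "int ^ 's::finite"
  assumes "restr_iso (ker_sheaf n e) (ker_sheaf n' e') dual_pt"
  shows "(\<exists>u\<in>twisted d n e. u \<noteq> 0) \<longleftrightarrow> (\<exists>u\<in>twisted d n' e'. u \<noteq> 0)"
proof (rule restr_iso_line_sections[OF assms])
  fix \<psi> assume \<psi>:
    "\<And>W. open_part W \<Longrightarrow> bij_betw (\<psi> W) (line_sections n e W) (line_sections n' e' W)"
    "\<And>W c u. open_part W \<Longrightarrow> c \<in> line_sections (0 :: int ^ 1) 0 W \<Longrightarrow> u \<in> line_sections n e W \<Longrightarrow>
      \<psi> W ((c $ 1) *s u) = (c $ 1) *s \<psi> W u"
    "\<And>W W' u. open_part W \<Longrightarrow> W' \<subseteq> W \<Longrightarrow> open_part W' \<Longrightarrow> u \<in> line_sections n e W \<Longrightarrow> \<psi> W' u = \<psi> W u"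
  let ?Wa = "chart x0" and ?Wb = "chart x1" and ?W = "chart x0 \<inter> chart x1"
  let ?c = "(\<chi> i. \<tau> powi (- d)) :: 'k poly fract ^ 1"
  note W0 = open_part_x0 and W1 = open_part_x1 and W = open_part_x01
  have \<psi>in: "\<psi> W u \<in> line_sections n' e' W" if "open_part W" "u \<in> line_sections n e W" for W u
    using \<psi>(1)[OF that(1)] that(2) by (auto simp: bij_betw_def)
  have \<psi>inj: "u = u'" if "open_part W" "u \<in> line_sections n e W" "u' \<in> line_sections n e W" "\<psi> W u = \<psi> W u'" for W u u'
    using \<psi>(1)[OF that(1)] that(2-) by (auto simp: bij_betw_def inj_on_def)
  have \<psi>surj: "\<exists>u\<in>line_sections n e W. \<psi> W u = u'" if "open_part W" "u' \<in> line_sections n' e' W" for W u'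
  proof -
    have "u' \<in> \<psi> W ` line_sections n e W"
      using bij_betw_imp_surj_on[OF \<psi>(1)[OF that(1)]] that(2) by simp
    then show ?thesis by auto
  qed
  have \<psi>0: "\<psi> W 0 = 0" if "open_part W" for W
    using \<psi>(2)[OF that line_sections_zero line_sections_zero] open_partD(3)[OF that] by simp
  have glue: "\<psi> ?W ((\<tau> powi (- d)) *s u) = (\<tau> powi (- d)) *s \<psi> ?Wa u" if "u \<in> line_sections n e ?Wa" for u
    using \<psi>(2)[OF W \<tau>_power_section line_sections_mono[OF Int_lower1 that], of "- d"] \<psi>(3)[OF W0 Int_lower1 W that] by simp
  show ?thesis
  proof
    assume "\<exists>u\<in>twisted d n e. u \<noteq> 0"
    then obtain u where u: "u \<in> line_sections n e ?Wa" "(\<tau> powi (- d)) *s u \<in> line_sections n e ?Wb" "u \<noteq> 0"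
      by (auto simp: twisted_def)
    have "(\<tau> powi (- d)) *s \<psi> ?Wa u = \<psi> ?Wb ((\<tau> powi (- d)) *s u)"
      using glue[OF u(1)] \<psi>(3)[OF W1 Int_lower2 W u(2)] by simp
    then have "\<psi> ?Wa u \<in> twisted d n' e'"
      using \<psi>in[OF W0 u(1)] \<psi>in[OF W1 u(2)] by (simp add: twisted_def)
    moreover have "\<psi> ?Wa u \<noteq> 0"
      using \<psi>inj[OF W0 u(1) line_sections_zero[OF open_partD(3)[OF W0]]] \<psi>0[OF W0] u(3) by auto
    ultimately show "\<exists>u\<in>twisted d n' e'. u \<noteq> 0" by blast
  next
    assume "\<exists>u\<in>twisted d n' e'. u \<noteq> 0"
    then obtain u' where u': "u' \<in> line_sections n' e' ?Wa" "(\<tau> powi (- d)) *s u' \<in> line_sections n' e' ?Wb" "u' \<noteq> 0"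
      by (auto simp: twisted_def)
    obtain u where u: "u \<in> line_sections n e ?Wa" "\<psi> ?Wa u = u'"
      using \<psi>surj[OF W0 u'(1)] by blast
    obtain u1 where u1: "u1 \<in> line_sections n e ?Wb" "\<psi> ?Wb u1 = (\<tau> powi (- d)) *s u'"
      using \<psi>surj[OF W1 u'(2)] by blast
    have "(\<tau> powi (- d)) *s u \<in> line_sections n e ?W"
      using line_sections_scale[OF open_partD(3)[OF W] \<tau>_power_section line_sections_mono[OF Int_lower1 u(1)], of "- d"] by simp
    moreover have "u1 \<in> line_sections n e ?W" by (rule line_sections_mono[OF _ u1(1)]) blast
    moreover have "\<psi> ?W ((\<tau> powi (- d)) *s u) = \<psi> ?W u1"
      using glue[OF u(1)] \<psi>(3)[OF W1 Int_lower2 W u1(1)] u(2) u1(2) by simp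
    ultimately have "(\<tau> powi (- d)) *s u = u1" by (intro \<psi>inj[OF W])
    then have "u \<in> twisted d n e" using u u1 by (simp add: twisted_def)
    moreover have "u \<noteq> 0" using u(2) u'(3) \<psi>0[OF W0] by auto
    ultimately show "\<exists>u\<in>twisted d n e. u \<noteq> 0" by blast
  qed
qed

end

section \<open>Twisted sections are vectors of polynomials\<close>

lemma ex_prime_factor:
  fixes b :: "'k::field poly"
  assumes "degree b > 0"
  shows "\<exists>\<pi>. prime_elem \<pi> \<and> \<pi> dvd b"
proof -
  define A where "A = {q. q dvd b \<and> degree q > 0}"
  have "b \<in> A" using assms by (simp add: A_def)
  then obtain \<pi> where \<pi>: "\<pi> \<in> A" "\<And>q. q \<in> A \<Longrightarrow> degree \<pi> \<le> degree q"
    using ex_has_least_nat[of "\<lambda>q. q \<in> A" b degree] by blast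
  have "irreducible \<pi>"
  proof (rule irreducibleI)
    show "\<pi> \<noteq> 0" using \<pi>(1) by (auto simp: A_def)
    then show "\<not> is_unit \<pi>" using \<pi>(1) by (simp add: A_def is_unit_iff_degree)
    fix p q assume pq: "\<pi> = p * q"
    then have nz: "p \<noteq> 0" "q \<noteq> 0" using \<open>\<pi> \<noteq> 0\<close> by auto
    show "is_unit p \<or> is_unit q"
    proof (rule ccontr)
      assume "\<not> (is_unit p \<or> is_unit q)"
      then have deg: "degree p > 0" "degree q > 0" using nz by (auto simp: is_unit_iff_degree)
      then have "p \<in> A" using \<pi>(1) pq by (auto simp: A_def intro: dvd_trans)
      then show False using \<pi>(2)[of p] deg nz by (simp add: pq degree_mult_eq)
    qed
  qed
  then show ?thesis using \<pi>(1) field_poly_irreducible_imp_prime by (auto simp: A_def)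
qed

text \<open>
  In a denominator of least degree every prime factor could be cancelled, so the denominator is constant.
\<close>
lemma fract_poly_if_locally_poly:
  fixes g :: "'k::field poly fract"
  assumes "\<And>\<pi>. prime_elem \<pi> \<Longrightarrow> \<exists>a b. \<not> \<pi> dvd b \<and> g = Fract a b"
  shows "\<exists>N. g = Fract N 1"
proof -
  define A where "A = {b. b \<noteq> 0 \<and> (\<exists>a. g = Fract a b)}"
  obtain a0 b0 where "b0 \<noteq> 0" "g = Fract a0 b0" by (cases g) auto
  then have "b0 \<in> A" by (auto simp: A_def)
  then obtain b where b: "b \<in> A" "\<And>q. q \<in> A \<Longrightarrow> degree b \<le> degree q"
    using ex_has_least_nat[of "\<lambda>q. q \<in> A" b0 degree] by blast
  obtain a where a: "b \<noteq> 0" "g = Fract a b" using b(1) by (auto simp: A_def)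
  have "degree b = 0"
  proof (rule ccontr)
    assume "degree b \<noteq> 0"
    then obtain \<pi> where \<pi>: "prime_elem \<pi>" "\<pi> dvd b" using ex_prime_factor by blast
    obtain b' where b': "b = \<pi> * b'" using \<pi>(2) by (rule dvdE)
    obtain c e where ce: "\<not> \<pi> dvd e" "g = Fract c e" using assms[OF \<pi>(1)] by blast
    have "e \<noteq> 0" using ce(1) by auto
    then have "a * e = \<pi> * (b' * c)" using a ce(2) b' by (simp add: eq_fract mult_ac)
    then have "\<pi> dvd a * e" by simp
    then have "\<pi> dvd a" using \<pi>(1) ce(1) prime_elem_dvd_multD by blast
    then obtain a' where a': "a = \<pi> * a'" by (rule dvdE)
    have nz: "b' \<noteq> 0" "\<pi> \<noteq> 0" using a(1) b' by auto
    then have "g = Fract a' b'" using a(2) a' b' by (simp add: eq_fract)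
    then have "b' \<in> A" using nz by (auto simp: A_def)
    then have "degree b \<le> degree b'" by (rule b(2))
    moreover have "degree \<pi> > 0" using \<pi>(1) nz(2) by (auto simp: prime_elem_def is_unit_iff_degree)
    ultimately show False using nz by (simp add: b' degree_mult_eq)
  qed
  then obtain c where c: "b = [:c:]" by (rule degree_eq_zeroE)
  then have "g = Fract (smult (inverse c) a) 1" using a by (simp add: eq_fract)
  then show ?thesis by blast
qed

context line_frame
begin

lemma line_prime_in_chart:
  assumes "prime_elem \<pi>"
  shows "line_prime p0 p1 \<pi> \<in> chart x0"
  using line_prime_on_line[of \<pi>] assms
  by (auto simp: chart_def homogeneous_in_line_prime_iff[OF homogeneous_linear_form] R_x0 prime_elem_def)

definition infinity_point :: "'k poly3 set" where
  "infinity_point = line_prime p1 p0 [:0, 1:]"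

lemma prime_elem_linear: "prime_elem [:a, 1 :: 'k:]"
  by (rule prime_elem_linear_field_poly) simp

lemma infinity_point_in_chart: "infinity_point \<in> chart x1"
proof -
  have x1: "\<not> [:0, 1:] dvd line_poly p1 p0 (linear_form x1)"
    by (simp add: line_poly_linear_form flip: poly_eq_0_iff_dvd[of _ 0, simplified])
  have "infinity_point \<in> Proj"
    unfolding infinity_point_def by (rule line_prime_in_Proj[OF disjI2[OF prime_elem_linear] x1])
  then show ?thesis
    using x1 by (simp add: chart_def on_line_def infinity_point_def
        homogeneous_in_line_prime_iff[OF homogeneous_linear_form] line_poly_linear_form)
qed

lemma degree_R_at_infinity:
  assumes "homogeneous j b" and "b \<notin> infinity_point"
  shows "degree (R b) = j"
proof -
  have "\<not> [:- 0, 1:] dvd line_poly p1 p0 b"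
    using assms by (simp add: infinity_point_def homogeneous_in_line_prime_iff)
  then have "evalp b p1 \<noteq> 0"
    by (simp only: poly_eq_0_iff_dvd[symmetric] poly_line_poly) simp
  then have "coeff (R b) j \<noteq> 0" using coeff_line_poly[OF assms(1)] by simp
  then show ?thesis using le_degree degree_line_poly[OF assms(1)] by (metis le_antisym)
qed

text \<open>
  Regularity on the first chart makes the components polynomials in \<open>\<tau>\<close>; regularity of the second half at the
  point at infinity bounds their degrees.
\<close>
lemma twisted_polynomial:
  assumes "u \<in> twisted d n e"
  shows "\<exists>N. u $ i = Fract N 1 \<and> (N = 0 \<or> int (degree N) \<le> d + n $ i)"
proof -
  have "\<exists>a b. \<not> \<pi> dvd b \<and> u $ i = Fract a b" if \<pi>: "prime_elem \<pi>" for \<pi>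
  proof -
    let ?P = "line_prime p0 p1 \<pi>"
    have P: "?P \<in> chart x0" by (rule line_prime_in_chart[OF \<pi>])
    then have on: "on_line ?P" by (simp add: chart_def)
    obtain v where v: "v \<in> ker_stalk n e ?P" "res v = u"
      using P assms by (auto simp: twisted_def line_sections_def)
    then have "v $ i \<in> loc (n $ i) ?P" by (simp add: ker_stalk_def)
    then obtain a b j k where ab: "homogeneous j a" "homogeneous k b" "b \<notin> ?P" "v $ i = Fract a b"
      by (rule locE)
    have "u $ i = Fract (R a) (R b)"
      using v(2) ab(4) fract_map_Fract[OF unital_hom_line_poly R_nonzero[OF on ab(2,3)]] by (auto simp: res_nth)
    moreover have "\<not> \<pi> dvd R b"
      using ab(3) by (simp add: homogeneous_in_line_prime_iff[OF ab(2)])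
    ultimately show ?thesis by blast
  qed
  then obtain N where N: "u $ i = Fract N 1" using fract_poly_if_locally_poly by blast
  have "int (degree N) \<le> d + n $ i" if nz: "N \<noteq> 0"
  proof -
    have on: "on_line infinity_point" using infinity_point_in_chart by (simp add: chart_def)
    obtain v where v: "v \<in> ker_stalk n e infinity_point" "res v = (\<tau> powi (- d)) *s u"
      using infinity_point_in_chart assms by (auto simp: twisted_def line_sections_def)
    then have "v $ i \<in> loc (n $ i) infinity_point" by (simp add: ker_stalk_def)
    then obtain a b j k where ab: "homogeneous j a" "homogeneous k b" "int j - int k = n $ i"
      "b \<notin> infinity_point" "v $ i = Fract a b" by (rule locE)
    have Rb: "R b \<noteq> 0" by (rule R_nonzero[OF on ab(2,4)])
    have "fract_map R (v $ i) = \<tau> powi (- d) * u $ i"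
      using v(2) by (simp add: vec_eq_iff res_nth)
    then have eq: "Fract (R a) (R b) = \<tau> powi (- d) * Fract N 1"
      using N ab(5) fract_map_Fract[OF unital_hom_line_poly Rb] by simp
    have deg: "degree (R a) \<le> j" "degree (R b) = k"
      using degree_line_poly[OF ab(1)] degree_R_at_infinity[OF ab(2,4)] by auto
    have pow: "degree ([:0, 1:] ^ m :: 'k poly) = m" "[:0, 1:] ^ m \<noteq> (0 :: 'k poly)" for m
      by (simp_all add: degree_power_eq)
    show ?thesis
    proof (cases d)
      case (nonneg m)
      have "Fract (R a) (R b) = Fract N ([:0, 1:] ^ m)"
        using eq unfolding nonneg power_int_minus power_int_of_nat by (simp add: \<tau>_def Fract_power)
      then have e: "R a * [:0, 1:] ^ m = N * R b" using Rb pow by (simp add: eq_fract)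
      then have "R a \<noteq> 0" using Rb nz by auto
      then have "degree (R a) + m = degree N + k"
        using arg_cong[OF e, of degree] Rb nz pow deg by (simp add: degree_mult_eq)
      then show ?thesis using deg(1) ab(3) nonneg by linarith
    next
      case (neg m)
      have "Fract (R a) (R b) = Fract ([:0, 1:] ^ Suc m * N) 1"
        using eq unfolding neg minus_minus power_int_of_nat by (simp add: \<tau>_def Fract_power del: power_Suc)
      then have e: "R a = [:0, 1:] ^ Suc m * N * R b" using Rb by (simp add: eq_fract del: power_Suc)
      have "degree (R a) = Suc m + degree N + k"
        unfolding e using Rb nz pow[of "Suc m"] deg by (simp add: degree_mult_eq del: power_Suc)
      then show ?thesis using deg(1) ab(3) neg by linarith
    qed
  qed
  then show ?thesis using N by blast
qed

section \<open>Twisted sections of a sum of two line bundles\<close>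

text \<open>
  The section is the generator of the first summand, given by \<open>x0\<^bsup>-a\<^esup>\<close> and \<open>x1\<^bsup>-a\<^esup>\<close> on the charts.
\<close>
lemma ex_nonzero_twisted_sum:
  "\<exists>u\<in>twisted a (vector [- a, - b] :: int ^ 2) 0. u \<noteq> 0"
proof -
  let ?n = "vector [- a, - b] :: int ^ 2"
  have lift: "\<exists>v\<in>ker_stalk ?n 0 P. res v = (\<chi> i. if i = 1 then Fract (R (linear_form x)) 1 powi (- a) else 0)"
    if "P \<in> chart x" for P x
  proof -
    have on: "on_line P" and x: "linear_form x \<notin> P" using that by (auto simp: chart_def)
    obtain g where g: "g \<in> loc (- a) P" "fract_map R g = Fract (R (linear_form x)) 1 powi (- a)"
      using ex_loc_power[OF on x] by blast
    have "(\<chi> i. if i = 1 then g else 0) \<in> ker_stalk ?n 0 P"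
      using g(1) loc_zero[OF on_lineD(1)[OF on]] by (simp add: ker_stalk_def forall_2)
    moreover have "res (\<chi> i. if i = 1 then g else 0 :: 'k ratf3 ^ 2) =
        (\<chi> i. if i = 1 then Fract (R (linear_form x)) 1 powi (- a) else 0)"
      using g(2) by (simp add: res_def vec_eq_iff fract_map_zero[OF unital_hom_line_poly])
    ultimately show ?thesis by blast
  qed
  have one: "Fract (R (linear_form x0)) 1 powi (- a) = 1"
    by (simp add: R_x0 flip: One_fract_def)
  have tau: "Fract (R (linear_form x1)) 1 powi (- a) = \<tau> powi (- a)"
    by (simp add: R_x1 \<tau>_def)
  let ?u = "(\<chi> i. if i = 1 then 1 else 0) :: 'k poly fract ^ 2"
  have "?u \<in> line_sections ?n 0 (chart x0)"
    using lift[of _ x0] unfolding one by (simp add: line_sections_def)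
  moreover have "(\<tau> powi (- a)) *s ?u = (\<chi> i. if i = 1 then \<tau> powi (- a) else 0)"
    by (simp add: vec_eq_iff)
  then have "(\<tau> powi (- a)) *s ?u \<in> line_sections ?n 0 (chart x1)"
    using lift[of _ x1] unfolding tau by (simp add: line_sections_def)
  moreover have "?u \<noteq> 0" by (simp add: vec_eq_iff forall_2)
  ultimately show ?thesis unfolding twisted_def by blast
qed

lemma nonzero_twisted_sum_imp:
  assumes "u \<in> twisted d (vector [- a, - b] :: int ^ 2) 0" and "u \<noteq> 0" and "a \<le> b"
  shows "a \<le> d"
proof -
  obtain i where i: "u $ i \<noteq> 0" using assms(2) by (auto simp: vec_eq_iff)
  obtain N where N: "u $ i = Fract N 1" "N = 0 \<or> int (degree N) \<le> d + (vector [- a, - b] :: int ^ 2) $ i"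
    using twisted_polynomial[OF assms(1)] by blast
  have "N \<noteq> 0" using i N(1) by (auto simp: Zero_fract_def)
  then have "0 \<le> d + (vector [- a, - b] :: int ^ 2) $ i" using N(2) by linarith
  then show ?thesis using exhaust_2[of i] assms(3) by (auto simp: vector_2)
qed

end

section \<open>Curves from twisted sections\<close>

lemma dot_commute: "dot u v = dot v u"
  by (simp add: dot_def mult.commute)

lemma dot_minus: "dot (- u) v = - dot u v" "dot u (- v) = - dot u v"
  by (simp_all add: dot_def sum_negf)

lemma unital_hom_Fract: "unital_hom (\<lambda>a :: 'a::idom. Fract a 1)"
  by unfold_locales (simp_all add: One_fract_def)

text \<open>
  The binary form of degree \<open>n\<close> in \<open>a\<close> and \<open>b\<close> whose dehomogenisation is \<open>N\<close>.
\<close>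
definition homogenization :: "'k::field poly3 \<Rightarrow> 'k poly3 \<Rightarrow> nat \<Rightarrow> 'k poly \<Rightarrow> 'k poly3" where
  "homogenization a b n N = (\<Sum>k\<le>n. const3 (coeff N k) * (a ^ (n - k) * b ^ k))"

lemma homogeneous_homogenization:
  assumes "homogeneous 1 a" and "homogeneous 1 b"
  shows "homogeneous n (homogenization a b n N)"
  unfolding homogenization_def
proof (rule homogeneous_sum)
  fix k assume "k \<in> {..n}"
  then have "0 + ((n - k) * 1 + k * 1) = n" by simp
  then show "homogeneous n (const3 (coeff N k) * (a ^ (n - k) * b ^ k))"
    using homogeneous_mult[OF homogeneous_const[of "coeff N k"]
        homogeneous_mult[OF homogeneous_power[OF assms(1), of "n - k"] homogeneous_power[OF assms(2), of k]]]
    by simp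
qed

lemma hom_homogenization:
  assumes "unital_hom h" and "h a = 1"
  shows "h (homogenization a b n N) = (\<Sum>k\<le>n. h (const3 (coeff N k)) * h b ^ k)"
proof -
  interpret unital_hom h by (rule assms(1))
  show ?thesis by (simp add: homogenization_def sum mult power assms(2))
qed

lemma evalp_const: "evalp (const3 c) v = c"
  by (simp add: evalp_eq_eval_hom eval_hom_const[OF unital_hom_id])

lemma evalp_var: "evalp (var3 i) v = v $ i"
  by (simp add: evalp_eq_eval_hom eval_hom_single[OF unital_hom_id] prod_single_exponent[unfolded One_nat_def])

lemma evalp_homogenization:
  assumes "degree N \<le> n" and "evalp a v \<noteq> 0"
  shows "evalp (homogenization a b n N) v = evalp a v ^ n * poly N (evalp b v / evalp a v)"
proof -
  interpret unital_hom "\<lambda>p. evalp p v" by (rule evalp_hom)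
  have "poly N t = (\<Sum>k\<le>n. coeff N k * t ^ k)" for t
  proof -
    have "(\<Sum>k\<le>n. coeff N k * t ^ k) = (\<Sum>k\<le>degree N. coeff N k * t ^ k)"
      by (rule sum.mono_neutral_right) (use assms(1) in \<open>auto simp: coeff_eq_0\<close>)
    then show ?thesis by (simp add: poly_altdef)
  qed
  moreover have "evalp a v ^ (n - k) * evalp b v ^ k = evalp a v ^ n * (evalp b v / evalp a v) ^ k" if "k \<le> n" for k
    using assms(2) that by (simp add: power_divide power_diff)
  then have "(\<Sum>k\<le>n. coeff N k * (evalp a v ^ (n - k) * evalp b v ^ k))
      = (\<Sum>k\<le>n. evalp a v ^ n * (coeff N k * (evalp b v / evalp a v) ^ k))"
    by (intro sum.cong) (simp_all add: mult.left_commute)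
  moreover have "evalp (homogenization a b n N) v = (\<Sum>k\<le>n. coeff N k * (evalp a v ^ (n - k) * evalp b v ^ k))"
    by (simp add: homogenization_def sum mult power evalp_const)
  ultimately show ?thesis by (simp add: sum_distrib_left)
qed

lemma power_in_set_power: "a \<in> I \<Longrightarrow> a ^ k \<in> (I ^ k :: 'a::comm_monoid_mult set)"
  by (induction k) (auto intro: set_times_intro)

text \<open>
  The lines of the arrangement are given by one form each.  The frame is chosen such that none of them meets
  \<open>w = 0\<close> at infinity; then \<open>root s\<close> is the coordinate of the intersection point with \<open>s = 0\<close>.
\<close>
locale arrangement = line_frame w x0 x1 p0 p1 p2
  for w x0 x1 p0 p1 p2 :: "'k::field_char_0 ^ 3" +
  fixes S :: "('k ^ 3) set"
  assumes finite_S: "finite S"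
    and distinct_lines: "\<And>s s'. s \<in> S \<Longrightarrow> s' \<in> S \<Longrightarrow> s \<noteq> s' \<Longrightarrow> cross s s' \<noteq> 0"
    and transversal: "\<And>s. s \<in> S \<Longrightarrow> dot s p1 \<noteq> 0"
begin

definition F :: "'k poly3" where
  "F = (\<Prod>s\<in>S. linear_form s)"

definition cofactor :: "'k ^ 3 \<Rightarrow> 'k poly3" where
  "cofactor s = (\<Prod>s'\<in>S - {s}. linear_form s')"

definition grad :: "'k ratf3 ^ 3" where
  "grad = (\<chi> i. Fract (partial_deriv i F) 1)"

definition fract_pairing :: "'k ^ 3 \<Rightarrow> 'k ratf3 ^ 3 \<Rightarrow> 'k ratf3" where
  "fract_pairing s v = (\<Sum>i\<in>UNIV. Fract (const3 (s $ i)) 1 * v $ i)"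

definition root :: "'k ^ 3 \<Rightarrow> 'k" where
  "root s = - dot s p0 / dot s p1"

definition curve :: "nat \<Rightarrow> 'k poly3 \<Rightarrow> bool" where
  "curve d g \<longleftrightarrow> g \<noteq> 0 \<and> homogeneous (d + 1) g \<and> (\<forall>s\<in>S. \<forall>c. evalp g (c *s s) = 0) \<and>
     multiplicity_at_least g dual_pt d"

lemma partial_F: "partial_deriv i F = (\<Sum>s\<in>S. const3 (s $ i) * cofactor s)"
  unfolding F_def cofactor_def by (rule partial_deriv_prod_linear_forms[OF finite_S])

lemma F_eq: "s \<in> S \<Longrightarrow> F = linear_form s * cofactor s"
  unfolding F_def cofactor_def by (rule prod.remove[OF finite_S])

text \<open>
  This is the product rule: \<open>v(f) = \<Sum> v(s) f / s\<close>.
\<close>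
lemma grad_pairing: "(\<Sum>i\<in>UNIV. v $ i * grad $ i) = (\<Sum>s\<in>S. fract_pairing s v * Fract (cofactor s) 1)"
proof -
  interpret unital_hom "\<lambda>a :: 'k poly3. Fract a 1" by (rule unital_hom_Fract)
  have "(\<Sum>i\<in>UNIV. v $ i * grad $ i) =
      (\<Sum>i\<in>UNIV. \<Sum>s\<in>S. Fract (const3 (s $ i)) 1 * v $ i * Fract (cofactor s) 1)"
    unfolding grad_def vec_lambda_beta partial_F sum mult sum_distrib_left
    by (simp only: mult_ac)
  also have "\<dots> = (\<Sum>s\<in>S. fract_pairing s v * Fract (cofactor s) 1)"
    unfolding fract_pairing_def by (subst sum.swap) (simp add: sum_distrib_right)
  finally show ?thesis .
qed

lemma euler: "(\<Sum>i\<in>UNIV. var3 i * partial_deriv i F) = of_nat (card S) * F"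
proof -
  have "(\<Sum>i\<in>UNIV. var3 i * partial_deriv i F) = (\<Sum>i\<in>UNIV. \<Sum>s\<in>S. const3 (s $ i) * var3 i * cofactor s)"
    unfolding partial_F sum_distrib_left by (simp only: mult_ac)
  also have "\<dots> = (\<Sum>s\<in>S. linear_form s * cofactor s)"
    by (subst sum.swap) (simp only: linear_form_eq_sum sum_distrib_right)
  also have "\<dots> = (\<Sum>s\<in>S. F)" using F_eq by (intro sum.cong) auto
  finally show ?thesis by simp
qed

lemma nonzero_S: "s \<in> S \<Longrightarrow> s \<noteq> 0"
  using transversal[of s] by (auto simp: dot_def)

lemma R_linear_form_S: "s \<in> S \<Longrightarrow> R (linear_form s) = smult (dot s p1) [:- root s, 1:]"
  using transversal by (simp add: line_poly_linear_form root_def)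

lemma R_F_nonzero: "R F \<noteq> 0"
  using transversal finite_S
  by (auto simp: F_def unital_hom.prod[OF unital_hom_line_poly] line_poly_linear_form)

lemma stalk_grad:
  "v \<in> ker_stalk n grad P \<Longrightarrow> (\<Sum>s\<in>S. fract_pairing s v * Fract (cofactor s) 1) = 0"
  by (simp add: ker_stalk_def grad_pairing)

lemma fract_pairing_loc:
  assumes "P \<in> Proj" and "\<And>i. v $ i \<in> loc n P"
  shows "fract_pairing s v \<in> loc n P"
  unfolding fract_pairing_def
proof (rule loc_sum[OF assms(1)])
  fix i
  show "Fract (const3 (s $ i)) 1 * v $ i \<in> loc n P"
    using loc_mult[OF assms(1) loc_poly[OF assms(1) homogeneous_const] assms(2)] by simp
qed

lemma fract_map_fract_pairing:
  assumes "\<And>i. v $ i \<in> regular (line_poly q0 q1)"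
  shows "fract_pairing s v \<in> regular (line_poly q0 q1)"
    and "fract_map (line_poly q0 q1) (fract_pairing s v) = (\<Sum>i\<in>UNIV. Fract [:s $ i:] 1 * fract_map (line_poly q0 q1) (v $ i))"
proof -
  note hom = unital_hom_line_poly[of q0 q1]
  have reg: "Fract (const3 (s $ i)) 1 * v $ i \<in> regular (line_poly q0 q1)" for i
    by (rule regular_mult(1)[OF hom regular_poly[OF hom] assms])
  show "fract_pairing s v \<in> regular (line_poly q0 q1)"
    unfolding fract_pairing_def by (rule regular_sum(1)[OF hom reg])
  show "fract_map (line_poly q0 q1) (fract_pairing s v) = (\<Sum>i\<in>UNIV. Fract [:s $ i:] 1 * fract_map (line_poly q0 q1) (v $ i))"
    unfolding fract_pairing_def
    by (simp add: regular_sum(2)[OF hom reg] regular_mult(2)[OF hom regular_poly[OF hom] assms]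
        fract_map_poly[OF hom] line_poly_const)
qed

text \<open>
  By the product rule \<open>s\<close> divides \<open>v(s) f / s\<close> for a lift \<open>v\<close>, and it should divide \<open>v(s)\<close>.  Instead of
  factoring polynomials, restrict to a line inside the plane \<open>s = 0\<close> through the point in question: all terms
  but one vanish there, and \<open>f / s\<close> does not.  So \<open>v(s)\<close> vanishes along this second line, in particular at
  the common point of the two lines.
\<close>
lemma twisted_vanishes_at_root:
  assumes u: "u \<in> twisted d 0 grad" and N: "\<And>i. u $ i = Fract (N i) 1" and s: "s \<in> S"
  shows "(\<Sum>i\<in>UNIV. s $ i * poly (N i) (root s)) = 0"
proof -
  let ?P = "line_prime p0 p1 [:- root s, 1:]"
  define q0 where "q0 = p0 + root s *s p1"
  have P: "?P \<in> chart x0" by (rule line_prime_in_chart[OF prime_elem_linear])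
  then have on: "on_line ?P" by (simp add: chart_def)
  obtain v where v: "v \<in> ker_stalk 0 grad ?P" "res v = u"
    using P u by (auto simp: twisted_def line_sections_def)
  have vloc: "v $ i \<in> loc 0 ?P" for i using v(1) by (simp add: ker_stalk_def)
  have eval: "b \<in> ?P \<longleftrightarrow> evalp b q0 = 0" if "homogeneous k b" for k b
    by (simp only: homogeneous_in_line_prime_iff[OF that] poly_eq_0_iff_dvd[symmetric] poly_line_poly q0_def)
  have q0: "dot s q0 = 0"
    using transversal[OF s] by (simp add: q0_def dot_add dot_diff dot_scale root_def)
  \<comment> \<open>a second line through the point, inside the plane of \<open>s\<close> and in no other plane\<close>
  obtain c where c: "\<And>s'. s' \<in> S - {s} \<Longrightarrow> dot s' (cross s c) \<noteq> 0"
    using ex_cross_avoiding[of "S - {s}" s] finite_S distinct_lines s by auto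
  define q1 where "q1 = cross s c"
  let ?R' = "line_poly q0 q1"
  note hom' = unital_hom_line_poly[of q0 q1]
  have q1: "dot s q1 = 0" by (simp add: q1_def dot_cross_self)
  have R': "?R' b \<noteq> 0" if "homogeneous k b" "b \<notin> ?P" for k b
  proof
    assume "?R' b = 0"
    then have "evalp b q0 = 0" using poly_line_poly[of q0 q1 b 0] by simp
    then show False using eval that by blast
  qed
  have reg: "g \<in> regular ?R'" if "g \<in> loc k ?P" for g k
    using that by (auto elim!: locE intro!: regular_Fract[OF hom'] dest: R')
  have cof: "?R' (cofactor s') = 0" if "s' \<in> S" "s' \<noteq> s" for s'
  proof -
    have "?R' (linear_form s) = 0" using q0 q1 by (simp add: line_poly_linear_form)
    then show ?thesis
      using that s finite_S unfolding cofactor_def unital_hom.prod[OF hom'] by (auto intro!: bexI[of _ s])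
  qed
  have cof_s: "?R' (cofactor s) \<noteq> 0"
    using c finite_S unfolding cofactor_def unital_hom.prod[OF hom']
    by (auto simp: line_poly_linear_form q1_def)
  have "0 = fract_map ?R' (\<Sum>s'\<in>S. fract_pairing s' v * Fract (cofactor s') 1)"
    using stalk_grad[OF v(1)] by (simp add: fract_map_zero[OF hom'])
  also have "\<dots> = (\<Sum>s'\<in>S. fract_map ?R' (fract_pairing s' v * Fract (cofactor s') 1))"
    by (rule regular_sum(2)[OF hom']) (intro regular_mult(1)[OF hom'] fract_map_fract_pairing(1) reg[OF vloc] regular_poly[OF hom'])
  also have "\<dots> = (\<Sum>s'\<in>S. fract_map ?R' (fract_pairing s' v) * Fract (?R' (cofactor s')) 1)"
    by (simp only: regular_mult(2)[OF hom' fract_map_fract_pairing(1)[OF reg[OF vloc]] regular_poly[OF hom']]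
        fract_map_poly[OF hom'])
  also have "\<dots> = (\<Sum>s'\<in>S. if s' = s then fract_map ?R' (fract_pairing s v) * Fract (?R' (cofactor s)) 1 else 0)"
    by (rule sum.cong) (auto simp: cof fract_collapse)
  also have "\<dots> = fract_map ?R' (fract_pairing s v) * Fract (?R' (cofactor s)) 1"
    using finite_S s by simp
  finally have "fract_map ?R' (fract_pairing s v) * Fract (?R' (cofactor s)) 1 = 0" by (rule sym)
  moreover have "Fract (?R' (cofactor s)) 1 \<noteq> 0"
    using cof_s by (simp add: Zero_fract_def eq_fract)
  ultimately have app0: "fract_map ?R' (fract_pairing s v) = 0" by simp
  obtain A B i j where AB: "homogeneous i A" "homogeneous j B" "B \<notin> ?P" "fract_pairing s v = Fract A B"
    using fract_pairing_loc[OF on_lineD(1)[OF on] vloc, of s] by (rule locE)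
  have "?R' A = 0"
    using app0 AB(4) fract_map_Fract[OF hom' R'[OF AB(2,3)]] R'[OF AB(2,3)] by (simp add: Zero_fract_def eq_fract)
  then have A0: "poly (R A) (root s) = 0"
    using poly_line_poly[of q0 q1 A 0] by (simp add: poly_line_poly q0_def)
  have B0: "poly (R B) (root s) \<noteq> 0"
    using AB(3) eval[OF AB(2)] by (simp add: poly_line_poly q0_def)
  have "Fract (R A) (R B) = fract_map R (fract_pairing s v)"
    using AB(4) fract_map_Fract[OF unital_hom_line_poly R_nonzero[OF on AB(2,3)]] by simp
  also have "\<dots> = (\<Sum>i\<in>UNIV. Fract [:s $ i:] 1 * Fract (N i) 1)"
    by (subst fract_map_fract_pairing(2)[OF loc_regular[OF on vloc]]) (simp only: res_nth[symmetric] v(2) N)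
  also have "\<dots> = Fract (\<Sum>i\<in>UNIV. [:s $ i:] * N i) 1"
    by (simp only: unital_hom.sum[OF unital_hom_Fract] unital_hom.mult[OF unital_hom_Fract])
  finally have "R A = (\<Sum>i\<in>UNIV. [:s $ i:] * N i) * R B"
    using R_nonzero[OF on AB(2,3)] by (simp add: eq_fract)
  then have "poly (R A) (root s) = (\<Sum>i\<in>UNIV. s $ i * poly (N i) (root s)) * poly (R B) (root s)"
    by (simp add: poly_sum)
  then show ?thesis using A0 B0 by simp
qed

lemma twisted_tangent:
  assumes u: "u \<in> twisted d n grad" and N: "\<And>i. u $ i = Fract (N i) 1"
  shows "(\<Sum>i\<in>UNIV. N i * R (partial_deriv i F)) = 0"
proof -
  note hom = unital_hom_line_poly[of p0 p1]
  have on: "on_line generic_point" by (rule generic_point_on_line)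
  have "generic_point \<in> chart x0" by (rule open_partD(2)[OF open_part_x0])
  then obtain v where v: "v \<in> ker_stalk n grad generic_point" "res v = u"
    using u by (auto simp: twisted_def line_sections_def)
  have "0 = fract_map R (\<Sum>i\<in>UNIV. v $ i * Fract (partial_deriv i F) 1)"
    using v(1) by (simp add: ker_stalk_def grad_def fract_map_zero[OF hom])
  also have "\<dots> = (\<Sum>i\<in>UNIV. fract_map R (v $ i * Fract (partial_deriv i F) 1))"
    by (rule regular_sum(2)[OF hom]) (intro regular_mult(1)[OF hom] stalk_regular[OF on v(1)] regular_poly[OF hom])
  also have "\<dots> = (\<Sum>i\<in>UNIV. Fract (N i) 1 * Fract (R (partial_deriv i F)) 1)"
    by (simp only: regular_mult(2)[OF hom stalk_regular[OF on v(1)] regular_poly[OF hom]]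
        fract_map_poly[OF hom] res_nth[symmetric] v(2) N)
  also have "\<dots> = Fract (\<Sum>i\<in>UNIV. N i * R (partial_deriv i F)) 1"
    by (simp only: unital_hom.sum[OF unital_hom_Fract] unital_hom.mult[OF unital_hom_Fract])
  finally show ?thesis by (simp add: Zero_fract_def eq_fract)
qed

lemma linear_form_in_point_ideal: "dot w q = 0 \<Longrightarrow> linear_form q \<in> point_ideal dual_pt"
  by (auto simp: point_ideal_def evalp_linear_form dot_scale dot_commute[of q w])

text \<open>
  The curve is \<open>v \<mapsto> \<langle>v, N\<rangle>\<close> with \<open>N\<close> evaluated at the point of the line cut out by \<open>v\<close>, which has
  homogeneous coordinates \<open>\<langle>v, p1\<rangle>\<close> and \<open>- \<langle>v, p0\<rangle>\<close>.  Both are linear forms vanishing at \<open>w\<close>, whence the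
  multiplicity.  If the curve is zero, then \<open>N\<close> is a multiple of the Euler field on the line; by the tangency
  condition and Euler's formula \<open>\<Sum> x\<^sub>i \<partial>\<^sub>i f = m f\<close> the multiple is zero.
\<close>

lemma curve_from_polynomials:
  assumes deg: "\<And>i. degree (N i) \<le> d"
    and vanish: "\<And>s. s \<in> S \<Longrightarrow> (\<Sum>i\<in>UNIV. s $ i * poly (N i) (root s)) = 0"
    and tangent: "(\<Sum>i\<in>UNIV. N i * R (partial_deriv i F)) = 0"
    and nonzero: "N i0 \<noteq> 0" and S: "S \<noteq> {}"
  shows "\<exists>g. curve d g"
proof -
  let ?a = "linear_form p1" and ?b = "linear_form (- p0)"
  define g where "g = (\<Sum>i\<in>UNIV. var3 i * homogenization ?a ?b d (N i))"
  have hom: "homogeneous (d + 1) g"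
    unfolding g_def
    using homogeneous_mult[OF homogeneous_var homogeneous_homogenization[OF homogeneous_linear_form homogeneous_linear_form]]
    by (intro homogeneous_sum) simp
  have eval: "evalp g v = dot v p1 ^ d * (\<Sum>i\<in>UNIV. v $ i * poly (N i) (- dot v p0 / dot v p1))"
    if "dot v p1 \<noteq> 0" for v
  proof -
    have b: "evalp ?b v = - dot v p0"
      by (simp add: evalp_linear_form dot_minus dot_commute[of v p0])
    have a: "evalp ?a v = dot v p1" by (simp add: evalp_linear_form dot_commute[of v])
    have "evalp g v = (\<Sum>i\<in>UNIV. v $ i * evalp (homogenization ?a ?b d (N i)) v)"
      unfolding g_def
      by (simp add: unital_hom.sum[OF evalp_hom] unital_hom.mult[OF evalp_hom] evalp_var[unfolded One_nat_def])
    also have "\<dots> = (\<Sum>i\<in>UNIV. v $ i * (dot v p1 ^ d * poly (N i) (- dot v p0 / dot v p1)))"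
      using evalp_homogenization[OF deg, of ?a v] that by (simp add: a b)
    finally show ?thesis by (simp add: sum_distrib_left mult_ac)
  qed
  have van: "evalp g (c *s s) = 0" if "s \<in> S" for s c
    using eval[OF transversal[OF that]] vanish[OF that] evalp_scale[OF hom, of c s]
    by (simp add: root_def)
  have "g \<noteq> 0"
  proof
    assume "g = 0"
    then have evalp_g: "evalp g v = 0" for v by (simp add: unital_hom.zero[OF evalp_hom])
    define M where "M x = (\<Sum>i\<in>UNIV. [:x $ i:] * N i)" for x :: "'k ^ 3"
    have "poly (M x1) t - t * poly (M x0) t + c * poly (M w) t = 0" for t c
    proof -
      let ?v = "x1 - t *s x0 + c *s w"
      have "dot ?v p1 = 1" "dot ?v p0 = - t" by (simp_all add: dot_add dot_diff dot_scale)
      then have "(\<Sum>i\<in>UNIV. ?v $ i * poly (N i) t) = 0"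
        using eval[of ?v] evalp_g[of ?v] by simp
      moreover have "(\<Sum>i\<in>UNIV. ?v $ i * poly (N i) t) = poly (M x1) t - t * poly (M x0) t + c * poly (M w) t"
        by (simp add: M_def poly_sum sum_distrib_left algebra_simps sum.distrib sum_subtractf)
      ultimately show ?thesis by simp
    qed
    note rel = this
    have "poly (M w) t = 0" for t using rel[of t 0] rel[of t 1] by simp
    then have Mw: "M w = 0" by (rule poly_eq_0_if_vanishing)
    have "poly (M x1 - [:0, 1:] * M x0) t = 0" for t using rel[of t 0] by simp
    then have "M x1 - [:0, 1:] * M x0 = 0" by (rule poly_eq_0_if_vanishing)
    then have M1: "M x1 = [:0, 1:] * M x0" by simp
    have N: "N j = M x0 * [:p0 $ j, p1 $ j:]" for j
    proof -
      have d: "x0 $ i * p0 $ j + x1 $ i * p1 $ j + w $ i * p2 $ j = (if i = j then 1 else 0)" for i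
        using bases by (simp add: dual_bases_def)
      have "[:p0 $ j:] * M x0 + [:p1 $ j:] * M x1 + [:p2 $ j:] * M w
          = (\<Sum>i\<in>UNIV. [:x0 $ i * p0 $ j + x1 $ i * p1 $ j + w $ i * p2 $ j:] * N i)"
        unfolding M_def sum_distrib_left sum.distrib[symmetric]
        by (rule sum.cong) (simp_all add: algebra_simps smult_add_left)
      also have "\<dots> = (\<Sum>i\<in>UNIV. if i = j then N i else 0)"
        unfolding d by (rule sum.cong) auto
      also have "\<dots> = N j" by simp
      finally show ?thesis unfolding Mw M1 by (simp add: algebra_simps smult_add_left)
    qed
    have Rvar: "R (var3 i) = [:p0 $ i, p1 $ i:]" for i
      unfolding line_poly_def
      by (simp add: eval_hom_single[OF unital_hom_const_poly] prod_single_exponent[unfolded One_nat_def])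
    have "0 = M x0 * R (\<Sum>i\<in>UNIV. var3 i * partial_deriv i F)"
      using tangent unfolding N
      by (simp only: unital_hom.sum[OF unital_hom_line_poly] unital_hom.mult[OF unital_hom_line_poly]
          Rvar sum_distrib_left mult.assoc)
    also have "\<dots> = M x0 * (of_nat (card S) * R F)"
      unfolding euler by (simp only: unital_hom.mult[OF unital_hom_line_poly] unital_hom.of_nat[OF unital_hom_line_poly])
    finally have "M x0 = 0"
      using R_F_nonzero S finite_S by simp
    then show False using N[of i0] nonzero by simp
  qed
  moreover have "multiplicity_at_least g dual_pt d"
  proof -
    have ab: "?a \<in> point_ideal dual_pt" "?b \<in> point_ideal dual_pt"
      by (rule linear_form_in_point_ideal; simp add: dot_minus)+
    have "var3 i * homogenization ?a ?b d (N i) \<in> module.span (*) (point_ideal dual_pt ^ d)" for i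
      unfolding homogenization_def sum_distrib_left
    proof (rule module.span_sum[OF module_mult])
      fix k assume k: "k \<in> {..d}"
      have "?a ^ (d - k) * ?b ^ k \<in> point_ideal dual_pt ^ (d - k) * point_ideal dual_pt ^ k"
        by (intro set_times_intro power_in_set_power ab)
      then have "?a ^ (d - k) * ?b ^ k \<in> point_ideal dual_pt ^ d"
        using k by (simp flip: power_add)
      then have "(var3 i * const3 (coeff (N i) k)) * (?a ^ (d - k) * ?b ^ k) \<in> module.span (*) (point_ideal dual_pt ^ d)"
        by (intro module.span_scale[OF module_mult] module.span_base[OF module_mult])
      then show "var3 i * (const3 (coeff (N i) k) * (?a ^ (d - k) * ?b ^ k)) \<in> module.span (*) (point_ideal dual_pt ^ d)"
        by (simp only: mult.assoc)
    qed
    then have "g \<in> module.span (*) (point_ideal dual_pt ^ d)"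
      unfolding g_def by (intro module.span_sum[OF module_mult])
    moreover have "1 \<notin> point_ideal dual_pt"
      by (simp add: point_ideal_def unital_hom.one[OF evalp_hom])
    ultimately show ?thesis
      unfolding multiplicity_at_least_def by (metis mult_1)
  qed
  ultimately show ?thesis using hom van unfolding curve_def by blast
qed

lemma twisted_imp_curve:
  assumes u: "u \<in> twisted d 0 grad" "u \<noteq> 0" and S: "S \<noteq> {}"
  shows "0 \<le> d \<and> (\<exists>g. curve (nat d) g)"
proof -
  have "\<forall>i. \<exists>N. u $ i = Fract N 1 \<and> (N = 0 \<or> int (degree N) \<le> d)"
    using twisted_polynomial[OF u(1)] by simp
  then obtain N where N: "\<And>i. u $ i = Fract (N i) 1" "\<And>i. N i = 0 \<or> int (degree (N i)) \<le> d"
    by metis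
  obtain i0 where "u $ i0 \<noteq> 0" using u(2) by (auto simp: vec_eq_iff)
  then have i0: "N i0 \<noteq> 0" using N(1)[of i0] by (auto simp: Zero_fract_def)
  then have d: "0 \<le> d" using N(2)[of i0] by linarith
  have "degree (N i) \<le> nat d" for i using N(2)[of i] d by auto
  from curve_from_polynomials[OF this twisted_vanishes_at_root[OF u(1) N(1)]
      twisted_tangent[OF u(1) N(1)] i0 S] d
  show ?thesis by blast
qed

end

section \<open>Polynomials from a curve\<close>

lemma dvd_set_power:
  fixes h :: "'a::comm_ring_1 \<Rightarrow> 'b::comm_ring_1"
  assumes "unital_hom h" and "\<And>f. f \<in> I \<Longrightarrow> x dvd h f" and "f \<in> I ^ d"
  shows "x ^ d dvd h f"
  using assms(3)
proof (induction d arbitrary: f)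
  case (Suc d)
  then obtain a b where "f = a * b" "a \<in> I" "b \<in> I ^ d" by (auto elim: set_times_elim)
  then show ?case using Suc.IH[of b] assms(2)[of a] by (simp add: unital_hom.mult[OF assms(1)] mult_dvd_mono)
qed simp

lemma dvd_span_set_power:
  fixes h :: "'a::comm_ring_1 \<Rightarrow> 'b::comm_ring_1"
  assumes "unital_hom h" and "\<And>f. f \<in> I \<Longrightarrow> x dvd h f" and "f \<in> module.span (*) (I ^ d)"
  shows "x ^ d dvd h f"
proof -
  have "module.span (*) (I ^ d) \<subseteq> {f. x ^ d dvd h f}"
  proof (rule module.span_minimal[OF module_mult])
    show "I ^ d \<subseteq> {f. x ^ d dvd h f}" using dvd_set_power[OF assms(1,2)] by blast
    show "module.subspace (*) {f. x ^ d dvd h f}"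
      by (simp add: module.subspace_def[OF module_mult] unital_hom.zero[OF assms(1)]
          unital_hom.add[OF assms(1)] unital_hom.mult[OF assms(1)])
  qed
  then show ?thesis using assms(3) by blast
qed

lemma ex_nonroot:
  fixes q :: "'k::field_char_0 poly"
  assumes "q \<noteq> 0"
  shows "\<exists>c. c \<noteq> 0 \<and> poly q c \<noteq> 0"
proof -
  have "finite (insert 0 {t. poly q t = 0})" using poly_roots_finite[OF assms] by simp
  then obtain c where "c \<notin> insert 0 {t. poly q t = 0}"
    using infinite_field ex_new_if_finite by blast
  then show ?thesis by auto
qed

context line_frame
begin

text \<open>
  Along a line through \<open>w\<close>, with \<open>w\<close> as origin, the form \<open>g\<close> of degree \<open>d + 1\<close> is divisible by the \<open>d\<close>-th
  power of the parameter.  Only a linear factor remains, and reversing the parametrisation yields the claim.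
  The factor \<open>h\<close> in the definition of multiplicity does not vanish at a suitable multiple of \<open>w\<close>, so it is coprime to the parameter.
\<close>
lemma multiplicity_imp_linear:
  assumes hom: "homogeneous (d + 1) g" and mult: "multiplicity_at_least g dual_pt d"
  shows "\<exists>c0 c1. \<forall>t. evalp g (v + t *s w) = c0 + t * c1"
proof -
  obtain h where h: "h \<notin> point_ideal dual_pt" "h * g \<in> module.span (*) (point_ideal dual_pt ^ d)"
    using mult by (auto simp: multiplicity_at_least_def)
  obtain c' where "evalp h (c' *s w) \<noteq> 0" using h(1) by (auto simp: point_ideal_def)
  then have "line_poly 0 w h \<noteq> 0" using poly_line_poly[of 0 w h c'] by auto
  then obtain c where c: "c \<noteq> 0" "evalp h (c *s w) \<noteq> 0"
    using ex_nonroot[of "line_poly 0 w h"] by (auto simp: poly_line_poly)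
  let ?Q = "line_poly (c *s w) v"
  have "[:- 0, 1:] dvd ?Q f" if "f \<in> point_ideal dual_pt" for f
    using that unfolding poly_eq_0_iff_dvd[symmetric] poly_line_poly by (simp add: point_ideal_def)
  then have "[:- 0, 1:] ^ d dvd ?Q (h * g)"
    by (rule dvd_span_set_power[OF unital_hom_line_poly _ h(2)])
  then have "[:- 0, 1:] ^ d dvd ?Q h * ?Q g"
    by (simp add: unital_hom.mult[OF unital_hom_line_poly])
  moreover have Qh: "poly (?Q h) 0 \<noteq> 0" using c(2) by (simp add: poly_line_poly)
  then have "order 0 (?Q h) = 0" "?Q h \<noteq> 0" using order_root by auto
  ultimately have "[:- 0, 1:] ^ d dvd ?Q g"
    unfolding order_divides by (cases "?Q g = 0") (auto simp: order_mult)
  then obtain K where K: "?Q g = [:0, 1:] ^ d * K" by (auto elim: dvdE)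
  have "degree K \<le> 1"
  proof (cases "K = 0")
    case False
    then have "degree (?Q g) = d + degree K"
      unfolding K by (simp add: degree_mult_eq degree_power_eq)
    then show ?thesis using degree_line_poly[OF hom, of "c *s w" v] by simp
  qed simp
  then obtain k0 k1 where k: "K = [:k0, k1:]"
    by (metis degree_pCons_eq_if le_zero_eq not_less_eq_eq pCons_cases One_nat_def degree_eq_zeroE pCons_0_0)
  have ev: "evalp g (c *s w + t *s v) = t ^ d * (k0 + k1 * t)" for t
    using arg_cong[OF K, of "\<lambda>q. poly q t"] by (simp add: poly_line_poly k algebra_simps)
  have nz: "evalp g (v + t *s w) = k1 + t * (k0 / c)" if "t \<noteq> 0" for t
  proof -
    have "v + t *s w = (t / c) *s (c *s w + (c / t) *s v)"
      using c(1) that by (simp add: vec_eq_iff field_simps)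
    then have "evalp g (v + t *s w) = (t / c) ^ (d + 1) * ((c / t) ^ d * (k0 + k1 * (c / t)))"
      by (simp only: evalp_scale[OF hom] ev)
    also have "\<dots> = (t / c) * (((t / c) * (c / t)) ^ d * (k0 + k1 * (c / t)))"
      by (simp only: power_add power_one_right power_mult_distrib mult_ac)
    also have "(t / c) * (c / t) = 1" using c(1) that by simp
    also have "(t / c) * (1 ^ d * (k0 + k1 * (c / t))) = k1 + t * (k0 / c)"
      using c(1) that by (simp add: field_simps)
    finally show ?thesis .
  qed
  have "line_poly v w g - [:k1, k0 / c:] = 0"
  proof (rule ccontr)
    assume "line_poly v w g - [:k1, k0 / c:] \<noteq> 0"
    from ex_nonroot[OF this] show False using nz by (auto simp: poly_line_poly)
  qed
  then have "evalp g (v + t *s w) = k1 + t * (k0 / c)" for t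
    using poly_line_poly[of v w g t] by simp
  then show ?thesis by blast
qed

end

context arrangement
begin

definition pairing :: "'k ^ 3 \<Rightarrow> (3 \<Rightarrow> 'k poly) \<Rightarrow> 'k poly" where
  "pairing x N = (\<Sum>i\<in>UNIV. [:x $ i:] * N i)"

text \<open>
  A section of the \<open>d\<close>-th twist in coordinates: the vector \<open>N\<close>, together with the quotients \<open>K s\<close> of
  \<open>N(s)\<close> by \<open>s\<close>.  The sum of these quotients is the logarithmic derivative \<open>N(f) / f\<close>.
\<close>
definition tangent_data :: "nat \<Rightarrow> (3 \<Rightarrow> 'k poly) \<Rightarrow> ('k ^ 3 \<Rightarrow> 'k poly) \<Rightarrow> bool" where
  "tangent_data d N K \<longleftrightarrow> (\<forall>i. degree (N i) \<le> d) \<and>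
     (\<forall>s\<in>S. pairing s N = R (linear_form s) * K s \<and> (K s = 0 \<or> degree (K s) < d)) \<and>
     (\<Sum>s\<in>S. K s) = 0"

text \<open>
  A curve of multiplicity \<open>d\<close> has the shape \<open>A(\<tau>) + c B(\<tau>)\<close> on the vectors \<open>x1 - \<tau> x0 + c w\<close>.  This prescribes
  the pairings of \<open>N\<close> with \<open>w\<close> and with \<open>x1 - \<tau> x0\<close>; the freedom left is a multiple of the Euler field,
  which is used twice: to reduce the degree, and to normalise the sum of the quotients.
\<close>
lemma curve_imp_tangent_data:
  assumes g: "curve d g"
  shows "\<exists>N K. tangent_data d N K \<and> (\<exists>i. N i \<noteq> 0)"
proof -
  have hom: "homogeneous (d + 1) g" and van: "\<And>s c. s \<in> S \<Longrightarrow> evalp g (c *s s) = 0"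
    and mult: "multiplicity_at_least g dual_pt d" and nz: "g \<noteq> 0"
    using g by (auto simp: curve_def)
  define A where "A = line_poly x1 (- x0) g"
  define B where "B = line_poly (x1 + w) (- x0) g - A"
  have lin: "evalp g (x1 - t *s x0 + c *s w) = poly A t + c * poly B t" for t c
  proof -
    obtain c0 c1 where c01: "\<And>c. evalp g ((x1 - t *s x0) + c *s w) = c0 + c * c1"
      using multiplicity_imp_linear[OF hom mult] by blast
    have "x1 + t *s - x0 = x1 - t *s x0 + 0 *s w" "x1 + w + t *s - x0 = x1 - t *s x0 + 1 *s w"
      by (simp_all add: vec_eq_iff)
    then have "poly A t = c0" "poly B t = c1"
      unfolding A_def B_def by (simp_all only: poly_diff poly_line_poly c01) simp_all
    then show ?thesis using c01 by simp
  qed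
  have degA: "degree A \<le> d + 1" unfolding A_def by (rule degree_line_poly[OF hom])
  have degB: "degree B \<le> d"
  proof (rule degree_le, intro allI impI)
    fix k assume "d < k"
    then consider "k = d + 1" | "d + 1 < k" by linarith
    then show "coeff B k = 0"
    proof cases
      case 1
      then show ?thesis using coeff_line_poly[OF hom] by (simp add: A_def B_def)
    next
      case 2
      then show ?thesis
        using degree_line_poly[OF hom, of "x1 + w" "- x0"] degA by (simp add: B_def coeff_eq_0)
    qed
  qed
  \<comment> \<open>\<open>M0\<close> is chosen such that the leading term of \<open>A\<close>, whose degree may be \<open>d + 1\<close>, cancels in \<open>M1\<close>\<close>
  define M0 where "M0 = - monom (coeff A (d + 1)) d"
  define M1 where "M1 = A + [:0, 1:] * M0"
  have degM0: "degree M0 \<le> d" by (simp add: M0_def degree_monom_le)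
  have degM1: "degree M1 \<le> d"
  proof (rule degree_le, intro allI impI)
    fix k assume "d < k"
    then obtain k' where k': "k = Suc k'" "d \<le> k'" by (cases k) auto
    have "coeff A k = 0" if "k' \<noteq> d"
      using degA that k' by (intro coeff_eq_0) auto
    then show "coeff M1 k = 0"
      using k' by (cases "k' = d") (auto simp: M1_def M0_def coeff_pCons)
  qed
  define N where "N i = [:p0 $ i:] * M0 + [:p1 $ i:] * M1 + [:p2 $ i:] * B" for i
  have degN: "degree (N i) \<le> d" for i
    unfolding N_def using degM0 degM1 degB
    by (intro degree_add_le) (auto intro: order_trans[OF degree_smult_le])
  have pairN: "pairing x N = [:dot x p0:] * M0 + [:dot x p1:] * M1 + [:dot x p2:] * B" for x
    by (simp add: pairing_def N_def dot_def sum_3 algebra_simps smult_add_left)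
  have rootN: "poly (pairing s N) (root s) = 0" if s: "s \<in> S" for s
  proof -
    let ?r = "root s" and ?c = "dot s p2 / dot s p1"
    have nz: "dot s p1 \<noteq> 0" by (rule transversal[OF s])
    have p0: "dot s p0 = - ?r * dot s p1" using nz by (simp add: root_def)
    have "s = dot s p0 *s x0 + dot s p1 *s x1 + dot s p2 *s w" by (rule dual_bases_expand[OF bases])
    then have "(1 / dot s p1) *s s = (1 / dot s p1) *s (dot s p0 *s x0 + dot s p1 *s x1 + dot s p2 *s w)"
      by (rule arg_cong)
    also have "\<dots> = x1 - ?r *s x0 + ?c *s w"
      using nz unfolding p0 by (simp add: vec_eq_iff field_simps)
    finally have "poly A ?r + ?c * poly B ?r = 0"
      using van[OF s, of "1 / dot s p1"] lin[of ?r ?c] by simp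
    then have "dot s p1 * poly A ?r + dot s p2 * poly B ?r = 0" using nz by (simp add: field_simps)
    then show ?thesis unfolding pairN p0 by (simp add: M1_def algebra_simps)
  qed
  have "\<exists>K. pairing s N = R (linear_form s) * K \<and> (K = 0 \<or> degree K < d)" if s: "s \<in> S" for s
  proof -
    have nz: "dot s p1 \<noteq> 0" by (rule transversal[OF s])
    obtain K where K: "pairing s N = [:- root s, 1:] * K"
      using rootN[OF s] by (auto simp: poly_eq_0_iff_dvd elim: dvdE)
    have "degree (pairing s N) \<le> d"
      unfolding pairing_def using degN
      by (intro degree_sum_le) (auto intro: order_trans[OF degree_smult_le])
    then have "K = 0 \<or> degree K < d"
      unfolding K by (cases "K = 0") (simp_all add: degree_mult_eq del: mult_pCons_left)
    moreover have "pairing s N = R (linear_form s) * smult (inverse (dot s p1)) K"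
      unfolding R_linear_form_S[OF s] K mult_smult_left mult_smult_right smult_smult
      by (simp only: left_inverse[OF nz] right_inverse[OF nz] smult_1_left)
    ultimately show ?thesis by (intro exI[of _ "smult (inverse (dot s p1)) K"]) auto
  qed
  then obtain K where K: "\<And>s. s \<in> S \<Longrightarrow> pairing s N = R (linear_form s) * K s"
    "\<And>s. s \<in> S \<Longrightarrow> K s = 0 \<or> degree (K s) < d" by metis
  \<comment> \<open>subtract the multiple of the Euler field that makes the quotients \<open>K s\<close> sum to zero\<close>
  \<comment> \<open>for an empty arrangement the division by zero gives \<open>e = 0\<close>, as it should be\<close>
  define e where "e = smult (1 / of_nat (card S)) (\<Sum>s\<in>S. K s)"
  have dege: "e = 0 \<or> degree e < d"
  proof (cases "d = 0")
    case True
    then show ?thesis using K(2) by (simp add: e_def)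
  next
    case False
    have "degree (\<Sum>s\<in>S. K s) \<le> d - 1"
      by (rule degree_sum_le) (use K(2) finite_S False in force)+
    then show ?thesis using False degree_smult_le[of "1 / of_nat (card S)" "\<Sum>s\<in>S. K s"]
      unfolding e_def by linarith
  qed
  define N' where "N' i = N i - e * [:p0 $ i, p1 $ i:]" for i
  have pairN': "pairing x N' = pairing x N - e * [:dot x p0, dot x p1:]" for x
    by (simp add: pairing_def N'_def sum_3 dot_def algebra_simps smult_add_left smult_add_right)
  have "tangent_data d N' (\<lambda>s. K s - e)"
    unfolding tangent_data_def
  proof (intro conjI allI ballI)
    fix i
    have "degree (e * [:p0 $ i, p1 $ i:]) \<le> d"
    proof (cases "e = 0")
      case False
      have "degree (e * [:p0 $ i, p1 $ i:]) \<le> degree e + degree [:p0 $ i, p1 $ i:]"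
        by (rule degree_mult_le)
      also have "\<dots> \<le> d" using dege False by (auto simp: less_eq_Suc_le)
      finally show ?thesis .
    qed simp
    then show "degree (N' i) \<le> d" unfolding N'_def by (rule degree_diff_le[OF degN])
  next
    fix s assume s: "s \<in> S"
    show "pairing s N' = R (linear_form s) * (K s - e)"
      unfolding pairN' K(1)[OF s] line_poly_linear_form by (metis right_diff_distrib mult.commute)
    have "degree (K s - e) < d" if "0 < d"
      using K(2)[OF s] dege that by (intro degree_diff_less) auto
    then show "K s - e = 0 \<or> degree (K s - e) < d" using K(2)[OF s] dege by fastforce
  next
    show "(\<Sum>s\<in>S. K s - e) = 0"
    proof (cases "S = {}")
      case False
      then have "of_nat (card S) * e = (\<Sum>s\<in>S. K s)"
        using finite_S by (simp add: e_def of_nat_poly)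
      then show ?thesis by (simp add: sum_subtractf)
    qed simp
  qed
  moreover have "\<exists>i. N' i \<noteq> 0"
  proof (rule ccontr)
    assume "\<not> (\<exists>i. N' i \<noteq> 0)"
    then have "pairing x N' = 0" for x by (simp add: pairing_def)
    then have eq: "pairing x N = e * [:dot x p0, dot x p1:]" for x using pairN'[of x] by simp
    have "M0 = e" using eq[of x0] by (simp add: pairN)
    moreover have "M1 = e * [:0, 1:]" using eq[of x1] by (simp add: pairN del: mult_pCons_right)
    ultimately have "A = 0" by (simp add: M1_def)
    moreover have "B = 0" using eq[of w] by (simp add: pairN)
    ultimately have zero: "evalp g (x1 - t *s x0 + c *s w) = 0" for t c using lin by simp
    have "evalp (g * linear_form p1) v = 0" for v
    proof (cases "dot v p1 = 0")
      case True
      then show ?thesis by (simp add: unital_hom.mult[OF evalp_hom] evalp_linear_form dot_commute[of p1])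
    next
      case False
      let ?u = "x1 - (- dot v p0 / dot v p1) *s x0 + (dot v p2 / dot v p1) *s w"
      have "v = dot v p0 *s x0 + dot v p1 *s x1 + dot v p2 *s w" by (rule dual_bases_expand[OF bases])
      also have "\<dots> = dot v p1 *s ?u" using False by (simp add: vec_eq_iff field_simps)
      finally have "evalp g v = dot v p1 ^ (d + 1) * evalp g ?u" using evalp_scale[OF hom] by metis
      then have "evalp g v = 0" by (simp only: zero mult_zero_right)
      then show ?thesis by (simp add: unital_hom.mult[OF evalp_hom])
    qed
    then have "g * linear_form p1 = 0" by (rule evalp_eq_0_imp_eq_0)
    moreover have "p1 \<noteq> 0" using dots(5) by (auto simp: dot_def)
    ultimately show False using nz linear_form_nonzero[of p1] by simp
  qed
  ultimately show ?thesis by blast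
qed

end

section \<open>Local lifts\<close>

lemma ex_cross_nonzero:
  assumes "(a :: 'k::field ^ 3) \<noteq> 0"
  shows "\<exists>b. cross a b \<noteq> 0"
proof -
  have "cross a (vector [0, 1, 0]) $ 3 = a $ 1" "cross a (vector [0, 0, 1]) $ 1 = a $ 2"
    "cross a (vector [1, 0, 0]) $ 2 = a $ 3"
    by (simp_all add: cross_expand)
  moreover obtain i where "a $ i \<noteq> 0" using assms by (auto simp: vec_eq_iff)
  ultimately show ?thesis using exhaust_3[of i] by (metis zero_index)
qed

lemma Fract_eq_mult: "Fract a b = Fract a 1 * Fract 1 (b :: 'a::idom)"
  by simp

context line_frame
begin

text \<open>
  The lift is the homogenisation, divided by a power of a linear form that is invertible at \<open>P\<close>.
\<close>
lemma ex_lift_polynomial: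
  assumes on: "on_line P" and x: "linear_form x \<notin> P" and M: "M = 0 \<or> int (degree M) \<le> int d + m"
  shows "\<exists>g\<in>loc m P. fract_map R g = Fract M (R (linear_form x) ^ d)"
proof (cases "M = 0")
  case True
  then show ?thesis
    using loc_zero[OF on_lineD(1)[OF on]] fract_map_zero[OF unital_hom_line_poly]
    by (intro bexI[of _ 0]) (auto simp: fract_collapse)
next
  case False
  note hom = unital_hom_line_poly[of p0 p1]
  let ?n = "nat (int d + m)"
  let ?a = "homogenization (linear_form x0) (linear_form x1) ?n M" and ?b = "linear_form x ^ d"
  have n: "int ?n = int d + m" "degree M \<le> ?n" using M False by auto
  have xd: "homogeneous d ?b" using homogeneous_power[OF homogeneous_linear_form, of d x] by simp
  have xP: "?b \<notin> P" by (rule Proj_power[OF on_lineD(1)[OF on] x])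
  have "Fract ?a ?b \<in> loc m P"
    by (rule loc_Fract[OF homogeneous_homogenization[OF homogeneous_linear_form homogeneous_linear_form] xd xP])
      (use n in simp)
  moreover have "R ?a = M"
  proof -
    have "R ?a = (\<Sum>k\<le>?n. [:coeff M k:] * [:0, 1:] ^ k)"
      using hom_homogenization[OF hom R_x0] by (simp add: line_poly_const R_x1)
    also have "\<dots> = (\<Sum>k\<le>?n. monom (coeff M k) k)"
      by (rule sum.cong) (simp_all add: monom_altdef)
    also have "\<dots> = M" by (rule poly_as_sum_of_monoms'[OF n(2)])
    finally show ?thesis .
  qed
  then have "fract_map R (Fract ?a ?b) = Fract M (R (linear_form x) ^ d)"
    using R_nonzero[OF on xd xP] by (simp add: fract_map_Fract[OF hom] unital_hom.power[OF hom])
  ultimately show ?thesis by blast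
qed

end

context arrangement
begin

text \<open>
  In a basis containing the forms \<open>s\<close> of the lines through \<open>P\<close>, the components of \<open>N\<close> are lifted independently,
  those along such an \<open>s\<close> as \<open>s\<close> times a lift of \<open>K s\<close>.  Then \<open>s\<close> divides \<open>t(s)\<close> for every line of the
  arrangement, so \<open>t(f) / f\<close> is regular; subtracting a multiple of the Euler field makes it zero, and does not
  change the restriction to the line, where \<open>t(f) / f\<close> is the sum of the \<open>K s\<close>, which is zero.
\<close>
lemma tangent_data_lifts:
  assumes data: "tangent_data d N K"
    and on: "on_line P" and x: "linear_form x \<notin> P"
    and few: "card {s \<in> S. linear_form s \<in> P} \<le> 2"
  shows "\<exists>t\<in>ker_stalk 0 grad P. res t = (\<chi> i. Fract (N i) (R (linear_form x) ^ d))"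
proof -
  note Proj = on_lineD(1)[OF on] and hom = unital_hom_line_poly[of p0 p1]
  interpret Fr: unital_hom "\<lambda>a :: 'k poly. Fract a 1" by (rule unital_hom_Fract)
  interpret Frk: unital_hom "\<lambda>a :: 'k poly3. Fract a 1" by (rule unital_hom_Fract)
  interpret C: unital_hom "const3 :: 'k \<Rightarrow> 'k poly3" by (rule unital_hom_const3)
  let ?X = "R (linear_form x) ^ d"
  have X: "?X \<noteq> 0" using R_linear_form_nonzero[OF on x] by simp
  have degN: "degree (N i) \<le> d" for i using data by (simp add: tangent_data_def)
  have K: "pairing s N = R (linear_form s) * K s" "K s = 0 \<or> degree (K s) < d" if "s \<in> S" for s
    using data that by (auto simp: tangent_data_def)
  have sumK: "(\<Sum>s\<in>S. K s) = 0" using data by (simp add: tangent_data_def)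
  define T where "T = {s \<in> S. linear_form s \<in> P}"
  \<comment> \<open>at most two lines pass through \<open>P\<close>, and they are part of a basis\<close>
  obtain a b where ab: "T \<subseteq> {a, b}" "cross a b \<noteq> 0"
  proof -
    have "finite T" using finite_S by (simp add: T_def)
    then consider "T = {}" | s where "T = {s}" | s s' where "T = {s, s'}" "s \<noteq> s'"
      using few unfolding T_def[symmetric]
      by (metis One_nat_def Suc_1 card_0_eq card_1_singletonE card_2_iff le_Suc_eq le_zero_eq)
    then show thesis
    proof cases
      case 1
      then show thesis using ex_cross_nonzero[OF w_nonzero] that by blast
    next
      case 2
      then have "s \<in> S" by (auto simp: T_def)
      then show thesis using ex_cross_nonzero[OF nonzero_S] that 2 by blast
    next
      case 3
      then have "s \<in> S" "s' \<in> S" by (auto simp: T_def)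
      then show thesis using distinct_lines that 3 by blast
    qed
  qed
  obtain c where "dual_bases a b c (cross b c) (cross c a) (cross a b)"
    using ex_dual_bases[OF ab(2)] by blast
  then obtain a' b' c' where bas: "dual_bases a b c a' b' c'" by blast
  have "\<exists>g\<in>loc 0 P. fract_map R g = Fract (pairing z N) ?X \<and>
      (z \<in> T \<longrightarrow> (\<exists>q\<in>loc (- 1) P. g = Fract (linear_form z) 1 * q))" for z
  proof (cases "z \<in> T")
    case True
    then have z: "z \<in> S" by (simp add: T_def)
    obtain q where q: "q \<in> loc (- 1) P" "fract_map R q = Fract (K z) ?X"
      using ex_lift_polynomial[OF on x, of "K z" d "- 1"] K(2)[OF z] by auto
    have l: "Fract (linear_form z) 1 \<in> loc 1 P"
      using loc_poly[OF Proj homogeneous_linear_form] by simp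
    have "Fract (linear_form z) 1 * q \<in> loc 0 P" using loc_mult[OF Proj l q(1)] by simp
    moreover have "fract_map R (Fract (linear_form z) 1 * q) = Fract (pairing z N) ?X"
      using regular_mult(2)[OF hom regular_poly[OF hom] loc_regular[OF on q(1)]]
      by (simp add: fract_map_poly[OF hom] q(2) K(1)[OF z])
    ultimately show ?thesis using q(1) by blast
  next
    case False
    have "degree (pairing z N) \<le> d"
      unfolding pairing_def using degN by (intro degree_sum_le) (auto intro: order_trans[OF degree_smult_le])
    then show ?thesis using ex_lift_polynomial[OF on x, of "pairing z N" d 0] False by auto
  qed
  then obtain G where G: "\<And>z. G z \<in> loc 0 P" "\<And>z. fract_map R (G z) = Fract (pairing z N) ?X"
    "\<And>z. z \<in> T \<Longrightarrow> \<exists>q\<in>loc (- 1) P. G z = Fract (linear_form z) 1 * q" by metis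
  define Cf where "Cf k = Fract (const3 k) (1 :: 'k poly3)" for k
  have Cf_loc: "Cf k \<in> loc 0 P" for k
    using loc_poly[OF Proj homogeneous_const] by (simp add: Cf_def)
  have Cf_R: "fract_map R (Cf k) = Fract [:k:] 1" for k
    by (simp add: Cf_def fract_map_poly[OF hom] line_poly_const)
  have Cf_add: "Cf (k + l) = Cf k + Cf l" and Cf_mult: "Cf (k * l) = Cf k * Cf l"
    and Cf_01: "Cf 0 = 0" "Cf 1 = 1" for k l
    by (simp_all add: Cf_def C.add C.mult Frk.add Frk.mult Frk.zero Frk.one del: add_fract mult_fract)
  define t where "t = (\<chi> i. Cf (a' $ i) * G a + Cf (b' $ i) * G b + Cf (c' $ i) * G c)"
  have t_loc: "t $ i \<in> loc 0 P" for i
    using loc_mult[OF Proj Cf_loc G(1)] by (simp add: t_def loc_add[OF Proj])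
  have t_res: "fract_map R (t $ i) = Fract (N i) ?X" for i
  proof -
    have reg: "Cf k * G z \<in> regular R" for k z
      by (rule loc_regular[OF on loc_mult[OF Proj Cf_loc G(1)]])
    have fm: "fract_map R (Cf k * G z) = Fract [:k:] 1 * Fract (pairing z N) ?X" for k z
      using regular_mult(2)[OF hom loc_regular[OF on Cf_loc] loc_regular[OF on G(1)]] by (simp add: Cf_R G(2))
    have "fract_map R (t $ i) = Fract [:a' $ i:] 1 * Fract (pairing a N) ?X +
        Fract [:b' $ i:] 1 * Fract (pairing b N) ?X + Fract [:c' $ i:] 1 * Fract (pairing c N) ?X"
      unfolding t_def by (simp only: vec_lambda_beta regular_add[OF hom] reg fm)
    also have "\<dots> = Fract ([:a' $ i:] * pairing a N + [:b' $ i:] * pairing b N + [:c' $ i:] * pairing c N) 1 * Fract 1 ?X"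
      by (simp only: Fract_eq_mult[of "pairing z N" ?X for z] Fr.add Fr.mult) (simp only: algebra_simps)
    also have "[:a' $ i:] * pairing a N + [:b' $ i:] * pairing b N + [:c' $ i:] * pairing c N = N i"
    proof -
      have d: "a $ j * a' $ i + b $ j * b' $ i + c $ j * c' $ i = (if j = i then 1 else 0)" for j
        using bas by (simp add: dual_bases_def)
      have "[:a' $ i:] * pairing a N + [:b' $ i:] * pairing b N + [:c' $ i:] * pairing c N
          = (\<Sum>j\<in>UNIV. [:a $ j * a' $ i + b $ j * b' $ i + c $ j * c' $ i:] * N j)"
        unfolding pairing_def sum_distrib_left sum.distrib[symmetric]
        by (rule sum.cong) (simp_all add: algebra_simps smult_add_left)
      also have "\<dots> = (\<Sum>j\<in>UNIV. if j = i then N j else 0)"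
        unfolding d by (rule sum.cong) auto
      finally show ?thesis by simp
    qed
    finally show ?thesis by simp
  qed
  have app_t: "fract_pairing z t = Cf (dot z a') * G a + Cf (dot z b') * G b + Cf (dot z c') * G c" for z
    unfolding fract_pairing_def Cf_def[symmetric] t_def dot_def
    by (simp add: sum_3 Cf_add Cf_mult algebra_simps)
  have app_ab: "fract_pairing a t = G a" "fract_pairing b t = G b"
    using bas unfolding app_t by (simp_all add: dual_bases_def Cf_01)
  have "\<exists>q\<in>loc (- 1) P. fract_pairing s t = Fract (linear_form s) 1 * q" if s: "s \<in> S" for s
  proof (cases "s \<in> T")
    case True
    then have "s = a \<or> s = b" using ab(1) by blast
    then show ?thesis using G(3)[OF True] app_ab by auto
  next
    case False
    then have ls: "linear_form s \<notin> P" using s by (simp add: T_def)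
    have quot: "fract_pairing s t * Fract 1 (linear_form s) \<in> loc (0 + - 1) P"
      by (rule loc_mult[OF Proj fract_pairing_loc[OF Proj t_loc] loc_Fract[OF homogeneous_one homogeneous_linear_form ls]]) simp
    have "fract_pairing s t = Fract (linear_form s) 1 * (fract_pairing s t * Fract 1 (linear_form s))"
    proof -
      have "Fract (linear_form s) 1 * Fract 1 (linear_form s) = 1"
        using linear_form_nonzero[OF nonzero_S[OF s]] by (simp add: One_fract_def eq_fract)
      then show ?thesis by (metis mult.left_commute mult_1_right)
    qed
    then show ?thesis using quot by (intro bexI[of _ "fract_pairing s t * Fract 1 (linear_form s)"]) (simp only: add_0)+
  qed
  then obtain q where q: "\<And>s. s \<in> S \<Longrightarrow> q s \<in> loc (- 1) P"
    "\<And>s. s \<in> S \<Longrightarrow> fract_pairing s t = Fract (linear_form s) 1 * q s" by metis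
  have q_res: "fract_map R (q s) = Fract (K s) ?X" if s: "s \<in> S" for s
  proof -
    have "Fract (R (linear_form s)) 1 * fract_map R (q s) = fract_map R (fract_pairing s t)"
      unfolding q(2)[OF s] regular_mult(2)[OF hom regular_poly[OF hom] loc_regular[OF on q(1)[OF s]]]
      by (simp add: fract_map_poly[OF hom])
    also have "\<dots> = (\<Sum>i\<in>UNIV. Fract [:s $ i:] 1 * Fract (N i) ?X)"
      by (subst fract_map_fract_pairing(2)[OF loc_regular[OF on t_loc]]) (simp only: t_res)
    also have "\<dots> = Fract (pairing s N) 1 * Fract 1 ?X"
      unfolding pairing_def Fr.sum Fr.mult sum_distrib_right
      by (simp only: Fract_eq_mult[of "N i" ?X for i] mult.assoc)
    also have "\<dots> = Fract (R (linear_form s)) 1 * Fract (K s) ?X"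
      by (simp add: K(1)[OF s])
    finally have "Fract (R (linear_form s)) 1 * fract_map R (q s) = Fract (R (linear_form s)) 1 * Fract (K s) ?X" .
    moreover have "Fract (R (linear_form s)) 1 \<noteq> 0"
      using transversal[OF s] by (simp add: line_poly_linear_form Zero_fract_def eq_fract)
    ultimately show ?thesis using mult_left_cancel by blast
  qed
  \<comment> \<open>\<open>r\<close> is \<open>t(f) / (m f)\<close>; it vanishes on the line, and \<open>t - r E\<close> kills \<open>f\<close>\<close>
  define r where "r = Cf (1 / of_nat (card S)) * (\<Sum>s\<in>S. q s)"
  have r_loc: "r \<in> loc (- 1) P"
    unfolding r_def using loc_mult[OF Proj Cf_loc loc_sum[OF Proj q(1)]] by simp
  have r_res: "fract_map R r = 0"
  proof -
    have "fract_map R (\<Sum>s\<in>S. q s) = (\<Sum>s\<in>S. fract_map R (q s))"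
      by (rule regular_sum(2)[OF hom]) (rule loc_regular[OF on q(1)])
    also have "\<dots> = (\<Sum>s\<in>S. Fract (K s) 1 * Fract 1 ?X)"
      by (rule sum.cong) (simp_all add: q_res)
    also have "\<dots> = 0"
      unfolding sum_distrib_right[symmetric] Fr.sum[symmetric] sumK by (simp add: fract_collapse)
    finally show ?thesis
      unfolding r_def
      by (subst regular_mult(2)[OF hom loc_regular[OF on Cf_loc] loc_regular[OF on loc_sum[OF Proj q(1)]]]) simp_all
  qed
  define E where "E = ((\<chi> i. Fract (var3 i) 1) :: 'k ratf3 ^ 3)"
  have E_loc: "E $ i \<in> loc 1 P" for i
    using loc_poly[OF Proj homogeneous_var] by (simp add: E_def)
  have app_E: "fract_pairing s E = Fract (linear_form s) 1" for s
    unfolding fract_pairing_def E_def linear_form_eq_sum Frk.sum Frk.mult by simp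
  have rE_loc: "r * E $ i \<in> loc 0 P" for i using loc_mult[OF Proj r_loc E_loc] by simp
  define t' where "t' = t - r *s E"
  have t'_nth: "t' $ i = t $ i - r * E $ i" for i by (simp add: t'_def)
  have "t' $ i \<in> loc 0 P" for i unfolding t'_nth by (rule loc_diff[OF Proj t_loc rE_loc])
  moreover have "(\<Sum>i\<in>UNIV. t' $ i * grad $ i) = 0"
  proof -
    have "fract_pairing s t' * Fract (cofactor s) 1 = Fract F 1 * (q s - r)" if s: "s \<in> S" for s
    proof -
      have "fract_pairing s t' = fract_pairing s t - r * fract_pairing s E"
        unfolding fract_pairing_def t'_nth by (simp add: algebra_simps sum_subtractf sum_distrib_left)
      then have "fract_pairing s t' = Fract (linear_form s) 1 * (q s - r)"
        by (simp add: q(2)[OF s] app_E algebra_simps)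
      then show ?thesis by (simp add: F_eq[OF s] Frk.mult mult_ac del: mult_fract)
    qed
    then have "(\<Sum>i\<in>UNIV. t' $ i * grad $ i) = Fract F 1 * (\<Sum>s\<in>S. q s - r)"
      by (simp add: grad_pairing sum_distrib_left)
    also have "(\<Sum>s\<in>S. q s - r) = 0"
    proof (cases "S = {}")
      case False
      have "of_nat (card S) * Cf (1 / of_nat (card S)) = Cf (of_nat (card S) * (1 / of_nat (card S)))"
        by (simp only: Cf_mult) (simp only: Cf_def C.of_nat Frk.of_nat)
      also have "\<dots> = 1" using False finite_S by (simp add: Cf_01)
      finally show ?thesis by (simp add: sum_subtractf r_def mult.assoc[symmetric])
    qed simp
    finally show ?thesis by simp
  qed
  ultimately have "t' \<in> ker_stalk 0 grad P" by (simp add: ker_stalk_def)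
  moreover have "res t' = (\<chi> i. Fract (N i) ?X)"
  proof -
    have "fract_map R (t' $ i) = Fract (N i) ?X" for i
      unfolding t'_nth regular_diff(2)[OF hom loc_regular[OF on t_loc] loc_regular[OF on rE_loc]]
        regular_mult(2)[OF hom loc_regular[OF on r_loc] loc_regular[OF on E_loc]]
      by (simp add: t_res r_res)
    then show ?thesis by (simp add: res_def)
  qed
  ultimately show ?thesis by blast
qed

lemma curve_imp_twisted:
  assumes g: "curve d g" and few: "\<And>P. on_line P \<Longrightarrow> card {s \<in> S. linear_form s \<in> P} \<le> 2"
  shows "\<exists>u\<in>twisted (int d) 0 grad. u \<noteq> 0"
proof -
  obtain N K i where N: "tangent_data d N K" "N i \<noteq> 0"
    using curve_imp_tangent_data[OF g] by blast
  define u where "u = (\<chi> i. Fract (N i) 1)"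
  have lift: "(\<chi> i. Fract (N i) (R (linear_form x) ^ d)) \<in> line_sections 0 grad (chart x)" for x
    using tangent_data_lifts[OF N(1)] few by (auto simp: line_sections_def chart_def)
  have "u \<in> line_sections 0 grad (chart x0)" using lift[of x0] by (simp add: u_def R_x0)
  moreover have "(\<tau> powi (- int d)) *s u = (\<chi> i. Fract (N i) (R (linear_form x1) ^ d))"
    unfolding power_int_minus power_int_of_nat
    by (simp add: vec_eq_iff u_def \<tau>_def Fract_power R_x1)
  then have "(\<tau> powi (- int d)) *s u \<in> line_sections 0 grad (chart x1)" using lift[of x1] by simp
  moreover have "u \<noteq> 0" using N(2) by (auto simp: u_def vec_eq_iff Zero_fract_def eq_fract)
  ultimately show ?thesis unfolding twisted_def by blast
qed

end

section \<open>Points of the dual plane\<close>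

lemma dual_point_eq_multiples:
  assumes "U \<in> dual_points" and "v \<in> U" and "v \<noteq> 0"
  shows "U = range (\<lambda>c. c *s v)"
proof -
  have U: "vec.subspace U" "vec.dim U = 1" using assms(1) by (auto simp: dual_points_def)
  have "vec.independent {v}" using assms(3) by (simp add: vec.dependent_single)
  then have "vec.dim (vec.span {v}) = 1" by (simp add: vec.dim_span_eq_card_independent)
  moreover have "vec.span {v} \<subseteq> U" using assms(2) U(1) by (simp add: vec.span_minimal)
  ultimately have "vec.span {v} = U"
    using U by (intro vec.subspace_dim_equal) auto
  then show ?thesis by (simp add: vec.span_singleton)
qed

lemma ex_dual_point_generator:
  assumes "U \<in> dual_points"
  shows "\<exists>v. v \<noteq> 0 \<and> U = range (\<lambda>c. c *s v)"
proof -
  have "vec.dim U = 1" using assms by (simp add: dual_points_def)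
  then have "\<not> U \<subseteq> {0}" using vec.dim_eq_0[of U] by auto
  then obtain v where "v \<in> U" "v \<noteq> 0" by blast
  then show ?thesis using dual_point_eq_multiples[OF assms] by blast
qed

lemma cross_eq_0_imp_multiple:
  assumes "cross a b = (0 :: 'k::field ^ 3)" and "a \<noteq> 0"
  shows "\<exists>c. b = c *s a"
proof -
  obtain j where j: "a $ j \<noteq> 0" using assms(2) by (auto simp: vec_eq_iff)
  have "a $ i * b $ k = a $ k * b $ i" for i k
    using assms(1) exhaust_3[of i] exhaust_3[of k]
    by (auto simp: vec_eq_iff forall_3 cross_expand algebra_simps)
  then have "b = (b $ j / a $ j) *s a" using j by (simp add: vec_eq_iff field_simps)
  then show ?thesis by blast
qed

lemma cross_anticommute: "cross a b = - cross b a"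
  by (simp add: vec_eq_iff forall_3 cross_expand)

lemma dual_bases_rotate: "dual_bases a b c a' b' c' \<Longrightarrow> dual_bases b c a b' c' a'"
  by (auto simp: dual_bases_def add_ac)

context line_frame
begin

text \<open>
  The forms vanishing at a point are a proper subspace, since a point of the projective plane is not the
  origin.  Hence lines of the arrangement that meet in a point of \<open>w = 0\<close> are points of the dual plane on a
  line through \<open>w\<close>.
\<close>

lemma forms_at_point_dual_line:
  assumes on: "on_line P" and s: "linear_form s \<in> P" "cross w s \<noteq> 0"
  shows "{v. linear_form v \<in> P} \<in> dual_lines"
proof -
  let ?L = "{v. linear_form v \<in> P}"
  note Proj = on_lineD(1)[OF on]
  have sub: "vec.subspace ?L"
    using ProjD(1,3,4)[OF Proj]
    by (auto simp: vec.subspace_def linear_form_add linear_form_scale) (simp add: linear_form_def)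
  have "?L \<noteq> UNIV" using ProjD(7)[OF Proj] by blast
  have "vec.dim ?L \<noteq> CARD(3)"
  proof
    assume dim: "vec.dim ?L = CARD(3)"
    have "vec.dim (UNIV :: ('k ^ 3) set) \<le> vec.dim ?L" unfolding vec_dim_card dim by (rule order_refl)
    from vec.subspace_dim_equal[OF sub vec.subspace_UNIV subset_UNIV this]
    show False using \<open>?L \<noteq> UNIV\<close> by contradiction
  qed
  moreover have "vec.dim ?L \<le> CARD(3)" by (rule dim_subset_UNIV_cart_gen)
  moreover have "2 \<le> vec.dim ?L"
  proof -
    have ns: "s \<notin> vec.span {w}"
    proof
      assume "s \<in> vec.span {w}"
      then obtain c where "s = c *s w" by (auto simp: vec.span_singleton)
      then show False using s(2) by (simp add: vec_eq_iff forall_3 cross_expand)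
    qed
    then have "vec.independent {s, w}"
      using w_nonzero by (intro vec.independent_insertI) (simp_all add: vec.dependent_single vec.independent_empty)
    moreover have "s \<noteq> w" using ns vec.span_base by blast
    moreover have "{s, w} \<subseteq> ?L" using s(1) on_lineD(2)[OF on] by simp
    ultimately show ?thesis using vec.independent_card_le_dim[of "{s, w}" ?L] by simp
  qed
  ultimately have "vec.dim ?L = 2" by simp
  then show ?thesis using sub by (simp add: dual_lines_def)
qed

end

context arrangement
begin

text \<open>
  For an empty arrangement the bundle is trivial of rank three and Euler's formula says nothing; then a line
  of the dual plane is a curve with \<open>d = 0\<close>.
\<close>
lemma twisted_imp_some_curve:
  assumes u: "u \<in> twisted d 0 grad" "u \<noteq> 0"
  shows "0 \<le> d \<and> (\<exists>k\<le>nat d. \<exists>g. curve k g)"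
proof (cases "S = {}")
  case False
  then show ?thesis using twisted_imp_curve[OF u] by blast
next
  case True
  obtain i where i: "u $ i \<noteq> 0" using u(2) by (auto simp: vec_eq_iff)
  obtain N where N: "u $ i = Fract N 1" "N = 0 \<or> int (degree N) \<le> d"
    using twisted_polynomial[OF u(1), of i] by auto
  have "N \<noteq> 0" using i N(1) by (auto simp: Zero_fract_def)
  then have "0 \<le> d" using N(2) by linarith
  have "linear_form w * 1 \<in> module.span (*) (point_ideal dual_pt ^ 0)"
    by (rule module.span_scale[OF module_mult module.span_base[OF module_mult]]) simp
  moreover have "1 \<notin> point_ideal dual_pt"
    by (simp add: point_ideal_def unital_hom.one[OF evalp_hom])
  ultimately have "multiplicity_at_least (linear_form w) dual_pt 0"
    unfolding multiplicity_at_least_def by (metis mult.commute)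
  then have "curve 0 (linear_form w)"
    unfolding curve_def using True linear_form_nonzero[OF w_nonzero] homogeneous_linear_form[of w] by simp
  then show ?thesis using \<open>0 \<le> d\<close> by blast
qed

text \<open>
  Both numbers are the least \<open>d\<close> such that the \<open>d\<close>-th twist of the restricted bundle has a nonzero section.
\<close>
lemma splitting_exponent:
  assumes few: "\<And>P. on_line P \<Longrightarrow> card {s \<in> S. linear_form s \<in> P} \<le> 2"
    and split: "splits_on_line F dual_pt a b" and "a \<le> b"
  shows "a = int (LEAST d. \<exists>g. curve d g)"
proof -
  define D where "D = (LEAST d. \<exists>g. curve d g)"
  have "restr_iso (ker_sheaf 0 grad) (ker_sheaf (vector [- a, - b] :: int ^ 2) 0) dual_pt"
    using split
    unfolding splits_on_line_def log_tangent_eq_ker_sheaf twist_sum_eq_ker_sheaf grad_def[symmetric] .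
  note transfer = twisted_transfer[OF this]
  obtain u where "u \<in> twisted a 0 grad" "u \<noteq> 0"
    using iffD2[OF transfer ex_nonzero_twisted_sum] by blast
  from twisted_imp_some_curve[OF this] obtain k g where k: "0 \<le> a" "k \<le> nat a" "curve k g" by blast
  have "\<exists>g. curve D g" unfolding D_def by (rule LeastI[of _ k]) (use k in blast)
  moreover have "D \<le> k" unfolding D_def by (rule Least_le) (use k in blast)
  ultimately obtain g' where "curve D g'" "D \<le> k" by blast
  from iffD1[OF transfer curve_imp_twisted[OF this(1) few]] obtain u'
    where "u' \<in> twisted (int D) (vector [- a, - b] :: int ^ 2) 0" "u' \<noteq> 0" by blast
  from nonzero_twisted_sum_imp[OF this \<open>a \<le> b\<close>] show ?thesis
    using k \<open>D \<le> k\<close> unfolding D_def by linarith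
qed

end

theorem theorem3:
  fixes Z :: "('k::field_char_0 ^ 3) set set" and y :: "('k ^ 3) set"
    and form :: "('k ^ 3) set \<Rightarrow> 'k ^ 3" and a b :: int
  assumes "finite Z" and "Z \<subseteq> dual_points"
    and "y \<in> dual_points" and "y \<notin> Z"
    and "\<And>z. z \<in> Z \<Longrightarrow> form z \<in> z \<and> form z \<noteq> 0"
    and "\<not> (\<exists>L. trisecant Z L \<and> y \<subseteq> L)"
    and "a \<le> b"
    and "splits_on_line (\<Prod>z\<in>Z. linear_form (form z)) y a b"
  shows "a = int (d_number Z y)"
proof -
  obtain w where w: "w \<noteq> 0" "y = range (\<lambda>c. c *s w)"
    using ex_dual_point_generator[OF assms(3)] by blast
  have z_eq: "z = range (\<lambda>c. c *s form z)" if "z \<in> Z" for z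
    using dual_point_eq_multiples[of z "form z"] assms(2,5) that by blast
  have cross_z: "cross (form z) v \<noteq> 0" if z: "z \<in> Z" and U: "U = range (\<lambda>c. c *s v)" "U \<noteq> z" "v \<noteq> 0" "U \<in> dual_points" for z v U
  proof
    assume "cross (form z) v = 0"
    then obtain c where "v = c *s form z" using cross_eq_0_imp_multiple assms(5)[OF z] by blast
    then have "v \<in> z" by (subst z_eq[OF z]) blast
    then have "z = U" using dual_point_eq_multiples[of z v] assms(2) z U by blast
    then show False using U(2) by simp
  qed
  have inj: "inj_on form Z"
  proof (rule inj_onI)
    fix z z' assume z: "z \<in> Z" "z' \<in> Z" "form z = form z'"
    then show "z = z'" using z_eq[OF z(1)] z_eq[OF z(2)] by simp
  qed
  define S where "S = form ` Z"
  \<comment> \<open>a coordinate frame whose point at infinity of \<open>H\<^sub>y\<close> lies on no line of the arrangement\<close>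
  obtain b0 where b0: "cross w b0 \<noteq> 0" using ex_cross_nonzero[OF w(1)] by blast
  have "\<exists>v. \<forall>s\<in>insert b0 S. dot s (cross w v) \<noteq> 0"
  proof (rule ex_cross_avoiding)
    show "finite (insert b0 S)" using assms(1) by (simp add: S_def)
    fix s assume "s \<in> insert b0 S"
    then consider "s = b0" | z where "z \<in> Z" "s = form z" by (auto simp: S_def)
    then show "cross s w \<noteq> 0"
    proof cases
      case 1
      then show ?thesis using b0 cross_anticommute[of b0 w] by simp
    next
      case 2
      then show ?thesis using cross_z[OF 2(1) w(2) _ w(1) assms(3)] assms(4) by auto
    qed
  qed
  then obtain x0 where x0: "dot b0 (cross w x0) \<noteq> 0" "\<And>s. s \<in> S \<Longrightarrow> dot s (cross w x0) \<noteq> 0" by blast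
  have "cross w x0 \<noteq> 0" using x0(1) by (auto simp: dot_def)
  then obtain x1 where "dual_bases w x0 x1 (cross x0 x1) (cross x1 w) (cross w x0)"
    by (rule ex_dual_bases)
  from dual_bases_rotate[OF this]
  interpret arrangement w x0 x1 "cross x1 w" "cross w x0" "cross x0 x1" S
  proof unfold_locales
    show "finite S" using assms(1) by (simp add: S_def)
    show "cross s s' \<noteq> 0" if "s \<in> S" "s' \<in> S" "s \<noteq> s'" for s s'
    proof -
      obtain z z' where z: "z \<in> Z" "s = form z" "z' \<in> Z" "s' = form z'" using \<open>s \<in> S\<close> \<open>s' \<in> S\<close> by (auto simp: S_def)
      then have "z' \<noteq> z" using \<open>s \<noteq> s'\<close> by auto
      then show ?thesis using cross_z[OF z(1) z_eq[OF z(3)]] assms(2,5) z by blast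
    qed
    show "dot s (cross w x0) \<noteq> 0" if "s \<in> S" for s by (rule x0(2)[OF that])
  qed
  have few: "card {s \<in> S. linear_form s \<in> P} \<le> 2" if P: "on_line P" for P
  proof (rule ccontr)
    assume "\<not> card {s \<in> S. linear_form s \<in> P} \<le> 2"
    then have three: "card {s \<in> S. linear_form s \<in> P} \<ge> 3" by simp
    let ?L = "{v. linear_form v \<in> P}"
    have inL: "z \<subseteq> ?L \<longleftrightarrow> linear_form (form z) \<in> P" if z: "z \<in> Z" for z
    proof
      show "linear_form (form z) \<in> P" if "z \<subseteq> ?L" using that assms(5)[OF z] by blast
      show "z \<subseteq> ?L" if "linear_form (form z) \<in> P"
        by (subst z_eq[OF z]) (use that ProjD(4)[OF on_lineD(1)[OF P]] in \<open>auto simp: linear_form_scale\<close>)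
    qed
    have "{s \<in> S. linear_form s \<in> P} \<noteq> {}"
      using three by (metis card.empty not_numeral_le_zero)
    then obtain z where z: "z \<in> Z" "linear_form (form z) \<in> P" by (auto simp: S_def)
    have "cross w (form z) \<noteq> 0"
      using cross_z[OF z(1) w(2) _ w(1) assms(3)] assms(4) z(1) cross_anticommute[of w "form z"] by auto
    then have "?L \<in> dual_lines" by (rule forms_at_point_dual_line[OF P z(2)])
    moreover have "form ` {z \<in> Z. z \<subseteq> ?L} = {s \<in> S. linear_form s \<in> P}"
      using inL by (auto simp: S_def)
    then have "card {z \<in> Z. z \<subseteq> ?L} = card {s \<in> S. linear_form s \<in> P}"
      using card_image[of form "{z \<in> Z. z \<subseteq> ?L}"] inj by (metis (no_types, lifting) inj_on_subset mem_Collect_eq subsetI)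
    ultimately have "trisecant Z ?L" using three by (simp add: trisecant_def)
    moreover have "y \<subseteq> ?L"
      unfolding w(2) using on_lineD(2)[OF P] ProjD(4)[OF on_lineD(1)[OF P]] by (auto simp: linear_form_scale)
    ultimately show False using assms(6) by blast
  qed
  have F: "F = (\<Prod>z\<in>Z. linear_form (form z))"
    by (simp only: F_def) (simp add: S_def prod.reindex[OF inj])
  have "(\<forall>s\<in>S. \<forall>c. evalp g (c *s s) = 0) \<longleftrightarrow> (\<forall>z\<in>Z. g \<in> point_ideal z)" for g
  proof -
    have "g \<in> point_ideal z \<longleftrightarrow> (\<forall>c. evalp g (c *s form z) = 0)" if "z \<in> Z" for z
      by (subst z_eq[OF that]) (auto simp: point_ideal_def)
    then show ?thesis by (simp add: S_def)
  qed
  then have "d_number Z y = (LEAST d. \<exists>g. curve d g)"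
    unfolding d_number_def curve_def w(2) by simp
  then show ?thesis
    using splitting_exponent[OF few _ assms(7)] assms(8) unfolding F w(2) by simp
qed

end
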